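(* Let $\mathfrak g=\mathfrak g(A,\Psi)$ be a BKM superalgebra with quasi Dynkin diagram $(G,\Psi)$ (vertex set $I$), let $\mathbf k\in\mathbb Z_+[I]$ satisfy $k_j\le1$ for $j\in I^{re}\sqcup\Psi_0$, and fix $i\in I$, assumed to be the least element in the total order on $I$. Then the set $\{\iota(\mathbf w):\mathbf w\in C^i(\mathbf k,G)\}$ is a basis of the root space $\mathfrak g_{\eta(\mathbf k)}$. Moreover, if $k_i=1$, the set $\{e(\mathbf w):\mathbf w\in\mathcal X_i,\ \operatorname{wt}(\mathbf w)=\eta(\mathbf k)\}$ forms a left-normed basis of $\mathfrak g_{\eta(\mathbf k)}$.
   Context: BKM superalgebras (over $\mathbb C$). Let $I=\{1,\dots,n\}$ or $I=\mathbb N$, and $\Psi\subseteq I$. A BKM supermatrix is a matrix $A=(a_{ij})_{i,j\in I}$ together with $\Psi$ such that: $a_{ii}=2$ or $a_{ii}\le 0$; $a_{ij}\le 0$ if $i\ne j$; $a_{ij}=0\iff a_{ji}=0$; $a_{ij}\in\mathbb Z$ if $a_{ii}=2$; $a_{ij}\in 2\mathbb Z$ if $a_{ii}=2$ and $i\in\Psi$; $A$ is symmetrizable ($DA$ symmetric for some diagonal $D$ with positive entries). Put $I^{re}=\{i:a_{ii}=2\}$, $\Psi^{re}=\Psi\cap I^{re}$, $\Psi_0=\{i\in\Psi:a_{ii}=0\}$. The BKM superalgebra $\mathfrak g(A,\Psi)$ is the Lie superalgebra generated by $e_i,f_i,h_i$ ($i\in I$), with $h_i$ even, $e_i,f_i$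 odd if $i\in\Psi$ and even otherwise, and relations: $[h_i,h_j]=0$; $[h_i,e_j]=a_{ij}e_j$, $[h_i,f_j]=-a_{ij}f_j$; $[e_i,f_j]=\delta_{ij}h_i$; $(\mathrm{ad}\,e_i)^{1-a_{ij}}e_j=0=(\mathrm{ad}\,f_i)^{1-a_{ij}}f_j$ if $i\in I^{re}$, $i\neq j$; $(\mathrm{ad}\,e_i)^{1-a_{ij}/2}e_j=0=(\mathrm{ad}\,f_i)^{1-a_{ij}/2}f_j$ if $i\in\Psi^{re}$, $i\ne j$; $[e_i,e_i]=0=[f_i,f_i]$ if $i\in\Psi_0$; $[e_i,e_j]=0=[f_i,f_j]$ if $a_{ij}=0$. $\mathfrak g$ is graded by $Q=\bigoplus_{i}\mathbb Z\alpha_i$ with $\deg e_i=\alpha_i$, $\deg f_i=-\alpha_i$, $\deg h_i=0$; $\mathfrak g_\alpha$ is the graded component (root space). The quasi Dynkin diagram is the simple graph $G$ on $I$ with $i, j$ adjacent iff $a_{ij}\ne0$, together with the set $\Psi$ of odd vertices. $\mathbb Z_+[I]$: finitely supported tuples $\mathbf k=(k_i)$ of non-negative integers; $\eta(\mathbf k)=\sum k_i\alpha_i$. Words. $I$ is totally ordered. $M(I,G)=I^*/\!\sim$ is the free partially commutative monoid, $\sim$ generated by $ab\sim ba$ for non-adjacent $a,b$. It is totally ordered by comparing lexicographically the lexicographically largest representatives (standard words). $\operatorname{wt}(\mathbf w)=\sum_j j(\mathbf w)\alpha_j$ with $j(\mathbf w)$ the number of occurrences of $j$ in $\mathbf w$.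 $\mathbf w$ is odd if it contains an odd number of letters of $\Psi$, otherwise even. The initial multiplicity of $j$ in $\mathbf w$ is the largest $m\ge0$ with $\mathbf w=j^m\mathbf u$ for some $\mathbf u\in M(I,G)$; $\mathrm{IA}_m(\mathbf w)$ is the multiset in which each $j$ occurs as often as its initial multiplicity. The left normed Lie word associated with $\mathbf w$, where $a_1\cdots a_r$ is an element of the class $\mathbf w$, is $e(\mathbf w)=[[\cdots[[e_{a_1},e_{a_2}],e_{a_3}]\cdots,e_{a_{r-1}}],e_{a_r}]\in\mathfrak g$; the association $\mathbf w\mapsto e(\mathbf w)$ is taken to be well defined on $M(I,G)$. $\mathcal X_i=\{\mathbf w\in M(I,G):\mathrm{IA}_m(\mathbf w)=\{i\},\ i(\mathbf w)=1\}$, with the induced total order and $\mathbb Z_2$-grading; $\mathcal X_i^*$ is the free monoid on the alphabet $\mathcal X_i$, ordered lexicographically, with induced weight and $\mathbb Z_2$-grading. A nonempty $\mathbf w\in\mathcal X_i^*$ is Lyndon if it is strictly smaller than all its proper cyclic rotations; super Lyndon if it is Lyndon or $\mathbf w=\mathbf u\mathbf u$ with $\mathbf u$ an odd Lyndon word. Standard factorization: for a Lyndon word not in $\mathcal X_i$, $\mathbf w=\mathbf u\mathbf v$ with $\mathbf u<\mathbf v$ Lyndon and $\mathbf v$ of maximal length; for $\mathbf w=\mathbf u\mathbf u$ it is $(\mathbf u,\mathbf u)$. $FLS(\mathcal X_i)$ is the free Lie superalgebra on $\mathcal X_i$; $L(\mathbf w)=\mathbf w$ if $\mathbf w\in\mathcal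 X_i$, else $L(\mathbf w)=[L(\mathbf u),L(\mathbf v)]$ with $\mathbf w=\mathbf u\mathbf v$ the standard factorization. $\Phi:FLS(\mathcal X_i)\to\mathfrak g$ is the Lie superalgebra homomorphism with $\Phi(\mathbf w)=e(\mathbf w)$ for $\mathbf w\in\mathcal X_i$. $C^i(\mathbf k,G)=\{\mathbf w\in\mathcal X_i^*:\mathbf w\text{ super Lyndon},\ \operatorname{wt}(\mathbf w)=\eta(\mathbf k)\}$ and $\iota(\mathbf w)=\Phi(L(\mathbf w))$.
   Formalization: Proved for k_i ≥ 1 (if k_i = 0, C^i(k,G) is empty while the root space may be nonzero), and with the relation of exponent 1−a_ij/2 for i in Ψ^re read with ad[e_i,e_i], ad[f_i,f_i] instead of ad e_i, ad f_i, which would force e_j = 0 when a_ij ≠ 0. *)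

theory Defs
  imports Complex_Main "HOL-Algebra.Module" "HOL-Library.Poly_Mapping"
    "HOL-Library.Countable" "HOL-Library.Multiset"
begin

section \<open>Superalgebras over the complex numbers\<close>

text \<open>
  The bracket is the multiplication \<open>\<otimes>\<close> of the underlying record; the field \<open>one\<close> plays no role.
  \<open>part False\<close> is the even part and \<open>part True\<close> the odd part.
\<close>

record 'v superalgebra = "(complex, 'v) module" +
  part :: "bool \<Rightarrow> 'v set"

definition superalgebra_hom ::
    "('v, 'm) superalgebra_scheme \<Rightarrow> ('w, 'n) superalgebra_scheme \<Rightarrow> ('v \<Rightarrow> 'w) set" where
  "superalgebra_hom g h = {\<phi>. \<phi> \<in> carrier g \<rightarrow> carrier h
     \<and> (\<forall>x\<in>carrier g. \<forall>y\<in>carrier g. \<phi> (x \<oplus>\<^bsub>g\<^esub> y) = \<phi> x \<oplus>\<^bsub>h\<^esub> \<phi> y)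
     \<and> (\<forall>c. \<forall>x\<in>carrier g. \<phi> (c \<odot>\<^bsub>g\<^esub> x) = c \<odot>\<^bsub>h\<^esub> \<phi> x)
     \<and> (\<forall>x\<in>carrier g. \<forall>y\<in>carrier g. \<phi> (x \<otimes>\<^bsub>g\<^esub> y) = \<phi> x \<otimes>\<^bsub>h\<^esub> \<phi> y)
     \<and> (\<forall>b. \<phi> ` part g b \<subseteq> part h b)}"

definition lin_independent :: "('v, 'm) superalgebra_scheme \<Rightarrow> 'v set \<Rightarrow> bool" where
  "lin_independent g B \<longleftrightarrow> (\<forall>S c. finite S \<longrightarrow> S \<subseteq> B \<longrightarrow>
     (\<Oplus>\<^bsub>g\<^esub>x\<in>S. c x \<odot>\<^bsub>g\<^esub> x) = \<zero>\<^bsub>g\<^esub> \<longrightarrow> (\<forall>x\<in>S. c x = 0))"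

definition lin_span :: "('v, 'm) superalgebra_scheme \<Rightarrow> 'v set \<Rightarrow> 'v set" where
  "lin_span g B = {(\<Oplus>\<^bsub>g\<^esub>x\<in>S. c x \<odot>\<^bsub>g\<^esub> x) | S c. finite S \<and> S \<subseteq> B}"

definition is_basis :: "('v, 'm) superalgebra_scheme \<Rightarrow> 'v set \<Rightarrow> 'v set \<Rightarrow> bool" where
  "is_basis g V B \<longleftrightarrow> B \<subseteq> V \<and> lin_independent g B \<and> lin_span g B = V"


section \<open>Lie superalgebras given by generators and relations\<close>

datatype 'x magma = Gen 'x | Br "'x magma" "'x magma"

primrec magma_odd :: "('x \<Rightarrow> bool) \<Rightarrow> 'x magma \<Rightarrow> bool" where
  "magma_odd od (Gen x) = od x"
| "magma_odd od (Br s t) = (magma_odd od s \<noteq> magma_odd od t)"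

primrec magma_deg :: "('x \<Rightarrow> 'q::plus) \<Rightarrow> 'x magma \<Rightarrow> 'q" where
  "magma_deg d (Gen x) = d x"
| "magma_deg d (Br s t) = magma_deg d s + magma_deg d t"

text \<open>
  Elements of the free nonassociative algebra on all of \<open>'x\<close> are finitely supported functions on
  the free magma; \<open>fna X\<close> is the free nonassociative algebra on the alphabet \<open>X\<close>.
\<close>

type_synonym 'x na = "'x magma \<Rightarrow>\<^sub>0 complex"

definition magma_on :: "'x set \<Rightarrow> 'x magma set" where
  "magma_on X = {t. set_magma t \<subseteq> X}"

definition fna :: "'x set \<Rightarrow> 'x na set" where
  "fna X = {p. Poly_Mapping.keys p \<subseteq> magma_on X}"

definition mon :: "'x magma \<Rightarrow> 'x na" where
  "mon t = Poly_Mapping.single t 1"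

abbreviation gen :: "'x \<Rightarrow> 'x na" where
  "gen x \<equiv> mon (Gen x)"

definition scl :: "complex \<Rightarrow> 'x na \<Rightarrow> 'x na" where
  "scl c p = Poly_Mapping.map (\<lambda>a. c * a) p"

definition br :: "'x na \<Rightarrow> 'x na \<Rightarrow> 'x na" where
  "br p q = (\<Sum>s\<in>Poly_Mapping.keys p. \<Sum>t\<in>Poly_Mapping.keys q.
     Poly_Mapping.single (Br s t) (Poly_Mapping.lookup p s * Poly_Mapping.lookup q t))"

inductive_set two_sided_ideal :: "'x set \<Rightarrow> 'x na set \<Rightarrow> 'x na set" for X R where
  base: "r \<in> R \<Longrightarrow> r \<in> two_sided_ideal X R"
| zero: "0 \<in> two_sided_ideal X R"
| add: "p \<in> two_sided_ideal X R \<Longrightarrow> q \<in> two_sided_ideal X R \<Longrightarrow> p + q \<in> two_sided_ideal X R"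
| scale: "p \<in> two_sided_ideal X R \<Longrightarrow> scl c p \<in> two_sided_ideal X R"
| left: "p \<in> two_sided_ideal X R \<Longrightarrow> q \<in> fna X \<Longrightarrow> br q p \<in> two_sided_ideal X R"
| right: "p \<in> two_sided_ideal X R \<Longrightarrow> q \<in> fna X \<Longrightarrow> br p q \<in> two_sided_ideal X R"

definition koszul :: "bool \<Rightarrow> bool \<Rightarrow> complex" where
  "koszul a b = (if a \<and> b then -1 else 1)"

text \<open>Super skew symmetry and super Jacobi identity on monomials.\<close>

definition lie_axioms :: "'x set \<Rightarrow> ('x \<Rightarrow> bool) \<Rightarrow> 'x na set" where
  "lie_axioms X od =
     {mon (Br s t) + scl (koszul (magma_odd od s) (magma_odd od t)) (mon (Br t s)) | s t.
        s \<in> magma_on X \<and> t \<in> magma_on X}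
   \<union> {mon (Br s (Br t u)) - mon (Br (Br s t) u)
        - scl (koszul (magma_odd od s) (magma_odd od t)) (mon (Br t (Br s u))) | s t u.
        s \<in> magma_on X \<and> t \<in> magma_on X \<and> u \<in> magma_on X}"

definition lie_class :: "'x set \<Rightarrow> ('x \<Rightarrow> bool) \<Rightarrow> 'x na set \<Rightarrow> 'x na \<Rightarrow> 'x na set" where
  "lie_class X od R p = {q \<in> fna X. q - p \<in> two_sided_ideal X (lie_axioms X od \<union> R)}"

text \<open>
  The Lie superalgebra with generators \<open>X\<close>, of parity \<open>od\<close>, and relations \<open>r = 0\<close> for \<open>r \<in> R\<close>
  (\<open>R\<close> is meant to consist of parity homogeneous elements of \<open>fna X\<close>). Its elements are cosets.
\<close>

definition lie_presented ::
    "'x set \<Rightarrow> ('x \<Rightarrow> bool) \<Rightarrow> 'x na set \<Rightarrow> 'x na set superalgebra" where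
  "lie_presented X od R =
     \<lparr> carrier = lie_class X od R ` fna X,
       monoid.mult = (\<lambda>C D. \<Union>p\<in>C. \<Union>q\<in>D. lie_class X od R (br p q)),
       one = undefined,
       zero = lie_class X od R 0,
       add = (\<lambda>C D. \<Union>p\<in>C. \<Union>q\<in>D. lie_class X od R (p + q)),
       smult = (\<lambda>c C. \<Union>p\<in>C. lie_class X od R (scl c p)),
       part = (\<lambda>b. lie_class X od R ` {p \<in> fna X. \<forall>t\<in>Poly_Mapping.keys p. magma_odd od t = b}) \<rparr>"

text \<open>Graded component of degree \<open>\<gamma>\<close> when the generator \<open>x\<close> has degree \<open>d x\<close>.\<close>

definition lie_component ::
    "'x set \<Rightarrow> ('x \<Rightarrow> bool) \<Rightarrow> 'x na set \<Rightarrow> ('x \<Rightarrow> 'q::plus) \<Rightarrow> 'q \<Rightarrow> 'x na set set" where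
  "lie_component X od R d \<gamma> =
     lie_class X od R ` {p \<in> fna X. \<forall>t\<in>Poly_Mapping.keys p. magma_deg d t = \<gamma>}"

definition fls :: "'x set \<Rightarrow> ('x \<Rightarrow> bool) \<Rightarrow> 'x na set superalgebra" where
  "fls X od = lie_presented X od {}"

definition fls_gen :: "'x set \<Rightarrow> ('x \<Rightarrow> bool) \<Rightarrow> 'x \<Rightarrow> 'x na set" where
  "fls_gen X od x = lie_class X od {} (gen x)"


section \<open>BKM superalgebras\<close>

definition I_re :: "('i \<Rightarrow> 'i \<Rightarrow> real) \<Rightarrow> 'i set" where
  "I_re A = {i. A i i = 2}"

definition Psi_re :: "('i \<Rightarrow> 'i \<Rightarrow> real) \<Rightarrow> 'i set \<Rightarrow> 'i set" where
  "Psi_re A \<Psi> = \<Psi> \<inter> I_re A"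

definition Psi_0 :: "('i \<Rightarrow> 'i \<Rightarrow> real) \<Rightarrow> 'i set \<Rightarrow> 'i set" where
  "Psi_0 A \<Psi> = {i \<in> \<Psi>. A i i = 0}"

definition bkm_supermatrix :: "('i \<Rightarrow> 'i \<Rightarrow> real) \<Rightarrow> 'i set \<Rightarrow> bool" where
  "bkm_supermatrix A \<Psi> \<longleftrightarrow>
     (\<forall>i. A i i = 2 \<or> A i i \<le> 0) \<and>
     (\<forall>i j. i \<noteq> j \<longrightarrow> A i j \<le> 0) \<and>
     (\<forall>i j. A i j = 0 \<longleftrightarrow> A j i = 0) \<and>
     (\<forall>i j. A i i = 2 \<longrightarrow> A i j \<in> \<int>) \<and>
     (\<forall>i j. A i i = 2 \<longrightarrow> i \<in> \<Psi> \<longrightarrow> (\<exists>z::int. A i j = 2 * of_int z)) \<and>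
     (\<exists>d. (\<forall>i. d i > 0) \<and> (\<forall>i j. d i * A i j = d j * A j i))"

datatype 'i bkm_gen = Egen 'i | Fgen 'i | Hgen 'i

primrec bkm_odd :: "'i set \<Rightarrow> 'i bkm_gen \<Rightarrow> bool" where
  "bkm_odd \<Psi> (Egen i) = (i \<in> \<Psi>)"
| "bkm_odd \<Psi> (Fgen i) = (i \<in> \<Psi>)"
| "bkm_odd \<Psi> (Hgen i) = False"

primrec bkm_deg :: "'i bkm_gen \<Rightarrow> ('i \<Rightarrow>\<^sub>0 int)" where
  "bkm_deg (Egen i) = Poly_Mapping.single i 1"
| "bkm_deg (Fgen i) = - Poly_Mapping.single i 1"
| "bkm_deg (Hgen i) = 0"

text \<open>
  The exponents \<open>1 - a\<^sub>i\<^sub>j\<close> and \<open>1 - a\<^sub>i\<^sub>j/2\<close> are natural numbers for a BKM supermatrix, and are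
  described by the equation they satisfy over the reals.

  The relation with exponent \<open>1 - a\<^sub>i\<^sub>j/2\<close> for odd real \<open>i\<close> is sometimes printed with \<open>ad e\<^sub>i\<close>; it
  has to be read with \<open>ad [e\<^sub>i, e\<^sub>i]\<close>, i.e. as the Serre relation for the even subalgebra
  \<open>sl\<^sub>2 \<subseteq> osp(1|2)\<close> attached to \<open>i\<close>. With \<open>ad e\<^sub>i\<close> the presentation collapses: for \<open>a\<^sub>i\<^sub>j = -2\<close>,
  applying \<open>ad f\<^sub>i\<close> twice to \<open>[e\<^sub>i, [e\<^sub>i, e\<^sub>j]] = 0\<close> gives \<open>e\<^sub>j = 0\<close>.
\<close>

definition bkm_relations :: "('i \<Rightarrow> 'i \<Rightarrow> real) \<Rightarrow> 'i set \<Rightarrow> 'i bkm_gen na set" where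
  "bkm_relations A \<Psi> =
    (let e = (\<lambda>i. gen (Egen i)); f = (\<lambda>i. gen (Fgen i)); h = (\<lambda>i. gen (Hgen i)) in
       {br (h i) (h j) | i j. True}
     \<union> {br (h i) (e j) - scl (of_real (A i j)) (e j) | i j. True}
     \<union> {br (h i) (f j) + scl (of_real (A i j)) (f j) | i j. True}
     \<union> {br (e i) (f j) - (if i = j then h i else 0) | i j. True}
     \<union> {(br (e i) ^^ m) (e j) | i j m. i \<in> I_re A \<and> i \<noteq> j \<and> real m = 1 - A i j}
     \<union> {(br (f i) ^^ m) (f j) | i j m. i \<in> I_re A \<and> i \<noteq> j \<and> real m = 1 - A i j}
     \<union> {(br (br (e i) (e i)) ^^ m) (e j) | i j m.
          i \<in> Psi_re A \<Psi> \<and> i \<noteq> j \<and> real m = 1 - A i j / 2}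
     \<union> {(br (br (f i) (f i)) ^^ m) (f j) | i j m.
          i \<in> Psi_re A \<Psi> \<and> i \<noteq> j \<and> real m = 1 - A i j / 2}
     \<union> {br (e i) (e i) | i. i \<in> Psi_0 A \<Psi>}
     \<union> {br (f i) (f i) | i. i \<in> Psi_0 A \<Psi>}
     \<union> {br (e i) (e j) | i j. A i j = 0}
     \<union> {br (f i) (f j) | i j. A i j = 0})"

definition bkm :: "('i \<Rightarrow> 'i \<Rightarrow> real) \<Rightarrow> 'i set \<Rightarrow> 'i bkm_gen na set superalgebra" where
  "bkm A \<Psi> = lie_presented UNIV (bkm_odd \<Psi>) (bkm_relations A \<Psi>)"

definition bkm_e :: "('i \<Rightarrow> 'i \<Rightarrow> real) \<Rightarrow> 'i set \<Rightarrow> 'i \<Rightarrow> 'i bkm_gen na set" where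
  "bkm_e A \<Psi> i = lie_class UNIV (bkm_odd \<Psi>) (bkm_relations A \<Psi>) (gen (Egen i))"

definition root_space ::
    "('i \<Rightarrow> 'i \<Rightarrow> real) \<Rightarrow> 'i set \<Rightarrow> ('i \<Rightarrow>\<^sub>0 int) \<Rightarrow> 'i bkm_gen na set set" where
  "root_space A \<Psi> \<gamma> = lie_component UNIV (bkm_odd \<Psi>) (bkm_relations A \<Psi>) bkm_deg \<gamma>"

definition quasi_dynkin :: "('i \<Rightarrow> 'i \<Rightarrow> real) \<Rightarrow> 'i \<Rightarrow> 'i \<Rightarrow> bool" where
  "quasi_dynkin A i j \<longleftrightarrow> i \<noteq> j \<and> A i j \<noteq> 0"

definition eta :: "('i \<Rightarrow>\<^sub>0 nat) \<Rightarrow> ('i \<Rightarrow>\<^sub>0 int)" where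
  "eta k = (\<Sum>j\<in>Poly_Mapping.keys k. Poly_Mapping.single j (int (Poly_Mapping.lookup k j)))"


section \<open>The free partially commutative monoid\<close>

text \<open>
  \<open>G\<close> is the adjacency relation of the graph. Elements of the monoid are equivalence classes of
  words.
\<close>

definition swap1 :: "('i \<Rightarrow> 'i \<Rightarrow> bool) \<Rightarrow> 'i list \<Rightarrow> 'i list \<Rightarrow> bool" where
  "swap1 G v w \<longleftrightarrow> (\<exists>x y a b. \<not> G a b \<and> v = x @ [a, b] @ y \<and> w = x @ [b, a] @ y)"

definition trace :: "('i \<Rightarrow> 'i \<Rightarrow> bool) \<Rightarrow> 'i list \<Rightarrow> 'i list set" where
  "trace G w = {v. equivclp (swap1 G) w v}"

definition traces :: "('i \<Rightarrow> 'i \<Rightarrow> bool) \<Rightarrow> 'i list set set" where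
  "traces G = range (trace G)"

text \<open>The lexicographically largest representative.\<close>

definition std :: "'i::linorder list set \<Rightarrow> 'i list" where
  "std w = (THE v. v \<in> w \<and> (\<forall>u\<in>w. u \<noteq> v \<longrightarrow> (u, v) \<in> lexord {(a, b). a < b}))"

definition trace_less :: "('i::linorder list set \<times> 'i list set) set" where
  "trace_less = {(v, w). (std v, std w) \<in> lexord {(a, b). a < b}}"

text \<open>
  The number of occurrences of a letter is constant on classes, so it may be read off from the
  standard representative.
\<close>

definition occ :: "'i::linorder \<Rightarrow> 'i list set \<Rightarrow> nat" where
  "occ j w = count_list (std w) j"

definition wt :: "'i::linorder list set \<Rightarrow> ('i \<Rightarrow>\<^sub>0 int)" where
  "wt w = (\<Sum>j\<in>set (std w). Poly_Mapping.single j (int (occ j w)))"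

definition trace_odd :: "'i::linorder set \<Rightarrow> 'i list set \<Rightarrow> bool" where
  "trace_odd \<Psi> w \<longleftrightarrow> odd (\<Sum>j\<in>set (std w) \<inter> \<Psi>. occ j w)"

definition init_mult :: "('i \<Rightarrow> 'i \<Rightarrow> bool) \<Rightarrow> 'i list set \<Rightarrow> 'i \<Rightarrow> nat" where
  "init_mult G w j = (GREATEST m. \<exists>u. w = trace G (replicate m j @ u))"

definition IA_m :: "('i::linorder \<Rightarrow> 'i \<Rightarrow> bool) \<Rightarrow> 'i list set \<Rightarrow> 'i multiset" where
  "IA_m G w = (\<Sum>j\<in>set (std w). replicate_mset (init_mult G w j) j)"

definition X_alph :: "('i::linorder \<Rightarrow> 'i \<Rightarrow> bool) \<Rightarrow> 'i \<Rightarrow> 'i list set set" where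
  "X_alph G i = {w \<in> traces G. IA_m G w = {#i#} \<and> occ i w = 1}"

text \<open>
  The left normed bracket of a word in the \<open>e\<^sub>i\<close>. Swapping two non-adjacent odd letters changes
  its sign, so that on traces it depends, up to sign, on the choice of a representative.
\<close>

fun left_normed :: "('i \<Rightarrow> 'i \<Rightarrow> real) \<Rightarrow> 'i set \<Rightarrow> 'i list \<Rightarrow> 'i bkm_gen na set" where
  "left_normed A \<Psi> [] = \<zero>\<^bsub>bkm A \<Psi>\<^esub>"
| "left_normed A \<Psi> (a # as) = foldl (\<lambda>x b. x \<otimes>\<^bsub>bkm A \<Psi>\<^esub> bkm_e A \<Psi> b) (bkm_e A \<Psi> a) as"


section \<open>Super Lyndon words\<close>

text \<open>Words over an alphabet whose total order is given by the relation \<open>r\<close> and parity by \<open>od\<close>.\<close>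

definition lyndon :: "('x \<times> 'x) set \<Rightarrow> 'x list \<Rightarrow> bool" where
  "lyndon r w \<longleftrightarrow> w \<noteq> [] \<and> (\<forall>n. 0 < n \<and> n < length w \<longrightarrow> (w, rotate n w) \<in> lexord r)"

definition word_odd :: "('x \<Rightarrow> bool) \<Rightarrow> 'x list \<Rightarrow> bool" where
  "word_odd od w \<longleftrightarrow> odd (length (filter od w))"

definition super_lyndon :: "('x \<times> 'x) set \<Rightarrow> ('x \<Rightarrow> bool) \<Rightarrow> 'x list \<Rightarrow> bool" where
  "super_lyndon r od w \<longleftrightarrow> lyndon r w \<or> (\<exists>u. lyndon r u \<and> word_odd od u \<and> w = u @ u)"

text \<open>
  Length of the left factor of the standard factorization; the right factor has maximal length
  when the left one has minimal length. A super Lyndon word that is not Lyndon is a square.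
\<close>

definition std_split :: "('x \<times> 'x) set \<Rightarrow> 'x list \<Rightarrow> nat" where
  "std_split r w =
     (if lyndon r w
      then LEAST n. 0 < n \<and> n < length w \<and> lyndon r (take n w) \<and> lyndon r (drop n w)
                    \<and> (take n w, drop n w) \<in> lexord r
      else length w div 2)"

text \<open>
  The bracketing \<open>L\<close>, as an element of the free Lie superalgebra on \<open>X\<close>; the values \<open>\<zero>\<close> occur only
  for words that are not super Lyndon.
\<close>

function lyndon_bracket ::
    "'x set \<Rightarrow> ('x \<times> 'x) set \<Rightarrow> ('x \<Rightarrow> bool) \<Rightarrow> 'x list \<Rightarrow> 'x na set" where
  "lyndon_bracket X r od w =
     (if length w = 1 then fls_gen X od (hd w)
      else if 0 < std_split r w \<and> std_split r w < length w
      then lyndon_bracket X r od (take (std_split r w) w)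
             \<otimes>\<^bsub>fls X od\<^esub> lyndon_bracket X r od (drop (std_split r w) w)
      else \<zero>\<^bsub>fls X od\<^esub>)"
  by pat_completeness auto
termination
  by (relation "measure (\<lambda>(X, r, od, w). length w)") auto

declare lyndon_bracket.simps [simp del]

definition C_set :: "('i::linorder \<Rightarrow> 'i \<Rightarrow> bool) \<Rightarrow> 'i set \<Rightarrow> 'i \<Rightarrow> ('i \<Rightarrow>\<^sub>0 nat) \<Rightarrow> 'i list set list set" where
  "C_set G \<Psi> i k = {w \<in> lists (X_alph G i).
     super_lyndon trace_less (trace_odd \<Psi>) w \<and> sum_list (map wt w) = eta k}"

end

theory Submission
  imports Defs
begin

text \<open>
  Linear combinations of super Lyndon brackets exhaust the root space: by the triangular
  decomposition a root space of positive degree is spanned by left normed brackets of the \<open>e\<^sub>j\<close>; the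
  span of the brackets of the \<open>e(x)\<close>, \<open>x \<in> X_alph G i\<close>, is an ideal of the positive part containing
  \<open>e\<^sub>i\<close>; and the Lyndon rewriting \<open>[[u\<^sub>1, u\<^sub>2], v] = [u\<^sub>1, [u\<^sub>2, v]] \<plusminus> [[u\<^sub>1, v], u\<^sub>2]\<close> ends in super
  Lyndon brackets.

  For independence the algebra acts from the right on functionals on words, as on the dual of a Verma
  module of highest weight zero for the free algebra: \<open>e\<^sub>j\<close> by \<open>(T e\<^sub>j)(w) = T(jw)\<close>. The Serre elements in the \<open>e\<^sub>j\<close>
  super commute with the \<open>f\<^sub>k\<close>, so the functionals killed by the ideal they generate form a
  submodule; since real and isotropic odd letters occur at most once in \<open>k\<close>, it contains the signed
  indicator of every trace of weight \<open>k\<close>. Modulo such functionals, a super Lyndon bracket has its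
  word as smallest term, and products of the \<open>e(x)\<close> are independent because a trace whose only initial
  letter is \<open>i\<close> factors uniquely over \<open>X_alph G i\<close>: its last factor is the part connected to the last
  \<open>i\<close>, and every nonleading term of \<open>e(x)\<close> makes this part shorter.
\<close>

section \<open>The free nonassociative algebra\<close>

text \<open>The obstacle to independence is that \<open>ideal\<close> also contains all that arises
  from the Serre elements by bracketing with f's and h's. Functionals supported on words in which
  real and isotropic odd letters occur at most once are not stable under the action:
  \<open>F j\<close> turns a functional of weight \<open>k\<close> into one living on words with one
  more letter \<open>j\<close>. Hence \<open>Z\<close> is defined by annihilation of the Serre
  elements, not by supports. Supports enter only in \<open>mem_ZI\<close>, where a real Serre
  element with \<open>A i j \<noteq> 0\<close> contains the letter \<open>i\<close> at least twice.
  No enveloping algebra and no PBW theorem is involved: functionals are simply evaluated at the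
  empty word. Two different orders make the system triangular: super Lyndon brackets are compared
  lexicographically as words over the alphabet, products of the e(x) by the lengths of their factors
  read from the right. Swapping commuting odd letters changes signs. The spanning arguments only
  track membership in subspaces, where signs are invisible; in the functionals
  \<open>sort_sign\<close> absorbs them.\<close>

lemma lookup_scl [simp]: "Poly_Mapping.lookup (scl c p) t = c * Poly_Mapping.lookup p t"
  unfolding scl_def by (simp add: Poly_Mapping.map.rep_eq when_def)

lemma lookup_mon: "Poly_Mapping.lookup (mon t) s = (if s = t then 1 else 0)"
  by (simp add: mon_def lookup_single when_def)

lemma keys_mon [simp]: "Poly_Mapping.keys (mon t) = {t}"
  by (simp add: mon_def)

interpretation na: vector_space "scl :: complex \<Rightarrow> 'x na \<Rightarrow> 'x na"
  by unfold_locales (auto intro!: poly_mapping_eqI simp: lookup_add algebra_simps)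

lemma lookup_br [simp]:
  "Poly_Mapping.lookup (br p q) (Br s t) = Poly_Mapping.lookup p s * Poly_Mapping.lookup q t"
proof -
  have "Poly_Mapping.lookup (br p q) (Br s t)
      = (\<Sum>s'\<in>Poly_Mapping.keys p. \<Sum>t'\<in>Poly_Mapping.keys q.
          if s' = s then (if t' = t then Poly_Mapping.lookup p s * Poly_Mapping.lookup q t else 0) else 0)"
    unfolding br_def lookup_sum by (intro sum.cong refl) (auto simp: lookup_single when_def)
  also have "\<dots> = Poly_Mapping.lookup p s * Poly_Mapping.lookup q t"
  proof -
    have "(\<Sum>t'\<in>Poly_Mapping.keys q. if s' = s then (if t' = t then Poly_Mapping.lookup p s * Poly_Mapping.lookup q t else 0) else 0)
      = (if s' = s then Poly_Mapping.lookup p s * Poly_Mapping.lookup q t else 0)" for s'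
      by (auto simp: sum.delta in_keys_iff)
    then show ?thesis by (auto simp: sum.delta in_keys_iff)
  qed
  finally show ?thesis .
qed

lemma lookup_br_Gen [simp]: "Poly_Mapping.lookup (br p q) (Gen x) = 0"
  unfolding br_def lookup_sum by (intro sum.neutral ballI) (auto simp: lookup_single when_def)

lemma na_eqI:
  assumes "\<And>x. Poly_Mapping.lookup p (Gen x) = Poly_Mapping.lookup q (Gen x)"
    and "\<And>s t. Poly_Mapping.lookup p (Br s t) = Poly_Mapping.lookup q (Br s t)"
  shows "p = q"
  by (rule poly_mapping_eqI) (metis assms magma.exhaust)

lemma br_add_left: "br (p + q) r = br p r + br q r"
  and br_add_right: "br r (p + q) = br r p + br r q"
  and br_diff_left: "br (p - q) r = br p r - br q r"
  and br_diff_right: "br r (p - q) = br r p - br r q"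
  and br_scl_left [simp]: "br (scl c p) r = scl c (br p r)"
  and br_scl_right [simp]: "br r (scl c p) = scl c (br r p)"
  and br_zero_left [simp]: "br 0 r = 0"
  and br_zero_right [simp]: "br r 0 = 0"
  by (auto intro!: na_eqI simp: lookup_add lookup_minus algebra_simps)

lemma br_mon: "br (mon s) (mon t) = mon (Br s t)"
  by (auto intro!: na_eqI simp: lookup_mon)

lemma na_expand: "p = (\<Sum>t\<in>Poly_Mapping.keys p. scl (Poly_Mapping.lookup p t) (mon t))"
proof (rule poly_mapping_eqI)
  fix s
  have "(\<Sum>t\<in>Poly_Mapping.keys p. Poly_Mapping.lookup p t * (if s = t then 1 else 0))
     = (\<Sum>t\<in>Poly_Mapping.keys p. if t = s then Poly_Mapping.lookup p s else 0)"
    by (intro sum.cong) auto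
  then show "Poly_Mapping.lookup p s
      = Poly_Mapping.lookup (\<Sum>t\<in>Poly_Mapping.keys p. scl (Poly_Mapping.lookup p t) (mon t)) s"
    by (simp add: lookup_sum lookup_mon in_keys_iff sum.delta)
qed

text \<open>With \<open>na.span_induct\<close> this reduces a statement linear in \<open>p\<close>
  to monomials; it is how relations given on monomials reach arbitrary elements.\<close>

lemma na_span_mon: "p \<in> na.span (mon ` Poly_Mapping.keys p)"
proof -
  have "(\<Sum>t\<in>Poly_Mapping.keys p. scl (Poly_Mapping.lookup p t) (mon t)) \<in> na.span (mon ` Poly_Mapping.keys p)"
    by (intro na.span_sum na.span_scale na.span_base) auto
  moreover have "(\<Sum>t\<in>Poly_Mapping.keys p. scl (Poly_Mapping.lookup p t) (mon t)) = p"
    by (rule na_expand[symmetric])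
  ultimately show ?thesis
    by (rule back_subst[where P = "\<lambda>x. x \<in> na.span (mon ` Poly_Mapping.keys p)"])
qed

lemma koszul_simps [simp]:
  "koszul False b = 1" "koszul b False = 1" "koszul True True = -1"
  by (auto simp: koszul_def)

lemma keys_scl: "Poly_Mapping.keys (scl c p) \<subseteq> Poly_Mapping.keys p"
  by (auto simp: in_keys_iff)

lemma keys_br: "Poly_Mapping.keys (br p q) \<subseteq> {Br s t |s t. s \<in> Poly_Mapping.keys p \<and> t \<in> Poly_Mapping.keys q}"
proof
  fix u assume "u \<in> Poly_Mapping.keys (br p q)"
  then show "u \<in> {Br s t |s t. s \<in> Poly_Mapping.keys p \<and> t \<in> Poly_Mapping.keys q}"
    by (cases u) (auto simp: in_keys_iff)
qed

lemma keys_na_diff: "Poly_Mapping.keys (p - q) \<subseteq> Poly_Mapping.keys p \<union> Poly_Mapping.keys (q :: 'x na)"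
  by (auto simp: in_keys_iff lookup_minus)

lemma fna_add: "p \<in> fna X \<Longrightarrow> q \<in> fna X \<Longrightarrow> p + q \<in> fna X"
  using Poly_Mapping.keys_add[of p q] unfolding fna_def by blast

lemma fna_diff: "p \<in> fna X \<Longrightarrow> q \<in> fna X \<Longrightarrow> p - q \<in> fna X"
  using keys_na_diff[of p q] unfolding fna_def by blast

lemma fna_scl: "p \<in> fna X \<Longrightarrow> scl c p \<in> fna X"
  using keys_scl[of c p] unfolding fna_def by blast

lemma fna_0 [simp]: "0 \<in> fna X"
  unfolding fna_def by simp

lemma fna_br: "p \<in> fna X \<Longrightarrow> q \<in> fna X \<Longrightarrow> br p q \<in> fna X"
  using keys_br[of p q] unfolding fna_def magma_on_def by fastforce

lemma fna_mon: "t \<in> magma_on X \<Longrightarrow> mon t \<in> fna X"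
  unfolding fna_def by simp

lemma fna_gen: "x \<in> X \<Longrightarrow> gen x \<in> fna X"
  unfolding fna_def magma_on_def by simp

lemma fna_UNIV [simp]: "fna UNIV = UNIV"
  unfolding fna_def magma_on_def by simp

lemma magma_on_UNIV [simp]: "magma_on UNIV = UNIV"
  unfolding magma_on_def by simp

lemma fna_sum: "(\<And>x. x \<in> A \<Longrightarrow> f x \<in> fna X) \<Longrightarrow> (\<Sum>x\<in>A. f x) \<in> fna X"
  by (induction A rule: infinite_finite_induct) (auto simp: fna_add)

lemma magma_on_Br [simp]: "Br s t \<in> magma_on X \<longleftrightarrow> s \<in> magma_on X \<and> t \<in> magma_on X"
  unfolding magma_on_def by auto

lemma lie_axioms_fna: "lie_axioms X od \<subseteq> fna X"
  unfolding lie_axioms_def by (auto intro!: fna_add fna_diff fna_scl fna_mon)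

section \<open>Lie superalgebras by generators and relations\<close>

locale presented_lie =
  fixes X :: "'x set" and od :: "'x \<Rightarrow> bool" and R :: "'x na set"
  assumes R_fna: "R \<subseteq> fna X"
begin

definition ideal :: "'x na set" where
  "ideal = two_sided_ideal X (lie_axioms X od \<union> R)"

abbreviation "cls \<equiv> lie_class X od R"
abbreviation "L \<equiv> lie_presented X od R"

lemma ideal_subspace: "na.subspace ideal"
  unfolding ideal_def na.subspace_def by (auto intro: two_sided_ideal.intros)

lemma ideal_br_left: "p \<in> ideal \<Longrightarrow> q \<in> fna X \<Longrightarrow> br q p \<in> ideal"
  and ideal_br_right: "p \<in> ideal \<Longrightarrow> q \<in> fna X \<Longrightarrow> br p q \<in> ideal"
  unfolding ideal_def by (auto intro: two_sided_ideal.intros)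

lemma cls_alt: "cls p = {q \<in> fna X. q - p \<in> ideal}"
  unfolding lie_class_def ideal_def ..

lemma cls_eq_iff: "p \<in> fna X \<Longrightarrow> q \<in> fna X \<Longrightarrow> cls p = cls q \<longleftrightarrow> p - q \<in> ideal"
proof
  assume pq: "p \<in> fna X" "q \<in> fna X" and "cls p = cls q"
  moreover have "p \<in> cls p" using pq na.subspace_0[OF ideal_subspace] by (simp add: cls_alt)
  ultimately have "p \<in> cls q" by simp
  then show "p - q \<in> ideal" by (simp add: cls_alt)
next
  assume pq: "p - q \<in> ideal"
  have "r - p \<in> ideal \<longleftrightarrow> r - q \<in> ideal" for r
    using na.subspace_add[OF ideal_subspace _ pq, of "r - p"]
      na.subspace_diff[OF ideal_subspace _ pq, of "r - q"] by auto
  then show "cls p = cls q" by (simp add: cls_alt)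
qed

lemma cls_self: "p \<in> fna X \<Longrightarrow> p \<in> cls p"
  using na.subspace_0[OF ideal_subspace] by (simp add: cls_alt)

lemma cls_eqI: "p \<in> fna X \<Longrightarrow> q \<in> fna X \<Longrightarrow> p - q \<in> ideal \<Longrightarrow> cls p = cls q"
  by (simp add: cls_eq_iff)

lemma mem_cls: "q \<in> cls p \<Longrightarrow> q \<in> fna X \<and> q - p \<in> ideal"
  by (simp add: cls_alt)

lemma carrier_L: "carrier L = cls ` fna X"
  by (simp add: lie_presented_def)

lemma zero_L: "\<zero>\<^bsub>L\<^esub> = cls 0"
  by (simp add: lie_presented_def)

text \<open>The product in the record is a union of cosets over all representatives. Since the ideal
  is two sided these cosets coincide, and the union is a single coset.\<close>

lemma mult_cls:
  assumes p: "p \<in> fna X" and q: "q \<in> fna X"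
  shows "cls p \<otimes>\<^bsub>L\<^esub> cls q = cls (br p q)"
proof -
  have "cls (br p' q') = cls (br p q)" if "p' \<in> cls p" "q' \<in> cls q" for p' q'
  proof (rule cls_eqI)
    have *: "p' \<in> fna X" "q' \<in> fna X" "p' - p \<in> ideal" "q' - q \<in> ideal"
      using that mem_cls by blast+
    then show "br p' q' \<in> fna X" "br p q \<in> fna X" using p q by (auto intro: fna_br)
    have "br p' q' - br p q = br (p' - p) q' + br p (q' - q)"
      by (simp add: br_diff_left br_diff_right)
    then show "br p' q' - br p q \<in> ideal"
      using ideal_br_right[OF *(3,2)] ideal_br_left[OF *(4) p]
      by (metis na.subspace_add[OF ideal_subspace])
  qed
  then have "(\<Union>p'\<in>cls p. \<Union>q'\<in>cls q. cls (br p' q')) = cls (br p q)"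
    using cls_self[OF p] cls_self[OF q] by blast
  then show ?thesis by (simp add: lie_presented_def)
qed

lemma add_cls:
  assumes p: "p \<in> fna X" and q: "q \<in> fna X"
  shows "cls p \<oplus>\<^bsub>L\<^esub> cls q = cls (p + q)"
proof -
  have "cls (p' + q') = cls (p + q)" if "p' \<in> cls p" "q' \<in> cls q" for p' q'
  proof (rule cls_eqI)
    have *: "p' \<in> fna X" "q' \<in> fna X" "p' - p \<in> ideal" "q' - q \<in> ideal"
      using that mem_cls by blast+
    then show "p' + q' \<in> fna X" "p + q \<in> fna X" using p q by (auto intro: fna_add)
    have "p' + q' - (p + q) = (p' - p) + (q' - q)" by simp
    then show "p' + q' - (p + q) \<in> ideal"
      using * by (metis na.subspace_add[OF ideal_subspace])
  qed
  then have "(\<Union>p'\<in>cls p. \<Union>q'\<in>cls q. cls (p' + q')) = cls (p + q)"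
    using cls_self[OF p] cls_self[OF q] by blast
  then show ?thesis by (simp add: lie_presented_def)
qed

lemma smult_cls:
  assumes p: "p \<in> fna X"
  shows "c \<odot>\<^bsub>L\<^esub> cls p = cls (scl c p)"
proof -
  have "cls (scl c p') = cls (scl c p)" if "p' \<in> cls p" for p'
  proof (rule cls_eqI)
    have *: "p' \<in> fna X" "p' - p \<in> ideal" using that mem_cls by blast+
    then show "scl c p' \<in> fna X" "scl c p \<in> fna X" using p by (auto intro: fna_scl)
    show "scl c p' - scl c p \<in> ideal"
      using na.subspace_scale[OF ideal_subspace *(2)] by (simp add: na.scale_right_diff_distrib)
  qed
  then have "(\<Union>p'\<in>cls p. cls (scl c p')) = cls (scl c p)"
    using cls_self[OF p] by blast
  then show ?thesis by (simp add: lie_presented_def)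
qed

lemma abelian_monoid_L: "abelian_monoid L"
proof (rule abelian_monoidI)
  show "\<And>x y. x \<in> carrier L \<Longrightarrow> y \<in> carrier L \<Longrightarrow> x \<oplus>\<^bsub>L\<^esub> y \<in> carrier L"
    by (auto simp: carrier_L add_cls fna_add)
  show "\<zero>\<^bsub>L\<^esub> \<in> carrier L" by (auto simp: carrier_L zero_L)
  show "\<And>x y z. x \<in> carrier L \<Longrightarrow> y \<in> carrier L \<Longrightarrow> z \<in> carrier L \<Longrightarrow>
     (x \<oplus>\<^bsub>L\<^esub> y) \<oplus>\<^bsub>L\<^esub> z = x \<oplus>\<^bsub>L\<^esub> (y \<oplus>\<^bsub>L\<^esub> z)"
    by (auto simp: carrier_L add_cls fna_add add.assoc)
  show "\<And>x. x \<in> carrier L \<Longrightarrow> \<zero>\<^bsub>L\<^esub> \<oplus>\<^bsub>L\<^esub> x = x"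
    by (auto simp: carrier_L zero_L add_cls)
  show "\<And>x y. x \<in> carrier L \<Longrightarrow> y \<in> carrier L \<Longrightarrow> x \<oplus>\<^bsub>L\<^esub> y = y \<oplus>\<^bsub>L\<^esub> x"
    by (auto simp: carrier_L add_cls add.commute)
qed

lemma finsum_cls:
  assumes "finite S" "\<And>x. x \<in> S \<Longrightarrow> h x \<in> fna X" "\<And>x. x \<in> S \<Longrightarrow> f x = cls (h x)"
  shows "(\<Oplus>\<^bsub>L\<^esub>x\<in>S. f x) = cls (\<Sum>x\<in>S. h x)"
  using assms
proof (induction S rule: finite_induct)
  case empty
  then show ?case by (simp add: abelian_monoid.finsum_empty[OF abelian_monoid_L] zero_L)
next
  case (insert x S)
  have "(\<Oplus>\<^bsub>L\<^esub>x\<in>insert x S. f x) = f x \<oplus>\<^bsub>L\<^esub> (\<Oplus>\<^bsub>L\<^esub>x\<in>S. f x)"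
    using insert by (intro abelian_monoid.finsum_insert[OF abelian_monoid_L]) (auto simp: carrier_L)
  also have "\<dots> = cls (\<Sum>x\<in>insert x S. h x)"
    using insert by (simp add: add_cls fna_sum)
  finally show ?case .
qed

text \<open>Moves the basis question from cosets to representatives modulo \<open>ideal\<close>.
  Independence is assumed for families indexed by \<open>C\<close>, not for the image set, and
  therefore also gives injectivity of the parametrization.\<close>

lemma is_basis_clsI:
  assumes V: "V \<subseteq> fna X"
    and mem: "\<And>w. w \<in> C \<Longrightarrow> P w \<in> V"
    and indep: "\<And>S c. finite S \<Longrightarrow> S \<subseteq> C \<Longrightarrow> (\<Sum>w\<in>S. scl (c w) (P w)) \<in> ideal \<Longrightarrow> \<forall>w\<in>S. c w = 0"
    and span: "\<And>p. p \<in> V \<Longrightarrow> p \<in> na.span (ideal \<union> P ` C)"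
    and Vsub: "na.subspace V"
  shows "inj_on (\<lambda>w. cls (P w)) C \<and> is_basis L (cls ` V) ((\<lambda>w. cls (P w)) ` C)"
proof -
  let ?b = "\<lambda>w. cls (P w)"
  have PX: "P w \<in> fna X" if "w \<in> C" for w using that mem V by blast
  have inj: "inj_on ?b C"
  proof (rule inj_onI, rule ccontr)
    fix v w assume vw: "v \<in> C" "w \<in> C" "?b v = ?b w" "v \<noteq> w"
    then have "P v - P w \<in> ideal" by (simp add: cls_eq_iff PX)
    \<comment> \<open>Two indices with the same coset would give a relation with coefficients 1 and
      -1.\<close>
    then have "(\<Sum>u\<in>{v,w}. scl (if u = v then 1 else -1) (P u)) \<in> ideal"
      using vw by simp
    from indep[OF _ _ this] vw show False by simp
  qed
  have comb: "(\<Oplus>\<^bsub>L\<^esub>x\<in>?b ` S. c x \<odot>\<^bsub>L\<^esub> x) = cls (\<Sum>w\<in>S. scl (c (?b w)) (P w))"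
    if "finite S" "S \<subseteq> C" for S c
  proof -
    define g where "g x = inv_into C ?b x" for x
    have g: "g (?b w) = w" if "w \<in> C" for w
      using inv_into_f_f[OF inj that] by (simp add: g_def)
    have "(\<Oplus>\<^bsub>L\<^esub>x\<in>?b ` S. c x \<odot>\<^bsub>L\<^esub> x) = cls (\<Sum>x\<in>?b ` S. scl (c x) (P (g x)))"
    proof (rule finsum_cls)
      show "finite (?b ` S)" using that by simp
      show "scl (c x) (P (g x)) \<in> fna X" if "x \<in> ?b ` S" for x
        using that \<open>S \<subseteq> C\<close> g PX by (auto intro!: fna_scl)
      show "c x \<odot>\<^bsub>L\<^esub> x = cls (scl (c x) (P (g x)))" if x: "x \<in> ?b ` S" for x
      proof -
        obtain w where w: "w \<in> S" "x = ?b w" using x by auto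
        then have "g x = w" "w \<in> C" using g \<open>S \<subseteq> C\<close> by auto
        then show ?thesis using w smult_cls[OF PX] by metis
      qed
    qed
    also have "(\<Sum>x\<in>?b ` S. scl (c x) (P (g x))) = (\<Sum>w\<in>S. scl (c (?b w)) (P (g (?b w))))"
      using inj that by (subst sum.reindex) (auto intro: inj_on_subset)
    also have "\<dots> = (\<Sum>w\<in>S. scl (c (?b w)) (P w))"
      using g that by (intro sum.cong) auto
    finally show ?thesis .
  qed
  have "?b ` C \<subseteq> cls ` V" using mem by auto
  moreover have "lin_independent L (?b ` C)"
    unfolding lin_independent_def
  proof (intro allI impI)
    fix T c assume T: "finite T" "T \<subseteq> ?b ` C" and 0: "(\<Oplus>\<^bsub>L\<^esub>x\<in>T. c x \<odot>\<^bsub>L\<^esub> x) = \<zero>\<^bsub>L\<^esub>"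
    from T obtain S where S: "finite S" "S \<subseteq> C" "T = ?b ` S"
      by (meson finite_subset_image)
    have "(\<Sum>w\<in>S. scl (c (?b w)) (P w)) \<in> fna X"
      using S PX by (intro fna_sum fna_scl) auto
    then have "(\<Sum>w\<in>S. scl (c (?b w)) (P w)) \<in> ideal"
      using 0 S comb[OF S(1,2), of c] by (simp add: zero_L cls_eq_iff)
    from indep[OF S(1,2) this] show "\<forall>x\<in>T. c x = 0" using S by simp
  qed
  moreover have "lin_span L (?b ` C) = cls ` V"
  proof
    show "lin_span L (?b ` C) \<subseteq> cls ` V"
    proof
      fix y assume "y \<in> lin_span L (?b ` C)"
      then obtain T c where T: "finite T" "T \<subseteq> ?b ` C" "y = (\<Oplus>\<^bsub>L\<^esub>x\<in>T. c x \<odot>\<^bsub>L\<^esub> x)"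
        unfolding lin_span_def by blast
      then obtain S where S: "finite S" "S \<subseteq> C" "T = ?b ` S"
        by (meson finite_subset_image)
      have "(\<Sum>w\<in>S. scl (c (?b w)) (P w)) \<in> V"
        using S mem by (intro na.subspace_sum[OF Vsub] na.subspace_scale[OF Vsub]) auto
      then show "y \<in> cls ` V" using T S comb[OF S(1,2), of c] by simp
    qed
    show "cls ` V \<subseteq> lin_span L (?b ` C)"
    proof
      fix y assume "y \<in> cls ` V"
      then obtain p where p: "p \<in> V" "y = cls p" by auto
      from span[OF p(1)] obtain r q where rq: "p = r + q" "r \<in> na.span ideal" "q \<in> na.span (P ` C)"
        unfolding na.span_Un by auto
      have r: "r \<in> ideal" using na.span_minimal[OF order.refl ideal_subspace] rq(2) by blast
      from rq(3) obtain T c where T: "finite T" "T \<subseteq> P ` C" "q = (\<Sum>x\<in>T. scl (c x) x)"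
        unfolding na.span_explicit by blast
      from T(2) obtain S where S': "S \<subseteq> C" "inj_on P S" "T = P ` S"
        unfolding subset_image_inj by blast
      then have S: "finite S" "S \<subseteq> C" "T = P ` S" "inj_on P S"
        using T(1) finite_imageD by auto
      have q: "q = (\<Sum>w\<in>S. scl (c (P w)) (P w))"
        using T S by (simp add: sum.reindex)
      \<comment> \<open>The coefficients of \<open>q\<close>, pulled back along the inverse of the
        injective map \<open>w \<mapsto> cls (P w)\<close>.\<close>
      define d where "d x = c (P (inv_into C ?b x))" for x
      have d: "d (?b w) = c (P w)" if "w \<in> C" for w
        using inv_into_f_f[OF inj that] by (simp add: d_def)
      have "q = (\<Sum>w\<in>S. scl (d (?b w)) (P w))"
        unfolding q using S d by (intro sum.cong) auto
      then have "(\<Oplus>\<^bsub>L\<^esub>x\<in>?b ` S. d x \<odot>\<^bsub>L\<^esub> x) = cls q"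
        using comb[OF S(1,2), of d] by simp
      also have "\<dots> = y"
        unfolding p(2)
      proof (rule cls_eqI)
        show "p \<in> fna X" using p V by auto
        show "q \<in> fna X" unfolding q using S PX by (intro fna_sum fna_scl) auto
        show "q - p \<in> ideal" using r rq(1) na.subspace_neg[OF ideal_subspace r] by simp
      qed
      finally show "y \<in> lin_span L (?b ` C)"
        unfolding lin_span_def using S by blast
    qed
  qed
  ultimately show ?thesis using inj unfolding is_basis_def by blast
qed

end

section \<open>Super Jacobi identities modulo the relations\<close>

definition homog :: "('x \<Rightarrow> bool) \<Rightarrow> bool \<Rightarrow> 'x na \<Rightarrow> bool" where
  "homog od b p \<longleftrightarrow> (\<forall>t\<in>Poly_Mapping.keys p. magma_odd od t = b)"

lemma homog_span: "homog od b p \<Longrightarrow> p \<in> na.span (mon ` {t. magma_odd od t = b})"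
  using na_span_mon[of p] na.span_mono[of "mon ` Poly_Mapping.keys p" "mon ` {t. magma_odd od t = b}"]
  unfolding homog_def by blast

lemma homog_mon: "homog od (magma_odd od t) (mon t)"
  by (simp add: homog_def)

lemma homog_gen: "homog od (od x) (gen x)"
  by (simp add: homog_def)

lemma homog_br: "homog od a p \<Longrightarrow> homog od b q \<Longrightarrow> homog od (a \<noteq> b) (br p q)"
  using keys_br[of p q] unfolding homog_def by fastforce

lemma homog_scl: "homog od a p \<Longrightarrow> homog od a (scl c p)"
  using keys_scl[of c p] unfolding homog_def by fastforce

lemma homog_add: "homog od a p \<Longrightarrow> homog od a q \<Longrightarrow> homog od a (p + q)"
  using Poly_Mapping.keys_add[of p q] unfolding homog_def by fastforce

lemma homog_diff: "homog od a p \<Longrightarrow> homog od a q \<Longrightarrow> homog od a (p - q)"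
  using keys_na_diff[of p q] unfolding homog_def by fastforce

lemma homog_0: "homog od a 0"
  unfolding homog_def by simp

lemma na_subspace_preimage:
  assumes "na.subspace S" "\<And>x y. f (x + y) = f x + f y" "\<And>c x. f (scl c x) = scl c (f x)"
  shows "na.subspace {x. f x \<in> S}"
  using assms na.scale_zero_left unfolding na.subspace_def
  by (metis (mono_tags, lifting) mem_Collect_eq)

locale lie_relations =
  fixes od :: "'x \<Rightarrow> bool" and R :: "'x na set"
begin

sublocale presented_lie UNIV od R
  by unfold_locales simp

lemma skew_mon: "mon (Br s t) + scl (koszul (magma_odd od s) (magma_odd od t)) (mon (Br t s)) \<in> ideal"
  unfolding ideal_def by (rule two_sided_ideal.base) (auto simp: lie_axioms_def)

lemma jacobi_mon:
  "mon (Br s (Br t u)) - mon (Br (Br s t) u)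
   - scl (koszul (magma_odd od s) (magma_odd od t)) (mon (Br t (Br s u))) \<in> ideal"
  unfolding ideal_def by (rule two_sided_ideal.base) (auto simp: lie_axioms_def)

text \<open>Once the parities \<open>a\<close> and \<open>b\<close> are fixed the Koszul sign is
  constant, so the expression is linear in each argument and extends from monomials one argument at
  a time.\<close>

lemma skew:
  assumes "homog od a p" "homog od b q"
  shows "br p q + scl (koszul a b) (br q p) \<in> ideal"
proof -
  have 1: "br p (mon t) + scl (koszul a (magma_odd od t)) (br (mon t) p) \<in> ideal" for t
    using homog_span[OF assms(1)]
  proof (induction rule: na.span_induct)
    case base
    show ?case
      by (rule na_subspace_preimage[OF ideal_subspace])
        (auto simp: br_add_left br_add_right na.scale_right_distrib na.scale_left_commute)
  next
    case (step x)
    then obtain s where "x = mon s" "magma_odd od s = a" by auto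
    then show ?case using skew_mon[of s t] by (simp add: br_mon)
  qed
  show ?thesis using homog_span[OF assms(2)]
  proof (induction rule: na.span_induct)
    case base
    show ?case
      by (rule na_subspace_preimage[OF ideal_subspace])
        (auto simp: br_add_left br_add_right na.scale_right_distrib na.scale_left_commute)
  next
    case (step x)
    then show ?case using 1 by auto
  qed
qed

text \<open>The sign involves only \<open>p\<close> and \<open>q\<close>, so \<open>r\<close> may be
  inhomogeneous. The identity is extended from monomials in \<open>r\<close>, then in
  \<open>p\<close>, then in \<open>q\<close>.\<close>

lemma jacobi:
  assumes "homog od a p" "homog od b q"
  shows "br p (br q r) - br (br p q) r - scl (koszul a b) (br q (br p r)) \<in> ideal"
proof -
  have 1: "br (mon s) (br (mon t) r) - br (br (mon s) (mon t)) r
      - scl (koszul (magma_odd od s) (magma_odd od t)) (br (mon t) (br (mon s) r)) \<in> ideal" for s t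
    using na_span_mon[of r]
  proof (induction rule: na.span_induct)
    case base
    show ?case
      by (rule na_subspace_preimage[OF ideal_subspace])
        (auto simp: br_add_left br_add_right na.scale_right_distrib na.scale_left_commute
           na.scale_right_diff_distrib)
  next
    case (step x)
    then show ?case using jacobi_mon by (auto simp: br_mon)
  qed
  have 2: "br p (br (mon t) r) - br (br p (mon t)) r
      - scl (koszul a (magma_odd od t)) (br (mon t) (br p r)) \<in> ideal" for t
    using homog_span[OF assms(1)]
  proof (induction rule: na.span_induct)
    case base
    show ?case
      by (rule na_subspace_preimage[OF ideal_subspace])
        (auto simp: br_add_left br_add_right na.scale_right_distrib na.scale_left_commute
           na.scale_right_diff_distrib)
  next
    case (step x)
    then show ?case using 1 by auto
  qed
  show ?thesis using homog_span[OF assms(2)]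
  proof (induction rule: na.span_induct)
    case base
    show ?case
      by (rule na_subspace_preimage[OF ideal_subspace])
        (auto simp: br_add_left br_add_right na.scale_right_distrib na.scale_left_commute
           na.scale_right_diff_distrib)
  next
    case (step x)
    then show ?case using 2 by auto
  qed
qed

text \<open>The Jacobi identity as a derivation rule for right multiplication, the form suited to
  left normed words. The parity of \<open>p\<close> cancels between Jacobi and skew symmetry, so
  \<open>p\<close> is arbitrary.\<close>

lemma right_jacobi:
  assumes q: "homog od b q" and r: "homog od c r"
  shows "br (br p q) r - br p (br q r) - scl (koszul b c) (br (br p r) q) \<in> ideal"
  using na_span_mon[of p]
proof (induction rule: na.span_induct)
  case base
  show ?case
    by (rule na_subspace_preimage[OF ideal_subspace])
      (auto simp: br_add_left br_add_right na.scale_right_distrib na.scale_left_commute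
         na.scale_right_diff_distrib)
next
  case (step x)
  then obtain s where x: "x = mon s" by auto
  define a where "a = magma_odd od s"
  have p: "homog od a x" unfolding x a_def by (rule homog_mon)
  note J = jacobi[OF p q, of r] and K = skew[OF q homog_br[OF p r]]
  have "br (br x q) r - br x (br q r) - scl (koszul b c) (br (br x r) q)
     = - (br x (br q r) - br (br x q) r - scl (koszul a b) (br q (br x r)))
       - scl (koszul a b) (br q (br x r) + scl (koszul b (a \<noteq> c)) (br (br x r) q))"
    by (cases a; cases b; cases c) (simp_all add: na.scale_right_distrib)
  then show ?case
    using na.subspace_diff[OF ideal_subspace na.subspace_neg[OF ideal_subspace J]
        na.subspace_scale[OF ideal_subspace K]] by (simp only:)
qed

text \<open>This and the next three rules trade identities modulo \<open>ideal\<close> for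
  membership in a subspace \<open>S\<close> above \<open>ideal\<close>. Koszul signs become
  irrelevant scalars, which keeps the later spanning arguments free of signs.\<close>

lemma br_skew_mem:
  assumes S: "na.subspace S" "ideal \<subseteq> S" and "homog od a p" "homog od b q" "br q p \<in> S"
  shows "br p q \<in> S"
proof -
  have eq: "br p q = (br p q + scl (koszul a b) (br q p)) - scl (koszul a b) (br q p)" by simp
  show ?thesis
    by (subst eq, intro na.subspace_diff[OF S(1)] na.subspace_scale[OF S(1)] assms(5)
        subsetD[OF S(2) skew[OF assms(3,4)]])
qed

lemma br_left_mem:
  assumes S: "na.subspace S" "ideal \<subseteq> S" and "homog od a p" "homog od b q"
    and "br p (br q r) \<in> S" "br q (br p r) \<in> S"
  shows "br (br p q) r \<in> S"
proof -
  let ?k = "scl (koszul a b) (br q (br p r))"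
  have eq: "br (br p q) r = br p (br q r) - (br p (br q r) - br (br p q) r - ?k) - ?k" by simp
  show ?thesis
    by (subst eq, intro na.subspace_diff[OF S(1)] na.subspace_add[OF S(1)] na.subspace_scale[OF S(1)]
        assms(5,6) subsetD[OF S(2) jacobi[OF assms(3,4), of r]])
qed

lemma br_right_mem:
  assumes S: "na.subspace S" "ideal \<subseteq> S" and "homog od b q" "homog od c r"
    and "br p (br q r) \<in> S" "br (br p r) q \<in> S"
  shows "br (br p q) r \<in> S"
proof -
  let ?k = "scl (koszul b c) (br (br p r) q)"
  have eq: "br (br p q) r = br p (br q r) + (br (br p q) r - br p (br q r) - ?k) + ?k" by simp
  show ?thesis
    by (subst eq, intro na.subspace_diff[OF S(1)] na.subspace_add[OF S(1)] na.subspace_scale[OF S(1)]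
        assms(5,6) subsetD[OF S(2) right_jacobi[OF assms(3,4), of p]])
qed

lemma br_assoc_mem:
  assumes S: "na.subspace S" "ideal \<subseteq> S" and "homog od b q" "homog od c r"
    and "br (br p q) r \<in> S" "br (br p r) q \<in> S"
  shows "br p (br q r) \<in> S"
proof -
  let ?k = "scl (koszul b c) (br (br p r) q)"
  have eq: "br p (br q r) = br (br p q) r - (br (br p q) r - br p (br q r) - ?k) - ?k" by simp
  show ?thesis
    by (subst eq, intro na.subspace_diff[OF S(1)] na.subspace_add[OF S(1)] na.subspace_scale[OF S(1)]
        assms(5,6) subsetD[OF S(2) right_jacobi[OF assms(3,4), of p]])
qed

lemma br_square_even: "homog od False p \<Longrightarrow> br p p \<in> ideal"
proof -
  assume "homog od False p"
  from skew[OF this this] have "scl (1/2) (br p p + br p p) \<in> ideal"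
    using na.subspace_scale[OF ideal_subspace] by simp
  also have "scl (1/2) (br p p + br p p) = br p p"
    by (simp flip: na.scale_left_distrib add: na.scale_right_distrib)
  finally show ?thesis .
qed

text \<open>For odd \<open>p\<close>, with x = [p,[p,p]] and y = [[p,p],p], the Jacobi identity puts
  2x - y into the ideal and skew symmetry x + y, hence 3x lies there.\<close>

lemma br_cube: assumes "homog od b p" shows "br p (br p p) \<in> ideal"
proof (cases b)
  case False
  then show ?thesis using assms br_square_even ideal_br_left by simp
next
  case True
  then have p: "homog od True p" using assms by simp
  from homog_br[OF p p] have pp: "homog od False (br p p)" by simp
  let ?x = "br p (br p p)" and ?y = "br (br p p) p"
  have 1: "?x - ?y + ?x \<in> ideal" using jacobi[OF p p, of p] by simp
  have 2: "?x + ?y \<in> ideal" using skew[OF p pp] by simp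
  have "scl (1/3) ((?x - ?y + ?x) + (?x + ?y)) \<in> ideal"
    using na.subspace_add[OF ideal_subspace 1 2] by (rule na.subspace_scale[OF ideal_subspace])
  also have "scl (1/3) ((?x - ?y + ?x) + (?x + ?y)) = ?x"
    by (rule poly_mapping_eqI) (simp add: lookup_add lookup_minus)
  finally show ?thesis .
qed

lemma br_span_left_mem:
  assumes "p \<in> na.span (ideal \<union> B)" "na.subspace S" "ideal \<subseteq> S" "\<And>b. b \<in> B \<Longrightarrow> br b q \<in> S"
  shows "br p q \<in> S"
  using assms(1)
proof (induction rule: na.span_induct)
  case base
  show ?case
    by (rule na_subspace_preimage[OF assms(2)]) (auto simp: br_add_left)
next
  case (step x)
  then show ?case using assms ideal_br_right[of x q] by auto
qed

lemma br_span_right_mem: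
  assumes "p \<in> na.span (ideal \<union> B)" "na.subspace S" "ideal \<subseteq> S" "\<And>b. b \<in> B \<Longrightarrow> br q b \<in> S"
  shows "br q p \<in> S"
  using assms(1)
proof (induction rule: na.span_induct)
  case base
  show ?case
    by (rule na_subspace_preimage[OF assms(2)]) (auto simp: br_add_right)
next
  case (step x)
  then show ?case using assms ideal_br_left[of x q] by auto
qed

lemma homog_foldl_br:
  assumes "\<exists>b. homog od b p" "\<forall>q\<in>set qs. \<exists>b. homog od b q"
  shows "\<exists>b. homog od b (foldl br p qs)"
  using assms by (induction qs arbitrary: p) (auto, metis homog_br)

text \<open>Stability under right bracketing by single elements passes to left normed words:
  [p,[L,z]] is a combination of [[p,L],z] and [[p,z],L] with a shorter \<open>L\<close>. The second
  term is the reason why the induction varies \<open>p\<close>.\<close>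

lemma br_foldl_mem:
  fixes S :: "'q::comm_monoid_add \<Rightarrow> 'x na set" and d :: "'y \<Rightarrow> 'q" and u :: "'y \<Rightarrow> 'x na"
  assumes S: "\<And>\<gamma>. na.subspace (S \<gamma>)" "\<And>\<gamma>. ideal \<subseteq> S \<gamma>"
    and hom: "\<And>y. y \<in> Y \<Longrightarrow> \<exists>b. homog od b (u y)"
    and closed: "\<And>\<gamma> p y. p \<in> S \<gamma> \<Longrightarrow> y \<in> Y \<Longrightarrow> br p (u y) \<in> S (\<gamma> + d y)"
    and "y \<in> Y" "set ys \<subseteq> Y" "p \<in> S \<gamma>"
  shows "br p (foldl br (u y) (map u ys)) \<in> S (\<gamma> + d y + sum_list (map d ys))"
  using assms(6,7)
proof (induction ys arbitrary: p \<gamma> rule: rev_induct)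
  case Nil
  then show ?case using closed assms(5) by simp
next
  case (snoc z zs)
  let ?L = "foldl br (u y) (map u zs)"
  have z: "z \<in> Y" and zs: "set zs \<subseteq> Y" using snoc.prems by auto
  have hL: "\<exists>b. homog od b ?L" using hom assms(5) zs by (intro homog_foldl_br) auto
  then obtain a where a: "homog od a ?L" by blast
  obtain b where b: "homog od b (u z)" using hom z by blast
  have eq: "\<gamma> + d y + sum_list (map d (zs @ [z])) = \<gamma> + d y + sum_list (map d zs) + d z"
    "\<gamma> + d y + sum_list (map d (zs @ [z])) = \<gamma> + d z + d y + sum_list (map d zs)"
    by (simp_all add: ac_simps)
  have 1: "br (br p ?L) (u z) \<in> S (\<gamma> + d y + sum_list (map d (zs @ [z])))"
    unfolding eq(1) using snoc.IH[OF zs snoc.prems(2)] closed z by blast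
  have 2: "br (br p (u z)) ?L \<in> S (\<gamma> + d y + sum_list (map d (zs @ [z])))"
    unfolding eq(2) using snoc.IH[OF zs] closed z snoc.prems(2) by blast
  show ?case using br_assoc_mem[OF S a b 1 2] by simp
qed

text \<open>Left normed words are stable under right bracketing by generators, hence by left normed
  words through \<open>br_foldl_mem\<close>, and so absorb any bracket. The degree \<open>d\<close>
  is carried along to keep the grading.\<close>

lemma mon_left_normed_span:
  fixes d :: "'x \<Rightarrow> 'q::comm_monoid_add"
  shows "mon t \<in> na.span (ideal \<union> {foldl br (gen x) (map gen xs) |x xs.
            d x + sum_list (map d xs) = magma_deg d t})" (is "_ \<in> ?S (magma_deg d t)")
proof (induction t)
  case (Gen x)
  have "gen x = foldl br (gen x) (map gen []) \<and> d x + sum_list (map d []) = magma_deg d (Gen x)"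
    by simp
  then show ?case by (intro na.span_base UnI2) blast
next
  case (Br s t)
  have sub: "ideal \<subseteq> ?S \<gamma>" for \<gamma> using na.span_superset by blast
  have closed: "br p (gen y) \<in> ?S (\<gamma> + d y)" if "p \<in> ?S \<gamma>" for p \<gamma> y
    using that
  proof (rule br_span_left_mem[OF _ na.subspace_span sub])
    fix b assume "b \<in> {foldl br (gen x) (map gen xs) |x xs. d x + sum_list (map d xs) = \<gamma>}"
    then obtain x xs where x: "b = foldl br (gen x) (map gen xs)" "d x + sum_list (map d xs) = \<gamma>"
      by blast
    then have "br b (gen y) = foldl br (gen x) (map gen (xs @ [y]))"
      "d x + sum_list (map d (xs @ [y])) = \<gamma> + d y" by (auto simp: ac_simps)
    then show "br b (gen y) \<in> ?S (\<gamma> + d y)" by (intro na.span_base UnI2) blast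
  qed
  have "br (mon s) (mon t) \<in> ?S (magma_deg d s + magma_deg d t)"
    using Br(2)
  proof (rule br_span_right_mem[OF _ na.subspace_span sub])
    fix b assume "b \<in> {foldl br (gen x) (map gen xs) |x xs. d x + sum_list (map d xs) = magma_deg d t}"
    then obtain x xs where x: "b = foldl br (gen x) (map gen xs)"
      "d x + sum_list (map d xs) = magma_deg d t" by blast
    have "br (mon s) (foldl br (gen x) (map gen xs)) \<in> ?S (magma_deg d s + d x + sum_list (map d xs))"
      by (rule br_foldl_mem[where Y = UNIV and S = ?S and d = d and u = gen])
        (use Br(1) closed sub in \<open>auto intro: exI[of _ "od _"] homog_gen\<close>)
    also have "magma_deg d s + d x + sum_list (map d xs) = magma_deg d s + magma_deg d t"
      by (simp add: x(2)[symmetric] ac_simps)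
    finally show "br (mon s) b \<in> ?S (magma_deg d s + magma_deg d t)"
      by (simp only: x(1))
  qed
  then show ?case by (simp add: br_mon)
qed

end

section \<open>Lyndon words\<close>

lemma lexord_cases:
  assumes "(u, v) \<in> lexord r"
  obtains (prefix) t where "t \<noteq> []" "v = u @ t"
  | (differ) p a b x y where "(a, b) \<in> r" "u = p @ a # x" "v = p @ b # y"
  using assms unfolding lexord_def by blast

text \<open>The length condition rules out that \<open>u\<close> is a proper prefix of
  \<open>v\<close>; the order is then decided at a letter and survives any continuation.\<close>

lemma lexord_append_mono:
  assumes "(u, v) \<in> lexord r" "length v \<le> length u"
  shows "(u @ x, v @ y) \<in> lexord r"
  using assms(1)
proof (cases rule: lexord_cases)
  case (prefix t)
  then show ?thesis using assms(2) by simp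
next
  case (differ p a b x' y')
  then show ?thesis using lexord_append_left_rightI[of a b r p "x' @ x" "y' @ y"] by simp
qed

lemma lexord_prefix: "t \<noteq> [] \<Longrightarrow> (u, u @ t) \<in> lexord r"
  by (cases t) (auto intro: lexord_append_rightI)

lemma lyndon_iff_append:
  "lyndon r w \<longleftrightarrow> w \<noteq> [] \<and> (\<forall>u v. u \<noteq> [] \<longrightarrow> v \<noteq> [] \<longrightarrow> w = u @ v \<longrightarrow> (w, v @ u) \<in> lexord r)"
proof -
  have "(w, rotate n w) \<in> lexord r"
    if "\<forall>u v. u \<noteq> [] \<longrightarrow> v \<noteq> [] \<longrightarrow> w = u @ v \<longrightarrow> (w, v @ u) \<in> lexord r" "0 < n" "n < length w" for n
    using that(1)[rule_format, of "take n w" "drop n w"] that(2,3) by (cases "w = []") (simp_all add: rotate_drop_take)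
  moreover have "(w, v @ u) \<in> lexord r"
    if "\<forall>n. 0 < n \<and> n < length w \<longrightarrow> (w, rotate n w) \<in> lexord r" "u \<noteq> []" "v \<noteq> []" "w = u @ v" for u v
    using that by (auto dest!: spec[of _ "length u"] simp: rotate_append)
  ultimately show ?thesis unfolding lyndon_def by blast
qed

text \<open>Totality is required on \<open>X\<close> only: \<open>trace_less\<close> compares the
  words \<open>std\<close>, which separate traces but not arbitrary sets of words.\<close>

locale alphabet =
  fixes r :: "('x \<times> 'x) set" and X :: "'x set"
  assumes trans_r: "trans r" and irrefl_r: "irrefl r" and total_r: "total_on X r"
begin

abbreviation lex_less (infix "\<lless>" 50) where "u \<lless> v \<equiv> (u, v) \<in> lexord r"

lemma lex_trans: "u \<lless> v \<Longrightarrow> v \<lless> w \<Longrightarrow> u \<lless> w"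
  using lexord_trans trans_r by blast

lemma lex_irrefl: "\<not> u \<lless> u"
  using lexord_irreflexive irrefl_r unfolding irrefl_def by blast

lemma lex_total: "u \<in> lists X \<Longrightarrow> v \<in> lists X \<Longrightarrow> u = v \<or> u \<lless> v \<or> v \<lless> u"
proof (induction u arbitrary: v)
  case Nil
  then show ?case by (cases v) auto
next
  case (Cons a u)
  show ?case
  proof (cases v)
    case Nil
    then show ?thesis by simp
  next
    case (Cons b v')
    then show ?thesis using Cons.IH[of v'] Cons.prems total_r unfolding total_on_def by auto
  qed
qed

lemma lex_append_leftD: "x @ u \<lless> x @ v \<Longrightarrow> u \<lless> v"
  using lexord_append_leftD irrefl_r unfolding irrefl_def by blast

lemma lyndon_iff_suffix:
  assumes "w \<in> lists X"
  shows "lyndon r w \<longleftrightarrow> w \<noteq> [] \<and> (\<forall>u v. u \<noteq> [] \<longrightarrow> v \<noteq> [] \<longrightarrow> w = u @ v \<longrightarrow> w \<lless> v)"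
proof -
  have "w \<lless> v"
    if L: "\<forall>u v. u \<noteq> [] \<longrightarrow> v \<noteq> [] \<longrightarrow> w = u @ v \<longrightarrow> w \<lless> v @ u"
      and w: "u \<noteq> []" "v \<noteq> []" "w = u @ v" for u v
  proof (rule ccontr)
    assume "\<not> w \<lless> v"
    moreover have "w \<noteq> v" using w by simp
    ultimately have "v \<lless> w" using lex_total[of w v] assms w by auto
    then show False
    proof (cases rule: lexord_cases)
      \<comment> \<open>The suffix \<open>v\<close> is also a prefix: w = u v = v t with |t| = |u|.
        Comparing \<open>w\<close> with its rotation v u gives t < u, hence t v < u v = w, although
        t v is itself a rotation of \<open>w\<close>.\<close>
      case (prefix t)
      have "v @ t \<lless> v @ u" using L w prefix by auto
      then have "t \<lless> u" by (rule lex_append_leftD)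
      moreover have len: "length t = length u" using prefix w
        by (metis add.commute add_left_cancel length_append)
      ultimately have "t @ v \<lless> u @ v" using lexord_append_mono by fastforce
      moreover have "w \<lless> t @ v" using L prefix w(2) by blast
      ultimately show False using w(3) lex_trans[of w "t @ v" w] lex_irrefl by auto
    next
      case (differ p a b x y)
      then have "v @ u \<lless> w"
        using lexord_append_left_rightI[of a b r p "x @ u" y] by simp
      moreover have "w \<lless> v @ u" using L w by blast
      ultimately show False using lex_trans[of w "v @ u" w] lex_irrefl by auto
    qed
  qed
  moreover have "w \<lless> v @ u" if "w \<lless> v" "w = u @ v" for u v
    using lexord_append_mono[of w v r "[]" u] that by simp
  ultimately show ?thesis unfolding lyndon_iff_append by blast
qed

lemma lyndon_singleton: "lyndon r [x]"
  unfolding lyndon_iff_append by (auto simp: Cons_eq_append_conv)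

lemma lyndon_less_suffix:
  "lyndon r (u @ v) \<Longrightarrow> u @ v \<in> lists X \<Longrightarrow> u \<noteq> [] \<Longrightarrow> v \<noteq> [] \<Longrightarrow> u @ v \<lless> v"
  using lyndon_iff_suffix by blast

text \<open>If \<open>u\<close> is a prefix, then v = u t with v < t since \<open>v\<close> is
  Lyndon, so u v < u t = v. Otherwise the order is decided inside \<open>u\<close>.\<close>

lemma lyndon_append_less:
  assumes "v \<in> lists X" "lyndon r v" "u \<noteq> []" "u \<lless> v"
  shows "u @ v \<lless> v"
  using assms(4)
proof (cases rule: lexord_cases)
  case (prefix t)
  then have "v \<lless> t" using lyndon_less_suffix assms by blast
  then show ?thesis using prefix lexord_append_leftI by metis
next
  case (differ p a b x y)
  then show ?thesis using lexord_append_left_rightI[of a b r p "x @ v" y] by simp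
qed

lemma lyndon_append:
  assumes "u \<in> lists X" "v \<in> lists X" "lyndon r u" "lyndon r v" "u \<lless> v"
  shows "lyndon r (u @ v)"
proof -
  have "u \<noteq> []" "v \<noteq> []" using assms(3,4) unfolding lyndon_def by auto
  have 1: "u @ v \<lless> v" using lyndon_append_less assms \<open>u \<noteq> []\<close> by blast
  have "u @ v \<lless> s" if "p \<noteq> []" "s \<noteq> []" "u @ v = p @ s" for p s
  proof -
    from that(3) consider (a) t where "t \<noteq> []" "u = p @ t" "s = t @ v"
      | (b) "s = v" | (c) t where "t \<noteq> []" "v = t @ s"
      by (auto simp: append_eq_append_conv2)
    then show ?thesis
    proof cases
      case a
      then have "u \<lless> t" using lyndon_less_suffix assms that by blast
      then show ?thesis using a lexord_append_mono[of u t r v v] by simp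
    next
      case b
      then show ?thesis using 1 by simp
    next
      case c
      then have "v \<lless> s" using lyndon_less_suffix assms that by blast
      then show ?thesis using lex_trans[OF 1] by simp
    qed
  qed
  then show ?thesis using \<open>u \<noteq> []\<close> assms lyndon_iff_suffix[of "u @ v"] by auto
qed

text \<open>Passing repeatedly to a proper suffix that is smaller must end in a Lyndon word. This
  weak form of the Lyndon factorization suffices for both facts about standard factorizations
  below.\<close>

lemma obtain_lyndon_suffix:
  assumes "y \<in> lists X" "y \<noteq> []"
  obtains p m where "y = p @ m" "lyndon r m" "m = y \<or> m \<lless> y"
  using assms
proof (induction "length y" arbitrary: y thesis rule: less_induct)
  case less
  show ?case
  proof (cases "lyndon r y")
    case True
    then show ?thesis using less.prems(1)[of "[]" y] by simp
  next
    case False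
    then obtain u s where s: "u \<noteq> []" "s \<noteq> []" "y = u @ s" "\<not> y \<lless> s"
      using lyndon_iff_suffix[OF less.prems(2)] less.prems(3) by metis
    have "s \<noteq> y" using s by simp
    then have sy: "s \<lless> y" using lex_total[of s y] s less.prems by auto
    obtain p m where pm: "s = p @ m" "lyndon r m" "m = s \<or> m \<lless> s"
      using less.hyps[of s] s less.prems by auto
    have "m \<lless> y" using pm(3) sy lex_trans[of m s y] by auto
    then show ?thesis using less.prems(1)[of "u @ p" m] s pm by simp
  qed
qed

text \<open>The conditions on the left factor in \<^const>\<open>std_split\<close> hold automatically for the longest
  proper Lyndon suffix.\<close>

lemma std_split_props:
  assumes w: "w \<in> lists X" "lyndon r w" "2 \<le> length w"
  defines "n \<equiv> std_split r w"
  shows "n = (LEAST n. 0 < n \<and> n < length w \<and> lyndon r (drop n w))"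
    and "0 < n" "n < length w" "lyndon r (take n w)" "lyndon r (drop n w)" "take n w \<lless> drop n w"
proof -
  define P where "P n \<longleftrightarrow> 0 < n \<and> n < length w \<and> lyndon r (drop n w)" for n
  define m where "m = (LEAST n. P n)"
  have "drop (length w - 1) w = [last w]"
  proof -
    have "w \<noteq> []" using w(3) by auto
    then show ?thesis by (metis append_butlast_last_id append_eq_conv_conj length_butlast)
  qed
  then have "P (length w - 1)" unfolding P_def using w lyndon_singleton by auto
  then have Pm: "P m" unfolding m_def by (rule LeastI)
  have min: "m \<le> k" if "P k" for k unfolding m_def using that by (rule Least_le)
  let ?u = "take m w" and ?v = "drop m w"
  have m: "0 < m" "m < length w" "lyndon r ?v" using Pm unfolding P_def by auto
  have ne: "?u \<noteq> []" "?v \<noteq> []" using m by auto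
  have in_X: "?u \<in> lists X" "?v \<in> lists X" using w(1) by (auto dest: in_set_takeD in_set_dropD)
  have wv: "w \<lless> ?v" using lyndon_iff_suffix[OF w(1)] w(2) ne by (metis append_take_drop_id)
  have uw: "?u \<lless> w" using lexord_prefix[OF ne(2), of ?u r] by simp
  have uv: "?u \<lless> ?v" using lex_trans[OF uw wv] .
  \<comment> \<open>Otherwise \<open>?u\<close> has a Lyndon suffix \<open>t\<close> below
    \<open>?v\<close>, and t followed by \<open>?v\<close> is a Lyndon suffix longer than
    \<open>?v\<close>, against the minimality of \<open>m\<close>.\<close>
  have "lyndon r ?u"
  proof (rule ccontr)
    assume "\<not> lyndon r ?u"
    then obtain p s where s: "p \<noteq> []" "s \<noteq> []" "?u = p @ s" "\<not> ?u \<lless> s"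
      using lyndon_iff_suffix[OF in_X(1)] ne by blast
    have sX: "s \<in> lists X" "p \<in> lists X" using in_X(1) unfolding s(3) by auto
    have "s \<noteq> ?u" using s by simp
    then have su: "s \<lless> ?u" using lex_total[OF sX(1) in_X(1)] s by auto
    obtain q t where t: "s = q @ t" "lyndon r t" "t = s \<or> t \<lless> s"
      by (rule obtain_lyndon_suffix[OF sX(1) s(2)])
    have "s \<lless> ?v" using lex_trans[OF su uv] .
    then have "t \<lless> ?v" using t(3) lex_trans[of t s ?v] by auto
    moreover have "t \<in> lists X" using sX t by auto
    ultimately have "lyndon r (t @ ?v)" using lyndon_append[of t ?v] in_X t m by simp
    moreover have weq: "w = (p @ q) @ t @ ?v" using s t by (metis append.assoc append_take_drop_id)
    then have "drop (length (p @ q)) w = t @ ?v" by (metis append_eq_conv_conj)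
    moreover have "length (p @ q) < length w" using weq ne
      by (metis append_is_Nil_conv length_append less_add_same_cancel1 length_greater_0_conv)
    ultimately have "P (length (p @ q))" unfolding P_def using s by auto
    then have "m \<le> length (p @ q)" by (rule min)
    moreover have "length ?u = m" using m by simp
    moreover have "t \<noteq> []" using t(2) unfolding lyndon_def by auto
    ultimately show False using arg_cong[OF s(3), of length] t(1) by simp
  qed
  note props = m(1,2) this m(3) uv
  have "std_split r w = m"
  proof -
    have "std_split r w = (LEAST n. 0 < n \<and> n < length w \<and> lyndon r (take n w) \<and> lyndon r (drop n w)
                    \<and> take n w \<lless> drop n w)"
      unfolding std_split_def using w by simp
    also have "\<dots> = m"
      by (rule Least_equality) (use props min in \<open>auto simp: P_def\<close>)
    finally show ?thesis .
  qed
  then show "n = (LEAST n. 0 < n \<and> n < length w \<and> lyndon r (drop n w))"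
    "0 < n" "n < length w" "lyndon r (take n w)" "lyndon r (drop n w)" "take n w \<lless> drop n w"
    unfolding n_def using props by (simp_all add: m_def P_def)
qed

text \<open>The criterion that decides, in the rewriting, whether a bracket of two Lyndon words is
  already a Lyndon bracket. It works because the right factor of \<open>u\<close> is the longest
  proper Lyndon suffix of \<open>u\<close>.\<close>

lemma std_split_append:
  assumes uv: "u \<in> lists X" "v \<in> lists X" "lyndon r u" "lyndon r v" "u \<lless> v"
    and std: "length u = 1 \<or> \<not> drop (std_split r u) u \<lless> v"
  shows "std_split r (u @ v) = length u"
proof -
  have ne: "u \<noteq> []" "v \<noteq> []" using uv unfolding lyndon_def by auto
  then have "2 \<le> length (u @ v)"
    by (cases u; cases v) auto
  then have "std_split r (u @ v) = (LEAST n. 0 < n \<and> n < length (u @ v) \<and> lyndon r (drop n (u @ v)))"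
    using std_split_props(1)[of "u @ v"] lyndon_append[OF uv] uv by auto
  also have "\<dots> = length u"
  proof (rule Least_equality)
    show "0 < length u \<and> length u < length (u @ v) \<and> lyndon r (drop (length u) (u @ v))"
      using ne uv by simp
    fix n assume n: "0 < n \<and> n < length (u @ v) \<and> lyndon r (drop n (u @ v))"
    show "length u \<le> n"
    proof (rule ccontr)
      assume "\<not> length u \<le> n"
      then have nu: "n < length u" by simp
      define y where "y = drop n u"
      have y: "y \<noteq> []" "y \<in> lists X" "lyndon r (y @ v)"
        using n nu uv(1) by (auto simp: y_def dest: in_set_dropD)
      have yv: "y @ v \<lless> v" using lyndon_less_suffix y uv ne by auto
      obtain p m where m: "y = p @ m" "lyndon r m" "m = y \<or> m \<lless> y"
        by (rule obtain_lyndon_suffix[OF y(2,1)])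
      have mne: "m \<noteq> []" using m unfolding lyndon_def by auto
      define k where "k = n + length p"
      have k: "drop k u = m" unfolding k_def
        using m(1) unfolding y_def by (metis append_eq_conv_conj add.commute drop_drop)
      have ku: "k < length u" using k mne by (metis drop_all leI)
      have len: "2 \<le> length u" using n nu by auto
      define l where "l = std_split r u"
      have "l \<le> k"
        unfolding l_def std_split_props(1)[OF uv(1,3) len]
        by (rule Least_le) (use k ku m n in \<open>auto simp: k_def\<close>)
      define s where "s = drop l u"
      have s: "lyndon r s" "s \<in> lists X" unfolding s_def l_def
        using std_split_props(5)[OF uv(1,3) len] uv(1) by (auto dest: in_set_dropD)
      have "m = drop (k - l) s" unfolding s_def using k \<open>l \<le> k\<close> by simp
      then have sm: "s = m \<or> s \<lless> m"
        using s mne lyndon_iff_suffix[OF s(2)] by (metis append_take_drop_id append_Nil)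
      have "\<not> s \<lless> v" using std len unfolding s_def l_def by auto
      \<comment> \<open>From here the chain v <= s <= m <= y < y v < v is contradictory; s <= m
        holds because \<open>m\<close> is a suffix of the Lyndon word \<open>s\<close>.\<close>
      then have "v = s \<or> v \<lless> s" using lex_total s uv by blast
      then have "v = m \<or> v \<lless> m" using sm lex_trans[of v s m] by auto
      then have "v = y \<or> v \<lless> y" using m(3) lex_trans[of v m y] by auto
      moreover have "y \<lless> y @ v" using lexord_prefix ne by blast
      ultimately have "v \<lless> y @ v" using lex_trans[of v y "y @ v"] by auto
      then show False using lex_trans[OF _ yv, of v] lex_irrefl by auto
    qed
  qed
  finally show ?thesis .
qed

end

section \<open>Super Lyndon brackets span\<close>

text \<open>The recursion of \<open>lyndon_bracket\<close> on representatives in the free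
  nonassociative algebra, with \<open>E x\<close> put for the letter \<open>x\<close>;
  \<open>hom_lyndon_bracket\<close> identifies its class with the image under \<Phi>.\<close>

function lyndon_poly :: "('x \<Rightarrow> 'y na) \<Rightarrow> ('x \<times> 'x) set \<Rightarrow> 'x list \<Rightarrow> 'y na" where
  "lyndon_poly E r w =
     (if length w = 1 then E (hd w)
      else if 0 < std_split r w \<and> std_split r w < length w
      then br (lyndon_poly E r (take (std_split r w) w)) (lyndon_poly E r (drop (std_split r w) w))
      else 0)"
  by pat_completeness auto
termination
  by (relation "measure (\<lambda>(E, r, w). length w)") auto

declare lyndon_poly.simps [simp del]

lemma lyndon_poly_singleton [simp]: "lyndon_poly E r [x] = E x"
  by (simp add: lyndon_poly.simps)

lemma word_odd_append: "word_odd od (u @ v) \<longleftrightarrow> word_odd od u \<noteq> word_odd od v"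
  unfolding word_odd_def by auto

lemma word_odd_singleton [simp]: "word_odd od [x] = od x"
  unfolding word_odd_def by simp

lemma homog_lyndon_poly:
  assumes "w \<in> lists X" "\<And>x. x \<in> X \<Longrightarrow> homog od (odX x) (E x)"
  shows "homog od (word_odd odX w) (lyndon_poly E r w)"
  using assms(1)
proof (induction w rule: length_induct)
  case (1 w)
  show ?case
  proof (cases "length w = 1")
    case True
    then obtain x where "w = [x]" by (auto simp: length_Suc_conv)
    then show ?thesis using assms(2) 1(2) by simp
  next
    case False
    let ?n = "std_split r w"
    show ?thesis
    proof (cases "0 < ?n \<and> ?n < length w")
      case True
      have "homog od (word_odd odX (take ?n w)) (lyndon_poly E r (take ?n w))"
        "homog od (word_odd odX (drop ?n w)) (lyndon_poly E r (drop ?n w))"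
        using 1(1)[rule_format, of "take ?n w"] 1(1)[rule_format, of "drop ?n w"]
          True[THEN conjunct1] True[THEN conjunct2]
          set_take_subset[of ?n w] set_drop_subset[of ?n w] 1(2)
        by (simp_all add: in_lists_conv_set subset_iff)
      from homog_br[OF this] show ?thesis
        using False True word_odd_append[of odX "take ?n w" "drop ?n w"]
        by (subst lyndon_poly.simps) auto
    next
      case False
      then show ?thesis using \<open>length w \<noteq> 1\<close> by (subst lyndon_poly.simps) (auto simp: homog_0)
    qed
  qed
qed

lemma lyndon_poly_split:
  "2 \<le> length w \<Longrightarrow> 0 < std_split r w \<Longrightarrow> std_split r w < length w \<Longrightarrow>
   lyndon_poly E r w = br (lyndon_poly E r (take (std_split r w) w)) (lyndon_poly E r (drop (std_split r w) w))"
  by (subst lyndon_poly.simps) auto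

locale lyndon_span = alphabet r X + lie_relations od R
  for r :: "('x \<times> 'x) set" and X and od :: "'y \<Rightarrow> bool" and R +
  fixes odX :: "'x \<Rightarrow> bool" and E :: "'x \<Rightarrow> 'y na"
  assumes homog_E: "x \<in> X \<Longrightarrow> homog od (odX x) (E x)"
begin

abbreviation "P \<equiv> lyndon_poly E r"

definition Lyn :: "'x list set" where "Lyn = {w \<in> lists X. lyndon r w}"

text \<open>\<open>M\<close> fixes the letters. For a square the bound \<open>Q\<close> constrains
  its root \<open>s\<close>, not the word s s; in the rewriting \<open>Q\<close> says that a word is
  below the current one.\<close>

definition lspan :: "'x multiset \<Rightarrow> ('x list \<Rightarrow> bool) \<Rightarrow> 'y na set" where
  "lspan M Q = na.span (ideal \<union> ({P w |w. w \<in> Lyn \<and> mset w = M \<and> Q w}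
      \<union> {br (P s) (P s) |s. s \<in> Lyn \<and> word_odd odX s \<and> mset s + mset s = M \<and> Q s}))"

lemma lspan_subspace: "na.subspace (lspan M Q)"
  unfolding lspan_def by (rule na.subspace_span)

lemma ideal_lspan: "ideal \<subseteq> lspan M Q"
  unfolding lspan_def using na.span_superset by blast

lemma lspan_mono: "(\<And>w. Q w \<Longrightarrow> Q' w) \<Longrightarrow> lspan M Q \<subseteq> lspan M Q'"
  unfolding lspan_def by (rule na.span_mono) blast

lemma lspan_word: "w \<in> Lyn \<Longrightarrow> mset w = M \<Longrightarrow> Q w \<Longrightarrow> P w \<in> lspan M Q"
  unfolding lspan_def by (rule na.span_base) blast

lemma lspan_square:
  "s \<in> Lyn \<Longrightarrow> word_odd odX s \<Longrightarrow> mset s + mset s = M \<Longrightarrow> Q s \<Longrightarrow> br (P s) (P s) \<in> lspan M Q"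
  unfolding lspan_def by (rule na.span_base) blast

lemma homog_P: "w \<in> Lyn \<Longrightarrow> homog od (word_odd odX w) (P w)"
  unfolding Lyn_def using homog_lyndon_poly[of w X od odX E r, OF _ homog_E] by simp

lemma homog_PP: "w \<in> Lyn \<Longrightarrow> homog od False (br (P w) (P w))"
  using homog_br[OF homog_P homog_P] by fastforce

lemma br_lspan_left:
  assumes "p \<in> lspan M Q"
    and "\<And>w. w \<in> Lyn \<Longrightarrow> mset w = M \<Longrightarrow> Q w \<Longrightarrow> br (P w) q \<in> lspan M' Q'"
    and "\<And>s. s \<in> Lyn \<Longrightarrow> mset s + mset s = M \<Longrightarrow> Q s \<Longrightarrow> br (br (P s) (P s)) q \<in> lspan M' Q'"
  shows "br p q \<in> lspan M' Q'"
  using assms(1) unfolding lspan_def[of M]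
  by (rule br_span_left_mem[OF _ lspan_subspace ideal_lspan]) (use assms in auto)

lemma br_lspan_right:
  assumes "p \<in> lspan M Q"
    and "\<And>w. w \<in> Lyn \<Longrightarrow> mset w = M \<Longrightarrow> Q w \<Longrightarrow> br q (P w) \<in> lspan M' Q'"
    and "\<And>s. s \<in> Lyn \<Longrightarrow> mset s + mset s = M \<Longrightarrow> Q s \<Longrightarrow> br q (br (P s) (P s)) \<in> lspan M' Q'"
  shows "br q p \<in> lspan M' Q'"
  using assms(1) unfolding lspan_def[of M]
  by (rule br_span_right_mem[OF _ lspan_subspace ideal_lspan]) (use assms in auto)

lemmas br_lspan_skew = br_skew_mem[OF lspan_subspace ideal_lspan]

text \<open>The induction invariant of the rewriting: brackets of total weight \<open>M\<close> whose largest factor is \<open>m\<close>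
  only involve words smaller than \<open>m\<close>. Squares need separate clauses because they are not Lyndon.\<close>

definition bracket_le :: "'x multiset \<Rightarrow> 'x list \<Rightarrow> bool" where
  "bracket_le M m \<longleftrightarrow>
     (\<forall>u\<in>Lyn. u \<lless> m \<longrightarrow> mset u + mset m = M \<longrightarrow> br (P u) (P m) \<in> lspan M (\<lambda>w. w \<lless> m)) \<and>
     (\<forall>s\<in>Lyn. s \<lless> m \<longrightarrow> mset s + mset s + mset m = M \<longrightarrow>
        br (br (P s) (P s)) (P m) \<in> lspan M (\<lambda>w. w \<lless> m)) \<and>
     (\<forall>u\<in>Lyn. u \<lless> m \<longrightarrow> mset m + mset m + mset u = M \<longrightarrow>
        br (br (P m) (P m)) (P u) \<in> lspan M (\<lambda>w. w \<lless> m))"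

text \<open>The invariant speaks of increasing pairs only. A decreasing pair is turned around by
  skew symmetry; two equal words give a square generator if odd and zero if even.\<close>

lemma lspan_pair:
  assumes le: "\<And>m. m \<in> Lyn \<Longrightarrow> Q m \<Longrightarrow> bracket_le M m" and down: "\<And>w m. Q m \<Longrightarrow> w \<lless> m \<Longrightarrow> Q w"
    and x: "x \<in> Lyn" "Q x" and y: "y \<in> Lyn" "Q y" and M: "mset x + mset y = M"
  shows "br (P x) (P y) \<in> lspan M Q"
proof -
  have less: "br (P x) (P y) \<in> lspan M Q"
    if "x \<in> Lyn" "y \<in> Lyn" "Q y" "mset x + mset y = M" "x \<lless> y" for x y
  proof -
    have "br (P x) (P y) \<in> lspan M (\<lambda>w. w \<lless> y)"
      using le[of y] that unfolding bracket_le_def by blast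
    then show ?thesis using lspan_mono[of "\<lambda>w. w \<lless> y" Q M] down[OF \<open>Q y\<close>] by blast
  qed
  consider "x = y" | "x \<lless> y" | "y \<lless> x" using lex_total[of x y] x y unfolding Lyn_def by blast
  then show ?thesis
  proof cases
    case 1
    show ?thesis
    proof (cases "word_odd odX x")
      case True
      then show ?thesis using lspan_square x M 1 by simp
    next
      case False
      then show ?thesis using br_square_even homog_P[OF x(1)] ideal_lspan 1 by auto
    qed
  next
    case 2
    then show ?thesis using less x y M by blast
  next
    case 3
    then have "br (P y) (P x) \<in> lspan M Q" using less[of y x] x y M by (simp add: add.commute)
    then show ?thesis using br_lspan_skew homog_P x y by blast
  qed
qed

text \<open>The case not covered by the invariant is \<open>s = x\<close>, where the triple bracket
  vanishes by \<open>br_cube\<close>.\<close>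

lemma lspan_square_pair:
  assumes le: "\<And>m. m \<in> Lyn \<Longrightarrow> Q m \<Longrightarrow> bracket_le M m" and down: "\<And>w m. Q m \<Longrightarrow> w \<lless> m \<Longrightarrow> Q w"
    and s: "s \<in> Lyn" "Q s" and x: "x \<in> Lyn" "Q x" and M: "mset s + mset s + mset x = M"
  shows "br (br (P s) (P s)) (P x) \<in> lspan M Q"
proof -
  have mono: "lspan M (\<lambda>w. w \<lless> m) \<subseteq> lspan M Q" if "Q m" for m
    using lspan_mono[of "\<lambda>w. w \<lless> m" Q M] down[OF that] by blast
  consider "s = x" | "s \<lless> x" | "x \<lless> s" using lex_total[of s x] x s unfolding Lyn_def by blast
  then show ?thesis
  proof cases
    case 1
    have "br (P s) (br (P s) (P s)) \<in> lspan M Q"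
      using br_cube[OF homog_P[OF s(1)]] ideal_lspan by blast
    then show ?thesis using br_lspan_skew[OF homog_PP[OF s(1)] homog_P[OF s(1)]] 1 by blast
  next
    case 2
    then have "br (br (P s) (P s)) (P x) \<in> lspan M (\<lambda>w. w \<lless> x)"
      using le[of x] s x M unfolding bracket_le_def by blast
    then show ?thesis using mono x by blast
  next
    case 3
    then have "br (br (P s) (P s)) (P x) \<in> lspan M (\<lambda>w. w \<lless> s)"
      using le[of s] s x M unfolding bracket_le_def by blast
    then show ?thesis using mono s by blast
  qed
qed

lemma lspan_square_pair':
  assumes le: "\<And>m. m \<in> Lyn \<Longrightarrow> Q m \<Longrightarrow> bracket_le M m" and down: "\<And>w m. Q m \<Longrightarrow> w \<lless> m \<Longrightarrow> Q w"
    and s: "s \<in> Lyn" "Q s" and x: "x \<in> Lyn" "Q x" and M: "mset s + mset s + mset x = M"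
  shows "br (P x) (br (P s) (P s)) \<in> lspan M Q"
  by (rule br_lspan_skew[OF homog_P[OF x(1)] homog_PP[OF s(1)]], rule lspan_square_pair)
    (use assms in auto)

text \<open>The induction is on the size of \<open>M\<close> and then on \<open>m\<close>: an inner
  bracket has smaller size and turns into words below \<open>m\<close>, after which the outer
  bracket is again under control at total weight \<open>M\<close>.\<close>

lemma bracket_le_step:
  assumes smaller: "\<And>M' m'. size M' < size M \<Longrightarrow> m' \<in> Lyn \<Longrightarrow> bracket_le M' m'"
    and below: "\<And>m'. m' \<in> Lyn \<Longrightarrow> m' \<lless> m \<Longrightarrow> bracket_le M m'"
    and m: "m \<in> Lyn"
  shows "bracket_le M m"
proof -
  let ?Q = "\<lambda>w. w \<lless> m"
  have down: "\<And>w v. v \<lless> m \<Longrightarrow> w \<lless> v \<Longrightarrow> w \<lless> m" using lex_trans by blast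
  note pair = lspan_pair[of ?Q M, OF below down]
  note sq = lspan_square_pair[of ?Q M, OF below down]
  note sq' = lspan_square_pair'[of ?Q M, OF below down]
  have ne: "w \<noteq> []" "w \<in> lists X" "lyndon r w" "0 < size (mset w)" if "w \<in> Lyn" for w
    using that unfolding Lyn_def lyndon_def by auto
  have C1: "br (P u) (P m) \<in> lspan M ?Q"
    if u: "u \<in> Lyn" "u \<lless> m" "mset u + mset m = M" for u
  proof (cases "length u = 1 \<or> \<not> drop (std_split r u) u \<lless> m")
    \<comment> \<open>Here (u,m) is the standard factorization of the Lyndon word u m, so nothing
      has to be rewritten, and u m < m.\<close>
    case True
    then have sp: "std_split r (u @ m) = length u"
      using std_split_append[of u m] ne[OF u(1)] ne[OF m] u(2) by simp
    have "u @ m \<in> Lyn" using lyndon_append[of u m] ne[OF u(1)] ne[OF m] u(2) unfolding Lyn_def by simp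
    moreover have "P (u @ m) = br (P u) (P m)"
    proof -
      have "2 \<le> length (u @ m)" using ne(1)[OF u(1)] ne(1)[OF m] by (cases u; cases m; simp)
      then show ?thesis using ne(1)[OF u(1)] ne(1)[OF m] by (subst lyndon_poly_split) (auto simp: sp)
    qed
    moreover have "u @ m \<lless> m" using lyndon_append_less[of m u] ne[OF u(1)] ne[OF m] u(2) by simp
    ultimately show ?thesis using lspan_word[of "u @ m" M ?Q] u by simp
  next
    case False
    \<comment> \<open>The failed test gives u2 < m, and u1 < u < m anyway, so expanding [[u1,u2],m]
      by the right Jacobi rule leaves only factors below \<open>m\<close> outside the inner
      brackets.\<close>
    define u1 where "u1 = take (std_split r u) u"
    define u2 where "u2 = drop (std_split r u) u"
    have len: "2 \<le> length u" using False ne[OF u(1)] by (cases u) (auto simp: Suc_le_eq)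
    note props = std_split_props[OF ne(2,3)[OF u(1)] len]
    have u12: "u = u1 @ u2" "P u = br (P u1) (P u2)"
      using lyndon_poly_split[OF len props(2,3)] by (simp_all add: u1_def u2_def)
    have L: "u1 \<in> Lyn" "u2 \<in> Lyn" using props ne(2)[OF u(1)]
      by (auto simp: Lyn_def u1_def u2_def dest: in_set_takeD in_set_dropD)
    have less: "u2 \<lless> m" "u1 \<lless> m"
    proof -
      show "u2 \<lless> m" using False u2_def by simp
      have "u1 \<lless> u" using u12 ne(1)[OF L(2)] lexord_prefix by simp
      then show "u1 \<lless> m" using u(2) lex_trans by blast
    qed
    have M: "mset u1 + mset u2 + mset m = M" using u u12 by simp
    have s: "bracket_le (mset u2 + mset m) m" "bracket_le (mset u1 + mset m) m"
      using smaller m ne(4)[OF L(1)] ne(4)[OF L(2)] M by auto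
    have "br (P u2) (P m) \<in> lspan (mset u2 + mset m) ?Q"
      using s(1) L less unfolding bracket_le_def by blast
    then have "br (P u1) (br (P u2) (P m)) \<in> lspan M ?Q"
    proof (rule br_lspan_right)
      show "br (P u1) (P w) \<in> lspan M ?Q" if "w \<in> Lyn" "mset w = mset u2 + mset m" "w \<lless> m" for w
        by (rule pair) (use that L less M in \<open>auto simp: add.assoc\<close>)
      show "br (P u1) (br (P t) (P t)) \<in> lspan M ?Q"
        if "t \<in> Lyn" "mset t + mset t = mset u2 + mset m" "t \<lless> m" for t
        by (rule sq') (use that L less M in \<open>auto simp: ac_simps\<close>)
    qed
    moreover have "br (P u1) (P m) \<in> lspan (mset u1 + mset m) ?Q"
      using s(2) L less unfolding bracket_le_def by blast
    then have "br (br (P u1) (P m)) (P u2) \<in> lspan M ?Q"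
    proof (rule br_lspan_left)
      show "br (P w) (P u2) \<in> lspan M ?Q" if "w \<in> Lyn" "mset w = mset u1 + mset m" "w \<lless> m" for w
        by (rule pair) (use that L less M in \<open>auto simp: ac_simps\<close>)
      show "br (br (P t) (P t)) (P u2) \<in> lspan M ?Q"
        if "t \<in> Lyn" "mset t + mset t = mset u1 + mset m" "t \<lless> m" for t
        by (rule sq) (use that L less M in \<open>auto simp: ac_simps\<close>)
    qed
    ultimately show ?thesis
      unfolding u12(2) by (rule br_right_mem[OF lspan_subspace ideal_lspan homog_P[OF L(2)] homog_P[OF m]])
  qed
  \<comment> \<open>The square is split: [[s,s],m] reduces to [s,[s,m]], whose inner bracket has
    smaller size.\<close>
  have C2: "br (br (P s) (P s)) (P m) \<in> lspan M ?Q"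
    if s: "s \<in> Lyn" "s \<lless> m" "mset s + mset s + mset m = M" for s
  proof -
    have "bracket_le (mset s + mset m) m"
      using smaller m ne(4)[OF s(1)] s(3) by auto
    then have "br (P s) (P m) \<in> lspan (mset s + mset m) ?Q"
      using s unfolding bracket_le_def by blast
    then have "br (P s) (br (P s) (P m)) \<in> lspan M ?Q"
    proof (rule br_lspan_right)
      show "br (P s) (P w) \<in> lspan M ?Q" if "w \<in> Lyn" "mset w = mset s + mset m" "w \<lless> m" for w
        by (rule pair) (use that s in \<open>auto simp: ac_simps\<close>)
      show "br (P s) (br (P t) (P t)) \<in> lspan M ?Q"
        if "t \<in> Lyn" "mset t + mset t = mset s + mset m" "t \<lless> m" for t
        by (rule sq') (use that s in \<open>auto simp: ac_simps\<close>)
    qed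
    then show ?thesis
      using br_left_mem[OF lspan_subspace ideal_lspan homog_P[OF s(1)] homog_P[OF s(1)]] by blast
  qed
  \<comment> \<open>Now \<open>m\<close> itself stays outside. After [m,u] is rewritten into words w
    < m, the bracket [m,w] is an instance of \<open>C1\<close> or, for squares, of
    \<open>C2\<close>, at the same \<open>M\<close>.\<close>
  have C3: "br (br (P m) (P m)) (P u) \<in> lspan M ?Q"
    if u: "u \<in> Lyn" "u \<lless> m" "mset m + mset m + mset u = M" for u
  proof -
    have "bracket_le (mset u + mset m) m"
      using smaller m ne(4)[OF m] u(3) by auto
    then have "br (P u) (P m) \<in> lspan (mset u + mset m) ?Q"
      using u unfolding bracket_le_def by blast
    then have "br (P m) (P u) \<in> lspan (mset u + mset m) ?Q"
      using br_lspan_skew homog_P u(1) m by blast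
    then have "br (P m) (br (P m) (P u)) \<in> lspan M ?Q"
    proof (rule br_lspan_right)
      fix w assume w: "w \<in> Lyn" "mset w = mset u + mset m" "w \<lless> m"
      then have "br (P w) (P m) \<in> lspan M ?Q" using C1 u by (simp add: ac_simps)
      then show "br (P m) (P w) \<in> lspan M ?Q" using br_lspan_skew homog_P w(1) m by blast
    next
      fix t assume t: "t \<in> Lyn" "mset t + mset t = mset u + mset m" "t \<lless> m"
      then have "br (br (P t) (P t)) (P m) \<in> lspan M ?Q" using C2 u by (simp add: ac_simps)
      then show "br (P m) (br (P t) (P t)) \<in> lspan M ?Q"
        using br_lspan_skew[OF homog_P[OF m] homog_PP[OF t(1)]] by blast
    qed
    then show ?thesis
      using br_left_mem[OF lspan_subspace ideal_lspan homog_P[OF m] homog_P[OF m]] by blast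
  qed
  show ?thesis unfolding bracket_le_def using C1 C2 C3 by blast
qed

text \<open>The lexicographic order on words of unbounded length need not be well founded, so the
  inner induction is confined to a finite set.\<close>

lemma wf_lex_finite: "finite A \<Longrightarrow> wf {(u, v). u \<in> A \<and> v \<in> A \<and> u \<lless> v}"
proof (rule finite_acyclic_wf)
  assume A: "finite A"
  show "finite {(u, v). u \<in> A \<and> v \<in> A \<and> u \<lless> v}"
    by (rule finite_subset[of _ "A \<times> A"]) (use A in auto)
  have "trans {(u, v). u \<in> A \<and> v \<in> A \<and> u \<lless> v}"
    by (rule transI) (use lex_trans in blast)
  then show "acyclic {(u, v). u \<in> A \<and> v \<in> A \<and> u \<lless> v}"
    unfolding acyclic_def using lex_irrefl by (simp add: trancl_id)
qed

lemma bracket_le: "m \<in> Lyn \<Longrightarrow> bracket_le M m"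
proof (induction "size M" arbitrary: M m rule: less_induct)
  case less
  define A where "A = {w. set w \<subseteq> set_mset M \<and> length w \<le> size M}"
  have fin: "finite A" unfolding A_def by (rule finite_lists_length_le) simp
  \<comment> \<open>A word outside \<open>A\<close> cannot be part of \<open>M\<close>, so all
    clauses of the invariant are vacuous for it.\<close>
  have out: "bracket_le M w" if "w \<notin> A" for w
  proof -
    have "mset w \<subseteq># M \<Longrightarrow> w \<in> A" unfolding A_def
      by (metis (mono_tags, lifting) mem_Collect_eq set_mset_mset set_mset_mono size_mset size_mset_mono)
    then have "mset u + mset w \<noteq> M" "mset s + mset s + mset w \<noteq> M" "mset w + mset w + mset u \<noteq> M" for u s
      using that by (auto simp: subset_mset.le_iff_add ac_simps)
    then show ?thesis unfolding bracket_le_def by blast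
  qed
  have "bracket_le M m" if "m \<in> A" "m \<in> Lyn" for m
    using that
  proof (induction m rule: wf_induct_rule[OF wf_lex_finite[OF fin]])
    case (1 m)
    show ?case
    proof (rule bracket_le_step)
      show "bracket_le M' m'" if "size M' < size M" "m' \<in> Lyn" for M' m'
        using less.hyps that by blast
      show "bracket_le M m'" if "m' \<in> Lyn" "m' \<lless> m" for m'
        using 1 out that by (cases "m' \<in> A") auto
    qed (use 1 in auto)
  qed
  then show ?case using out less.prems by blast
qed

lemma lyndon_poly_square:
  assumes "s \<in> Lyn"
  shows "P (s @ s) = br (P s) (P s)"
proof -
  have s: "s \<noteq> []" using assms unfolding Lyn_def lyndon_def by auto
  have "\<not> lyndon r (s @ s)"
    unfolding lyndon_iff_append using s lex_irrefl by blast
  then have "std_split r (s @ s) = length s" unfolding std_split_def by simp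
  then show ?thesis using s by (subst lyndon_poly_split) (cases s; auto)+
qed

text \<open>Each further letter is a Lyndon word of length one; \<open>lspan_pair\<close> and
  \<open>lspan_square_pair\<close> with the trivial bound absorb it.\<close>

theorem left_normed_in_super_lyndon_span:
  assumes "x # xs \<in> lists X"
  shows "foldl br (E x) (map E xs) \<in>
    na.span (ideal \<union> {P w |w. w \<in> lists X \<and> super_lyndon r odX w \<and> mset w = mset (x # xs)})"
proof -
  have "foldl br (E x) (map E xs) \<in> lspan (mset (x # xs)) (\<lambda>_. True)"
    using assms
  proof (induction xs rule: rev_induct)
    case Nil
    then have "[x] \<in> Lyn" using lyndon_singleton unfolding Lyn_def by auto
    then show ?case using lspan_word[of "[x]" "{#x#}" "\<lambda>_. True"] by simp
  next
    case (snoc y ys)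
    have y: "[y] \<in> Lyn" using lyndon_singleton snoc.prems unfolding Lyn_def by auto
    have "foldl br (E x) (map E ys) \<in> lspan (mset (x # ys)) (\<lambda>_. True)"
      using snoc by simp
    then have "br (foldl br (E x) (map E ys)) (P [y]) \<in> lspan (mset (x # ys @ [y])) (\<lambda>_. True)"
    proof (rule br_lspan_left)
      show "br (P w) (P [y]) \<in> lspan (mset (x # ys @ [y])) (\<lambda>_. True)"
        if "w \<in> Lyn" "mset w = mset (x # ys)" for w
        by (rule lspan_pair) (use that y bracket_le in auto)
      show "br (br (P s) (P s)) (P [y]) \<in> lspan (mset (x # ys @ [y])) (\<lambda>_. True)"
        if "s \<in> Lyn" "mset s + mset s = mset (x # ys)" for s
        by (rule lspan_square_pair) (use that y bracket_le in auto)
    qed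
    then show ?case by simp
  qed
  also have "lspan (mset (x # xs)) (\<lambda>_. True) \<subseteq>
    na.span (ideal \<union> {P w |w. w \<in> lists X \<and> super_lyndon r odX w \<and> mset w = mset (x # xs)})"
    unfolding lspan_def
  proof (rule na.span_mono, rule Un_mono[OF order.refl], rule Un_least)
    show "{P w |w. w \<in> Lyn \<and> mset w = mset (x # xs) \<and> True} \<subseteq>
      {P w |w. w \<in> lists X \<and> super_lyndon r odX w \<and> mset w = mset (x # xs)}"
      unfolding Lyn_def super_lyndon_def by blast
    show "{br (P s) (P s) |s. s \<in> Lyn \<and> word_odd odX s \<and> mset s + mset s = mset (x # xs) \<and> True} \<subseteq>
      {P w |w. w \<in> lists X \<and> super_lyndon r odX w \<and> mset w = mset (x # xs)}"
    proof
      fix p assume "p \<in> {br (P s) (P s) |s. s \<in> Lyn \<and> word_odd odX s \<and> mset s + mset s = mset (x # xs) \<and> True}"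
      then obtain s where s: "s \<in> Lyn" "word_odd odX s" "mset s + mset s = mset (x # xs)" "p = br (P s) (P s)"
        by blast
      then have "p = P (s @ s)" "s @ s \<in> lists X" "super_lyndon r odX (s @ s)" "mset (s @ s) = mset (x # xs)"
        unfolding lyndon_poly_square[OF s(1)] Lyn_def super_lyndon_def by auto
      then show "p \<in> {P w |w. w \<in> lists X \<and> super_lyndon r odX w \<and> mset w = mset (x # xs)}"
        by blast
    qed
  qed
  finally show ?thesis .
qed

end

section \<open>Linear operators acting from the right\<close>

text \<open>A type of its own for linear endomorphisms of the space of functionals, so that the
  simplification rules of rings and vector spaces apply to operators.\<close>

typedef 'w lop = "{T :: ('w \<Rightarrow> complex) \<Rightarrow> 'w \<Rightarrow> complex.
    (\<forall>F G. T (\<lambda>w. F w + G w) = (\<lambda>w. T F w + T G w)) \<and> (\<forall>c F. T (\<lambda>w. c * F w) = (\<lambda>w. c * T F w))}"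
  morphisms app Lop
  by (rule exI[of _ "\<lambda>F. F"]) simp

setup_lifting type_definition_lop

lemma lop_eqI: "(\<And>F w. app x F w = app y F w) \<Longrightarrow> x = y"
  by (metis app_inject ext)

lemma app_plus: "app x (\<lambda>w. F w + G w) = (\<lambda>w. app x F w + app x G w)"
  and app_scale: "app x (\<lambda>w. c * F w) = (\<lambda>w. c * app x F w)"
  using app[of x] by auto

lemma app_zero: "app x (\<lambda>_. 0) = (\<lambda>_. 0)"
  using app_scale[of x 0 "\<lambda>_. 0"] by simp

lemma app_diff: "app x (\<lambda>w. F w - G w) = (\<lambda>w. app x F w - app x G w)"
  using app_plus[of x F "\<lambda>w. (-1) * G w"] app_scale[of x "-1" G] by simp

instantiation lop :: (type) ring_1
begin

lift_definition zero_lop :: "'a lop" is "\<lambda>F w. 0" by simp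
lift_definition one_lop :: "'a lop" is "\<lambda>F. F" by simp
lift_definition plus_lop :: "'a lop \<Rightarrow> 'a lop \<Rightarrow> 'a lop" is "\<lambda>x y F w. x F w + y F w"
  by (auto simp: algebra_simps)
lift_definition minus_lop :: "'a lop \<Rightarrow> 'a lop \<Rightarrow> 'a lop" is "\<lambda>x y F w. x F w - y F w"
  by (auto simp: algebra_simps)
lift_definition uminus_lop :: "'a lop \<Rightarrow> 'a lop" is "\<lambda>x F w. - x F w"
  by (auto simp: algebra_simps)
text \<open>Composition is reversed to obtain a right action: the product of the operators
  \<open>E\<close> along a word shifts a functional by that word, read from left to right.\<close>

lift_definition times_lop :: "'a lop \<Rightarrow> 'a lop \<Rightarrow> 'a lop" is "\<lambda>x y F. y (x F)"
  by simp

instance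
proof
  fix a b c :: "'a lop"
  show "a * b * c = a * (b * c)" by transfer simp
  show "1 * a = a" "a * 1 = a" by (transfer; simp)+
  show "a + b + c = a + (b + c)" "a + b = b + a" "0 + a = a" "- a + a = 0" "a - b = a + - b"
    by (transfer; simp add: fun_eq_iff)+
  show "(a + b) * c = a * c + b * c" "a * (b + c) = a * b + a * c"
    by (transfer; simp add: fun_eq_iff)+
  have "app (0::'a lop) (\<lambda>_. 1) undefined \<noteq> app 1 (\<lambda>_. 1) undefined"
    by (simp add: zero_lop.rep_eq one_lop.rep_eq)
  then show "(0::'a lop) \<noteq> 1" by auto
qed
end

lift_definition sc :: "complex \<Rightarrow> 'a lop \<Rightarrow> 'a lop" is "\<lambda>c x F w. c * x F w"
  by (auto simp: algebra_simps)

lemma app_simps [simp]: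
  "app (x + y) F = (\<lambda>w. app x F w + app y F w)"
  "app (x - y) F = (\<lambda>w. app x F w - app y F w)"
  "app (- x) F = (\<lambda>w. - app x F w)"
  "app (x * y) F = app y (app x F)"
  "app 0 F = (\<lambda>w. 0)" "app 1 F = F"
  "app (sc c x) F = (\<lambda>w. c * app x F w)"
  by (transfer; simp)+

interpretation lop: vector_space sc
  by unfold_locales (auto intro!: lop_eqI simp: algebra_simps)

lemma sc_mult_left [simp]: "sc c x * y = sc c (x * y)"
  and sc_mult_right [simp]: "x * sc c y = sc c (x * y)"
  by (auto intro!: lop_eqI simp: app_scale)

section \<open>Super commutators and representations\<close>

text \<open>The operators carry no grading, so the parities of both arguments are passed
  explicitly.\<close>

definition sbr :: "bool \<Rightarrow> bool \<Rightarrow> 'w lop \<Rightarrow> 'w lop \<Rightarrow> 'w lop" where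
  "sbr a b x y = x * y - sc (koszul a b) (y * x)"

lemma sbr_add [simp]: "sbr a b (x + y) z = sbr a b x z + sbr a b y z"
  "sbr a b z (x + y) = sbr a b z x + sbr a b z y"
  by (auto simp: sbr_def algebra_simps lop.scale_right_distrib)

lemma sbr_sc [simp]: "sbr a b (sc c x) z = sc c (sbr a b x z)" "sbr a b z (sc c x) = sc c (sbr a b z x)"
  by (auto simp: sbr_def lop.scale_right_diff_distrib lop.scale_left_commute)

lemma sbr_zero [simp]: "sbr a b 0 x = 0" "sbr a b x 0 = 0"
  by (auto simp: sbr_def)

lemma sbr_skew: "sbr a b x y = - sc (koszul a b) (sbr b a y x)"
  by (cases a; cases b; simp add: sbr_def algebra_simps)

lemma sbr_jacobi:
  "sbr a (b \<noteq> c) x (sbr b c y z) = sbr (a \<noteq> b) c (sbr a b x y) z + sc (koszul a b) (sbr b (a \<noteq> c) y (sbr a c x z))"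
  by (cases a; cases b; cases c; simp add: sbr_def algebra_simps)

primrec evm :: "('g \<Rightarrow> 'w lop) \<Rightarrow> ('g \<Rightarrow> bool) \<Rightarrow> 'g magma \<Rightarrow> 'w lop" where
  "evm G od (Gen g) = G g"
| "evm G od (Br s t) = sbr (magma_odd od s) (magma_odd od t) (evm G od s) (evm G od t)"

text \<open>For \<open>b\<close> true, the odd part is taken with a minus sign: commuting an odd element past an
  inhomogeneous one twists the latter in this way.\<close>

definition ev :: "('g \<Rightarrow> 'w lop) \<Rightarrow> ('g \<Rightarrow> bool) \<Rightarrow> bool \<Rightarrow> 'g na \<Rightarrow> 'w lop" where
  "ev G od b p = (\<Sum>t\<in>Poly_Mapping.keys p. sc (Poly_Mapping.lookup p t * koszul b (magma_odd od t)) (evm G od t))"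

lemma ev_superset:
  assumes "finite S" "Poly_Mapping.keys p \<subseteq> S"
  shows "ev G od b p = (\<Sum>t\<in>S. sc (Poly_Mapping.lookup p t * koszul b (magma_odd od t)) (evm G od t))"
  unfolding ev_def by (rule sum.mono_neutral_left) (use assms in \<open>auto simp: in_keys_iff\<close>)

lemma ev_add: "ev G od b (p + q) = ev G od b p + ev G od b q"
proof -
  let ?S = "Poly_Mapping.keys p \<union> Poly_Mapping.keys q"
  show ?thesis
    using Poly_Mapping.keys_add[of p q]
    by (simp add: ev_superset[of ?S] lookup_add lop.scale_left_distrib ring_distribs sum.distrib)
qed

lemma ev_scl: "ev G od b (scl c p) = sc c (ev G od b p)"
  using keys_scl[of c p]
  by (simp add: ev_superset[of "Poly_Mapping.keys p"] lop.scale_sum_right mult.assoc)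

lemma ev_zero [simp]: "ev G od b 0 = 0"
  by (simp add: ev_def)

lemma ev_diff: "ev G od b (p - q) = ev G od b p - ev G od b q"
  using ev_add[of G od b "p - q" q] by (simp add: algebra_simps)

lemma ev_sum: "ev G od b (\<Sum>x\<in>S. f x) = (\<Sum>x\<in>S. ev G od b (f x))"
  by (induction S rule: infinite_finite_induct) (auto simp: ev_add)

lemma ev_mon: "ev G od b (mon t) = sc (koszul b (magma_odd od t)) (evm G od t)"
  by (simp add: ev_def lookup_mon)

lemma na_linear_eq_on_span:
  assumes "p \<in> na.span B"
    and "\<And>x y. f (x + y) = f x + f y" "\<And>x y. g (x + y) = g x + g y"
    and "\<And>c x. f (scl c x) = sc c (f x)" "\<And>c x. g (scl c x) = sc c (g x)"
    and "\<And>b. b \<in> B \<Longrightarrow> f b = g b"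
  shows "f p = g p"
  using assms(1)
proof (induction rule: na.span_induct)
  case base
  have "f 0 = 0" "g 0 = 0" using assms(4)[of 0 0] assms(5)[of 0 0] by simp_all
  then show ?case unfolding na.subspace_def using assms by auto
next
  case (step x)
  then show ?case using assms(6) by simp
qed

lemma ev_homog: "homog od a p \<Longrightarrow> ev G od b p = sc (koszul b a) (ev G od False p)"
  by (rule na_linear_eq_on_span[OF homog_span])
    (auto simp: ev_add ev_scl ev_mon lop.scale_right_distrib lop.scale_left_commute)

lemma ev_br:
  assumes "homog od a p" "homog od b q"
  shows "ev G od False (br p q) = sbr a b (ev G od False p) (ev G od False q)"
proof -
  have 1: "ev G od False (br p (mon t)) = sbr a (magma_odd od t) (ev G od False p) (evm G od t)" for t
    by (rule na_linear_eq_on_span[OF homog_span[OF assms(1)]])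
      (auto simp: ev_add ev_scl ev_mon br_add_left br_mon)
  show ?thesis
    by (rule na_linear_eq_on_span[OF homog_span[OF assms(2)]])
      (auto simp: ev_add ev_scl ev_mon br_add_right 1)
qed

lemma ev_br_mon_left:
  "ev G od b (br (mon s) p) = sc (koszul b (magma_odd od s))
     (evm G od s * ev G od b p - ev G od (b \<noteq> magma_odd od s) p * evm G od s)"
proof (rule na_linear_eq_on_span[OF na_span_mon])
  show "ev G od b (br (mon s) x) = sc (koszul b (magma_odd od s))
     (evm G od s * ev G od b x - ev G od (b \<noteq> magma_odd od s) x * evm G od s)"
    if "x \<in> mon ` Poly_Mapping.keys p" for x
    using that by (cases b; cases "magma_odd od s")
      (auto simp: br_mon ev_mon sbr_def koszul_def algebra_simps split: if_splits)
qed (auto simp: ev_add ev_scl br_add_right algebra_simps lop.scale_right_distrib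
      lop.scale_right_diff_distrib lop.scale_left_commute)

lemma ev_br_mon_right:
  "ev G od b (br p (mon s)) = sc (koszul b (magma_odd od s))
     (ev G od b p * evm G od s - evm G od s * ev G od (b \<noteq> magma_odd od s) p)"
proof (rule na_linear_eq_on_span[OF na_span_mon])
  show "ev G od b (br x (mon s)) = sc (koszul b (magma_odd od s))
     (ev G od b x * evm G od s - evm G od s * ev G od (b \<noteq> magma_odd od s) x)"
    if "x \<in> mon ` Poly_Mapping.keys p" for x
    using that by (cases b; cases "magma_odd od s")
      (auto simp: br_mon ev_mon sbr_def koszul_def algebra_simps split: if_splits)
qed (auto simp: ev_add ev_scl br_add_left algebra_simps lop.scale_right_distrib
      lop.scale_right_diff_distrib lop.scale_left_commute)

definition kills :: "('w \<Rightarrow> complex) set \<Rightarrow> 'w lop \<Rightarrow> bool" where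
  "kills Z x \<longleftrightarrow> (\<forall>F\<in>Z. app x F = (\<lambda>_. 0))"

definition preserves :: "('w \<Rightarrow> complex) set \<Rightarrow> 'w lop \<Rightarrow> bool" where
  "preserves Z x \<longleftrightarrow> (\<forall>F\<in>Z. app x F \<in> Z)"

lemma kills_simps: "kills Z 0"
  "kills Z x \<Longrightarrow> kills Z y \<Longrightarrow> kills Z (x + y)"
  "kills Z x \<Longrightarrow> kills Z y \<Longrightarrow> kills Z (x - y)"
  "kills Z x \<Longrightarrow> kills Z (sc c x)"
  "kills Z x \<Longrightarrow> preserves Z y \<Longrightarrow> kills Z (y * x)"
  "kills Z x \<Longrightarrow> kills Z (x * y)"
  unfolding kills_def preserves_def by (auto simp: app_zero)

lemma kills_sbr: "kills Z x \<Longrightarrow> preserves Z y \<Longrightarrow> kills Z (sbr a b y x)"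
  unfolding sbr_def by (simp add: kills_simps)

lemma homog_lie_axioms: "r \<in> lie_axioms UNIV od \<Longrightarrow> \<exists>b. homog od b r"
  unfolding lie_axioms_def
proof (elim UnE CollectE exE conjE)
  fix s t assume r: "r = mon (Br s t) + scl (koszul (magma_odd od s) (magma_odd od t)) (mon (Br t s))"
  have "homog od (magma_odd od (Br s t)) r"
    unfolding r by (intro homog_add homog_scl) (auto simp: homog_def)
  then show ?thesis by blast
next
  fix s t u assume r: "r = mon (Br s (Br t u)) - mon (Br (Br s t) u)
      - scl (koszul (magma_odd od s) (magma_odd od t)) (mon (Br t (Br s u)))"
  have "homog od (magma_odd od (Br s (Br t u))) r"
    unfolding r by (intro homog_diff homog_scl) (auto simp: homog_def)
  then show ?thesis by blast
qed

lemma ev_lie_axioms: "r \<in> lie_axioms UNIV od \<Longrightarrow> ev G od False r = 0"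
  unfolding lie_axioms_def
proof (elim UnE CollectE exE conjE)
  fix s t assume r: "r = mon (Br s t) + scl (koszul (magma_odd od s) (magma_odd od t)) (mon (Br t s))"
  show ?thesis unfolding r
    by (simp add: ev_add ev_scl ev_mon) (subst sbr_skew, simp)
next
  fix s t u assume r: "r = mon (Br s (Br t u)) - mon (Br (Br s t) u)
      - scl (koszul (magma_odd od s) (magma_odd od t)) (mon (Br t (Br s u)))"
  show ?thesis unfolding r
    using sbr_jacobi[of "magma_odd od s" "magma_odd od t" "magma_odd od u"
        "evm G od s" "evm G od t" "evm G od u"]
    by (simp add: ev_diff ev_scl ev_mon)
qed

text \<open>Elements of the ideal need not be homogeneous, and bracketing with an odd monomial mixes
  the plain and the twisted evaluation. The induction therefore runs over both values of
  \<open>b\<close>; on the homogeneous generators they differ by a sign only.\<close>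

lemma kills_ideal:
  assumes Z: "\<And>F G. F \<in> Z \<Longrightarrow> G \<in> Z \<Longrightarrow> (\<lambda>w. F w - G w) \<in> Z" "\<And>F c. F \<in> Z \<Longrightarrow> (\<lambda>w. c * F w) \<in> Z"
    and G: "\<And>g. preserves Z (G g)"
    and R: "\<And>r. r \<in> R \<Longrightarrow> (\<exists>b. homog od b r) \<and> kills Z (ev G od False r)"
    and p: "p \<in> two_sided_ideal UNIV (lie_axioms UNIV od \<union> R)"
  shows "kills Z (ev G od b p)"
proof -
  have pres: "preserves Z (evm G od t)" for t
  proof (induction t)
    case (Br s t)
    then show ?case using Z unfolding preserves_def by (simp add: sbr_def)
  qed (simp add: G)
  show ?thesis using p
  proof (induction arbitrary: b rule: two_sided_ideal.induct)
    case (base r)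
    then obtain a where a: "homog od a r" using R homog_lie_axioms by blast
    have "kills Z (ev G od False r)" using base R ev_lie_axioms[of r od G] kills_simps(1) by auto
    then show ?case unfolding ev_homog[OF a, of G b] by (rule kills_simps)
  next
    case (left p q)
    show ?case using na_span_mon[of q]
    proof (induction rule: na.span_induct)
      case base
      show ?case unfolding na.subspace_def
        by (auto simp: br_add_left ev_add ev_scl kills_simps)
    next
      case (step x)
      then obtain s where "x = mon s" by auto
      then show ?case
        using kills_simps(3)[OF kills_simps(5)[OF left.IH pres] kills_simps(6)[OF left.IH]]
        by (auto simp: ev_br_mon_left intro!: kills_simps(4))
    qed
  next
    case (right p q)
    show ?case using na_span_mon[of q]
    proof (induction rule: na.span_induct)
      case base
      show ?case unfolding na.subspace_def
        by (auto simp: br_add_right ev_add ev_scl kills_simps)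
    next
      case (step x)
      then obtain s where "x = mon s" by auto
      then show ?case
        using kills_simps(3)[OF kills_simps(6)[OF right.IH] kills_simps(5)[OF right.IH pres]]
        by (auto simp: ev_br_mon_right intro!: kills_simps(4))
    qed
  qed (auto simp: ev_add ev_scl kills_simps)
qed

section \<open>Serre elements in an operator algebra\<close>

lemma sbr_False: "sbr False b x y = x * y - y * x"
  by (simp add: sbr_def)

text \<open>The \<open>m\<close>-fold application of ad \<open>e\<close> to \<open>y\<close>, where
  \<open>pe\<close> and \<open>py\<close> are the parities of \<open>e\<close> and \<open>y\<close>;
  the parity of the intermediate result is recomputed at each step.\<close>

primrec adn :: "bool \<Rightarrow> 'w lop \<Rightarrow> bool \<Rightarrow> 'w lop \<Rightarrow> nat \<Rightarrow> 'w lop" where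
  "adn pe e py y 0 = y"
| "adn pe e py y (Suc m) = sbr pe (py \<noteq> (pe \<and> odd m)) e (adn pe e py y m)"

lemma adn_zero_mono: "adn pe e py y m = 0 \<Longrightarrow> m \<le> n \<Longrightarrow> adn pe e py y n = 0"
  by (induction n) (auto simp: le_Suc_eq)

lemma adn_0 [simp]: "adn pe e py 0 m = 0"
  by (induction m) auto

lemma adn_weight:
  assumes "h * e - e * h = sc c e" "h * y - y * h = sc d y"
  shows "h * adn pe e py y m - adn pe e py y m * h = sc (d + c * of_nat m) (adn pe e py y m)"
proof (induction m)
  case (Suc m)
  let ?p = "py \<noteq> (pe \<and> odd m)" and ?z = "adn pe e py y m"
  have "sbr False (pe \<noteq> ?p) h (sbr pe ?p e ?z) = sbr pe ?p (sbr False pe h e) ?z + sbr pe ?p e (sbr False ?p h ?z)"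
    using sbr_jacobi[of False pe ?p h e ?z] by simp
  then show ?case using Suc assms
    by (simp add: sbr_False lop.scale_left_distrib[symmetric] ring_distribs ac_simps)
qed (use assms in simp)

text \<open>The coefficient c in [f, (ad e)^m y] = c (ad e)^(m-1) y. By the Jacobi identity a
  further ad \<open>e\<close> contributes the weight of the vector it is applied to and, with sign
  \<open>k\<close>, the previous coefficient. The factor \<open>s\<close> allows for a rescaled
  h.\<close>

primrec lower_coeff :: "complex \<Rightarrow> complex \<Rightarrow> complex \<Rightarrow> complex \<Rightarrow> nat \<Rightarrow> complex" where
  "lower_coeff k s a b 0 = 0"
| "lower_coeff k s a b (Suc m) = s * (a + b * of_nat m) + k * lower_coeff k s a b m"

lemma adn_lower:
  assumes fe: "sbr pe pe f e = h" and he: "h * e - e * h = sc (s * b) e"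
    and hy: "h * y - y * h = sc (s * a) y" and fy: "sbr pe py f y = 0"
  shows "sbr pe (py \<noteq> (pe \<and> odd m)) f (adn pe e py y m)
    = sc (lower_coeff (koszul pe pe) s a b m) (adn pe e py y (m - 1))"
proof (induction m)
  case 0
  then show ?case using fy by simp
next
  case (Suc m)
  let ?p = "\<lambda>m. py \<noteq> (pe \<and> odd m)" and ?z = "adn pe e py y"
  let ?c = "lower_coeff (koszul pe pe) s a b"
  have p: "?p (Suc m) \<longleftrightarrow> pe \<noteq> ?p m" by auto
  have "sbr pe (?p (Suc m)) f (?z (Suc m))
    = sbr False (?p m) h (?z m) + sc (koszul pe pe) (sbr pe (pe \<noteq> ?p m) e (sbr pe (?p m) f (?z m)))"
    unfolding p adn.simps using sbr_jacobi[of pe pe "?p m" f e "?z m"] fe by simp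
  also have "sbr False (?p m) h (?z m) = sc (s * (a + b * of_nat m)) (?z m)"
    using adn_weight[OF he hy, of pe py m] by (simp add: sbr_False algebra_simps)
  also have "sbr pe (pe \<noteq> ?p m) e (sbr pe (?p m) f (?z m)) = sc (?c m) (?z m)"
  proof (cases m)
    \<comment> \<open>At \<open>m = 0\<close> the index \<open>m - 1\<close> is truncated,
      harmlessly, since the coefficient is zero.\<close>
    case 0
    then show ?thesis using Suc by simp
  next
    case (Suc n)
    then have "(pe \<noteq> ?p m) \<longleftrightarrow> ?p n" by auto
    then have "sbr pe (pe \<noteq> ?p m) e (?z (m - 1)) = ?z m"
      using Suc by (simp only: adn.simps diff_Suc_1)
    then show ?thesis unfolding Suc.IH by simp
  qed
  finally show ?case by (simp add: lop.scale_left_distrib)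
qed

text \<open>The sl(2) coefficient; it vanishes at m = 1 - a.\<close>

lemma lower_coeff_even: "lower_coeff 1 s a 2 m = s * of_nat m * (a + of_nat m - 1)"
  by (induction m) (auto simp: algebra_simps)

text \<open>For odd \<open>e\<close> the sign alternates, as in osp(1|2). The next value, at 2t + 1,
  is s (a + 2t), which vanishes for a = -2t.\<close>

lemma lower_coeff_odd: "lower_coeff (-1) s a 2 (2 * t) = 2 * s * of_nat t"
  by (induction t) (auto simp: algebra_simps)

text \<open>Since \<open>f\<close> super commutes with \<open>e\<close>, it passes through all
  brackets with \<open>e\<close> up to sign and acts only on the innermost \<open>y\<close>.\<close>

lemma adn_other:
  assumes fe: "sbr pk pe f e = 0" and fy: "sbr pk py f y = g"
  shows "\<exists>c. sbr pk (py \<noteq> (pe \<and> odd m)) f (adn pe e py y m) = sc c (adn pe e (pk \<noteq> py) g m)"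
proof (induction m)
  case 0
  then show ?case using fy by (auto intro: exI[of _ 1])
next
  case (Suc m)
  let ?p = "py \<noteq> (pe \<and> odd m)" and ?z = "adn pe e py y m"
  obtain c where c: "sbr pk ?p f ?z = sc c (adn pe e (pk \<noteq> py) g m)" using Suc by blast
  have p: "(py \<noteq> (pe \<and> odd (Suc m))) \<longleftrightarrow> pe \<noteq> ?p" "(pk \<noteq> ?p) \<longleftrightarrow> ((pk \<noteq> py) \<noteq> (pe \<and> odd m))" by auto
  have "sbr pk (pe \<noteq> ?p) f (sbr pe ?p e ?z) = sc (koszul pk pe) (sbr pe (pk \<noteq> ?p) e (sbr pk ?p f ?z))"
    using sbr_jacobi[of pk pe ?p f e ?z] fe by simp
  also have "\<dots> = sc (koszul pk pe * c) (adn pe e (pk \<noteq> py) g (Suc m))"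
    unfolding c p(2) by simp
  finally show ?case unfolding p(1) adn.simps(2)[of pe e py] by blast
qed

text \<open>Here \<open>g\<close> stands for some h: [e,g] is a multiple of \<open>e\<close>, the
  second bracket is a multiple of [e,e], zero for even \<open>e\<close>, and the third vanishes for
  odd \<open>e\<close> by [e,[e,e]] = 0.\<close>

lemma adn_cartan:
  assumes "g * e - e * g = sc c e" and "c = 0 \<or> 2 \<le> m" and "c = 0 \<or> \<not> pe \<or> 3 \<le> m" and "0 < m"
  shows "adn pe e False g m = 0"
proof -
  have 1: "adn pe e False g 1 = - sc c e"
    using assms(1) by (simp add: sbr_def algebra_simps)
  show ?thesis
  proof (cases "c = 0")
    case True
    then show ?thesis using 1 assms(4) adn_zero_mono[of pe e False g 1 m] by simp
  next
    case False
    have 2: "adn pe e False g 2 = - sc c (sbr pe pe e e)"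
      using 1 by (simp add: numeral_2_eq_2 sbr_def lop.scale_right_diff_distrib mult.commute)
    show ?thesis
    proof (cases pe)
      case pe: False
      then have "adn pe e False g 2 = 0" using 2 by (simp add: sbr_def)
      then show ?thesis using False assms(2) adn_zero_mono by blast
    next
      case pe: True
      have "adn pe e False g 3 = sbr True False e (adn pe e False g 2)"
        using pe by (simp add: numeral_3_eq_3 numeral_2_eq_2)
      then have "adn pe e False g 3 = 0"
        unfolding 2 using pe by (simp add: sbr_def algebra_simps)
      then show ?thesis using False pe assms(3) adn_zero_mono by blast
    qed
  qed
qed

lemma adn_square:
  "adn False (sbr True True e e) py y m = sc (2 ^ m) (adn True e py y (2 * m))"
proof (induction m)
  case (Suc m)
  have "sbr False b (sbr True True e e) z = sc 2 (sbr True (\<not> b) e (sbr True b e z))" for b z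
  proof -
    have "sc 2 x = x + x" for x :: "'a lop"
      using lop.scale_left_distrib[of 1 1 x] by simp
    then show ?thesis by (cases b) (simp_all add: sbr_def algebra_simps)
  qed
  then show ?case by (simp add: Suc lop.scale_left_commute mult.commute)
qed simp

section \<open>A representation of the BKM superalgebra\<close>

locale bkm_data =
  fixes A :: "'i \<Rightarrow> 'i \<Rightarrow> real" and \<Psi> :: "'i set"
  assumes bkm: "bkm_supermatrix A \<Psi>"
begin

text \<open>The relations \<open>(ad e\<^sub>i)\<^sup>m e\<^sub>j = 0\<close>, including the commutation relations with \<open>m = 1\<close>. Those with
  \<open>ad [e\<^sub>i, e\<^sub>i] = 2 (ad e\<^sub>i)\<^sup>2\<close> for odd real \<open>i\<close> are consequences of these.\<close>

definition serre :: "'i \<Rightarrow> 'i \<Rightarrow> nat \<Rightarrow> bool" where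
  "serre i j m \<longleftrightarrow> (i \<in> I_re A \<and> i \<noteq> j \<and> real m = 1 - A i j) \<or> (A i j = 0 \<and> m = 1)"

lemma A_zero_iff: "A i j = 0 \<longleftrightarrow> A j i = 0"
  using bkm unfolding bkm_supermatrix_def by blast

text \<open>This is what singles out the Serre exponent. For odd \<open>i\<close> the entry
  \<open>A i j\<close> is even, so \<open>m\<close> is odd and only the values of the alternating
  coefficient at odd arguments matter.\<close>

lemma lower_coeff_serre:
  assumes "i \<in> I_re A" "i \<noteq> j" "real m = 1 - A i j"
  shows "lower_coeff (koszul (i \<in> \<Psi>) (i \<in> \<Psi>)) s (of_real (A i j)) 2 m = 0"
proof -
  have a: "complex_of_real (A i j) = 1 - of_nat m"
  proof -
    have "A i j = 1 - real m" using assms(3) by simp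
    then show ?thesis by simp
  qed
  show ?thesis
  proof (cases "i \<in> \<Psi>")
    case False
    then show ?thesis by (simp add: lower_coeff_even a)
  next
    case True
    then obtain z :: int where "A i j = 2 * of_int z"
      using bkm assms(1) unfolding bkm_supermatrix_def I_re_def by blast
    then have "real_of_int (int m) = real_of_int (1 - 2 * z)" using assms(3) by simp
    then have "int m = 1 - 2 * z" by linarith
    then have "odd (int m)" by simp
    then have "odd m" by simp
    then obtain t where t: "m = Suc (2 * t)" by (auto elim!: oddE)
    have "lower_coeff (-1) s (of_real (A i j)) 2 m = 0"
      unfolding a unfolding t lower_coeff.simps lower_coeff_odd by (simp add: algebra_simps)
    then show ?thesis using True by simp
  qed
qed

text \<open>Stated for arbitrary \<open>E\<close>, \<open>F\<close>, \<open>H\<close> and scaling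
  \<open>s\<close>, so that it serves the e's against the f's and, with roles exchanged, the f's
  against the e's. The bracket with \<open>F k\<close> lowers \<open>E i\<close>, or replaces
  \<open>E j\<close> by \<open>H j\<close>, or meets nothing.\<close>

lemma serre_commute:
  fixes E F H :: "'i \<Rightarrow> 'w lop"
  assumes FE: "\<And>k i. sbr (k \<in> \<Psi>) (i \<in> \<Psi>) (F k) (E i) = (if k = i then H i else 0)"
    and HE: "\<And>i j. H i * E j - E j * H i = sc (s i * of_real (A i j)) (E j)"
    and S: "serre i j m"
  shows "sbr (k \<in> \<Psi>) ((j \<in> \<Psi>) \<noteq> ((i \<in> \<Psi>) \<and> odd m)) (F k) (adn (i \<in> \<Psi>) (E i) (j \<in> \<Psi>) (E j) m) = 0"
proof -
  have m: "0 < m"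
  proof -
    have "i \<noteq> j \<Longrightarrow> A i j \<le> 0" using bkm unfolding bkm_supermatrix_def by blast
    then show ?thesis using S unfolding serre_def by (auto intro!: Nat.gr0I)
  qed
  consider (lower) "k = i" "i \<noteq> j" | (cartan) "k = j" "i \<noteq> j" | (none) "k \<noteq> i" "k \<noteq> j" | (same) "i = j" "k = i"
    by blast
  then show ?thesis
  proof cases
    case lower
    have "sbr (i \<in> \<Psi>) ((j \<in> \<Psi>) \<noteq> ((i \<in> \<Psi>) \<and> odd m)) (F i) (adn (i \<in> \<Psi>) (E i) (j \<in> \<Psi>) (E j) m)
      = sc (lower_coeff (koszul (i \<in> \<Psi>) (i \<in> \<Psi>)) (s i) (of_real (A i j)) (of_real (A i i)) m)
          (adn (i \<in> \<Psi>) (E i) (j \<in> \<Psi>) (E j) (m - 1))"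
      by (rule adn_lower[OF _ HE HE]) (use FE lower in auto)
    also have "lower_coeff (koszul (i \<in> \<Psi>) (i \<in> \<Psi>)) (s i) (of_real (A i j)) (of_real (A i i)) m = 0"
      using S lower_coeff_serre[of i j m "s i"] unfolding serre_def by (auto simp: I_re_def)
    finally show ?thesis using lower by simp
  next
    case cartan
    obtain c where c: "sbr (j \<in> \<Psi>) ((j \<in> \<Psi>) \<noteq> ((i \<in> \<Psi>) \<and> odd m)) (F j) (adn (i \<in> \<Psi>) (E i) (j \<in> \<Psi>) (E j) m)
      = sc c (adn (i \<in> \<Psi>) (E i) False (H j) m)"
      using adn_other[of "j \<in> \<Psi>" "i \<in> \<Psi>" "F j" "E i" "j \<in> \<Psi>" "E j" "H j" m] FE cartan by auto
    have "adn (i \<in> \<Psi>) (E i) False (H j) m = 0"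
    proof (rule adn_cartan[OF HE])
      \<comment> \<open>A nonzero \<open>A i j\<close> is negative, and an even integer if
        \<open>i\<close> is odd; so the exponent is at least 2, respectively 3, the thresholds of
        \<open>adn_cartan\<close>.\<close>
      have big: "A i j = 0 \<or> 2 \<le> m \<and> (i \<in> \<Psi> \<longrightarrow> 3 \<le> m)"
      proof (cases "A i j = 0")
        case False
        then have re: "i \<in> I_re A" "real m = 1 - A i j" using S unfolding serre_def by auto
        have neg: "A i j < 0" using bkm cartan False unfolding bkm_supermatrix_def
          by (metis order_le_imp_less_or_eq)
        have "3 \<le> m" if par: "i \<in> \<Psi>"
        proof -
          obtain z :: int where z: "A i j = 2 * of_int z"
            using bkm re(1) par unfolding bkm_supermatrix_def I_re_def by blast
          then have "z \<le> -1" using neg by simp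
          then have "A i j \<le> -2" using z by linarith
          then show ?thesis using re(2) by linarith
        qed
        moreover have "2 \<le> m" using re(2) neg by linarith
        ultimately show ?thesis by simp
      qed simp
      show "s j * of_real (A j i) = 0 \<or> 2 \<le> m" "s j * of_real (A j i) = 0 \<or> i \<notin> \<Psi> \<or> 3 \<le> m"
        using big A_zero_iff[of i j] by auto
    qed (rule m)
    then show ?thesis using c cartan by simp
  next
    case none
    then show ?thesis
      using adn_other[of "k \<in> \<Psi>" "i \<in> \<Psi>" "F k" "E i" "j \<in> \<Psi>" "E j" 0 m] FE by auto
  next
    case same
    then have A0: "A i i = 0" "m = 1" using S unfolding serre_def I_re_def by auto
    have "H i * E i = E i * H i" using HE[of i i] A0 by simp
    moreover have "sbr (i \<in> \<Psi>) (i \<in> \<Psi>) (F i) (E i) = H i" using FE[of i i] by simp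
    ultimately show ?thesis
      using sbr_jacobi[of "i \<in> \<Psi>" "i \<in> \<Psi>" "i \<in> \<Psi>" "F i" "E i" "E i"] same A0(2)
      by (cases "i \<in> \<Psi>") (simp_all add: sbr_def)
  qed
qed

section \<open>The action on functionals on words\<close>

definition wtf :: "'i \<Rightarrow> 'i list \<Rightarrow> complex" where
  "wtf j w = (\<Sum>b\<leftarrow>w. of_real (A j b))"

text \<open>This recursion is forced by the relation that [E a, F j] is \<open>H j\<close> for
  \<open>a = j\<close> and 0 otherwise, once \<open>F j\<close> is to produce functionals vanishing
  at the empty word.\<close>

primrec fop :: "'i \<Rightarrow> 'i list \<Rightarrow> ('i list \<Rightarrow> complex) \<Rightarrow> complex" where
  "fop j [] = (\<lambda>F. 0)"
| "fop j (a # w) = (\<lambda>F. koszul (j \<in> \<Psi>) (a \<in> \<Psi>) *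
      (fop j w (\<lambda>v. F (a # v)) - (if a = j then wtf j w * F w else 0)))"

lemma fop_add: "fop j w (\<lambda>v. F v + G v) = fop j w F + fop j w G"
  by (induction w arbitrary: F G) (auto simp: algebra_simps)

lemma fop_scale: "fop j w (\<lambda>v. c * F v) = c * fop j w F"
  by (induction w arbitrary: F) (auto simp: algebra_simps)

lift_definition E :: "'i \<Rightarrow> 'i list lop" is "\<lambda>i F w. F (i # w)" by simp
lift_definition H :: "'i \<Rightarrow> 'i list lop" is "\<lambda>j F w. wtf j w * F w" by (auto simp: algebra_simps)
lift_definition F :: "'i \<Rightarrow> 'i list lop" is "\<lambda>j F w. fop j w F"
  by (auto simp: fop_add fop_scale)

lemma app_E [simp]: "app (E i) T = (\<lambda>w. T (i # w))"
  and app_H [simp]: "app (H i) T = (\<lambda>w. wtf i w * T w)"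
  and app_F [simp]: "app (F i) T = (\<lambda>w. fop i w T)"
  by (simp_all add: E.rep_eq H.rep_eq F.rep_eq)

lemma HH: "H i * H j = H j * H i"
  by (rule lop_eqI) simp

lemma HE: "H i * E j - E j * H i = sc (of_real (A i j)) (E j)"
  by (rule lop_eqI) (simp add: wtf_def algebra_simps)

lemma EF: "sbr (i \<in> \<Psi>) (j \<in> \<Psi>) (E i) (F j) = (if i = j then H j else 0)"
  by (rule lop_eqI) (auto simp: sbr_def koszul_def)

lemma FE: "sbr (j \<in> \<Psi>) (i \<in> \<Psi>) (F j) (E i) = (if j = i then - sc (koszul (i \<in> \<Psi>) (i \<in> \<Psi>)) (H i) else 0)"
  using EF[of i j] by (subst sbr_skew) auto

lemma HF: "H i * F j - F j * H i = sc (- of_real (A i j)) (F j)"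
proof (rule lop_eqI)
  fix T w
  have "fop j w (\<lambda>v. wtf i v * T v) = (wtf i w - of_real (A i j)) * fop j w T"
  proof (induction w arbitrary: T)
    case (Cons a w)
    have "fop j w (\<lambda>v. wtf i (a # v) * T (a # v))
       = fop j w (\<lambda>v. of_real (A i a) * T (a # v) + wtf i v * T (a # v))"
      by (simp add: wtf_def algebra_simps)
    also have "\<dots> = (wtf i (a # w) - of_real (A i j)) * fop j w (\<lambda>v. T (a # v))"
      unfolding fop_add fop_scale Cons.IH by (simp add: wtf_def algebra_simps)
    finally have eq: "fop j w (\<lambda>v. wtf i (a # v) * T (a # v))
       = (wtf i (a # w) - of_real (A i j)) * fop j w (\<lambda>v. T (a # v))" .
    have "wtf i (a # w) = of_real (A i a) + wtf i w" by (simp add: wtf_def)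
    then show ?case unfolding fop.simps eq by (cases "a = j") (simp_all add: algebra_simps)
  qed simp
  then show "app (H i * F j - F j * H i) T w = app (sc (- of_real (A i j)) (F j)) T w"
    by (simp add: algebra_simps)
qed

abbreviation "par i \<equiv> i \<in> \<Psi>"
abbreviation "theta i j m \<equiv> adn (par i) (E i) (par j) (E j) m"
abbreviation "theta' i j m \<equiv> adn (par i) (F i) (par j) (F j) m"
abbreviation "podd i j m \<equiv> par j \<noteq> (par i \<and> odd m)"

text \<open>The scaling \<open>s\<close> comes from reversing the order in [E i, F i] =
  \<open>H i\<close>, which multiplies the right side by minus a Koszul sign.\<close>

lemma F_theta: "serre i j m \<Longrightarrow> sbr (par k) (podd i j m) (F k) (theta i j m) = 0"
  by (rule serre_commute[where s = "\<lambda>i. - koszul (par i) (par i)"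
        and H = "\<lambda>i. - sc (koszul (par i) (par i)) (H i)"])
    (auto simp: FE HE[unfolded diff_eq_eq] algebra_simps lop.scale_right_distrib)

lemma E_theta': "serre i j m \<Longrightarrow> sbr (par k) (podd i j m) (E k) (theta' i j m) = 0"
  by (rule serre_commute[where s = "\<lambda>i. -1" and H = H])
    (auto simp: EF HF)

text \<open>An operator that kills the vacuum and super commutes with all \<open>e\<^sub>k\<close> is zero.\<close>

lemma theta'_zero:
  assumes "serre i j m"
  shows "theta' i j m = 0"
proof -
  have vac: "app (theta' i j n) T [] = 0" for n T
    by (induction n arbitrary: T) (auto simp: sbr_def)
  have "app (theta' i j m) T w = 0" for T w
  proof (induction w arbitrary: T)
    case (Cons a w)
    have "app (sbr (par a) (podd i j m) (E a) (theta' i j m)) T w = 0"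
      using E_theta'[OF assms] by simp
    then show ?case using Cons by (simp add: sbr_def koszul_def split: if_splits)
  qed (rule vac)
  then show ?thesis by (intro lop_eqI) simp
qed

text \<open>The function required to vanish is v \<mapsto> T(u \<theta> v), so this is the
  annihilator of the two sided ideal generated by the Serre elements in the free associative algebra
  on the e's. The shifts by \<open>u\<close> make stability under \<open>E\<close>
  automatic.\<close>

definition Z :: "('i list \<Rightarrow> complex) set" where
  "Z = {T. \<forall>u i j m. serre i j m \<longrightarrow> app (theta i j m) (\<lambda>v. T (u @ v)) = (\<lambda>_. 0)}"

lemma Z_D: "T \<in> Z \<Longrightarrow> serre i j m \<Longrightarrow> app (theta i j m) T = (\<lambda>_. 0)"
  unfolding Z_def by (drule CollectD, drule spec[of _ "[]"]) auto

lemma Z_diff: "S \<in> Z \<Longrightarrow> T \<in> Z \<Longrightarrow> (\<lambda>w. S w - T w) \<in> Z"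
  unfolding Z_def by (auto simp: app_diff)

lemma Z_scale: "T \<in> Z \<Longrightarrow> (\<lambda>w. c * T w) \<in> Z"
  unfolding Z_def by (auto simp: app_scale)

lemma preserves_E: "preserves Z (E k)"
  unfolding preserves_def Z_def by (auto simp flip: append_Cons)

lemma preserves_H: "preserves Z (H k)"
  unfolding preserves_def Z_def
proof (intro ballI CollectI allI impI)
  fix T u i j m
  assume T: "T \<in> {T. \<forall>u i j m. serre i j m \<longrightarrow> app (theta i j m) (\<lambda>v. T (u @ v)) = (\<lambda>_. 0)}" and S: "serre i j m"
  let ?T = "\<lambda>v. T (u @ v)"
  have 0: "app (theta i j m) ?T = (\<lambda>_. 0)" using T S by simp
  obtain c where "H k * theta i j m - theta i j m * H k = sc c (theta i j m)"
    using adn_weight[OF HE HE] by blast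
  then have "H k * theta i j m = theta i j m * H k + sc c (theta i j m)" by (simp add: algebra_simps)
  then have "app (H k * theta i j m) ?T = app (theta i j m * H k + sc c (theta i j m)) ?T" by simp
  then have 1: "app (theta i j m) (app (H k) ?T) = (\<lambda>_. 0)" using 0 by simp
  have "(\<lambda>v. app (H k) T (u @ v)) = (\<lambda>v. wtf k u * T (u @ v) + app (H k) ?T v)"
    by (simp add: wtf_def algebra_simps)
  then show "app (theta i j m) (\<lambda>v. app (H k) T (u @ v)) = (\<lambda>_. 0)"
    using 0 1 by (simp add: app_plus app_scale)
qed

text \<open>For empty shift \<open>u\<close> the operator \<open>F k\<close> super commutes with the
  Serre element; a first letter of \<open>u\<close> is removed by the recursion of
  \<open>fop\<close>, at the cost of a term with \<open>H k\<close>.\<close>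

lemma preserves_F: "preserves Z (F k)"
proof -
  have "app (theta i j m) (\<lambda>v. app (F k) T (u @ v)) = (\<lambda>_. 0)" if "T \<in> Z" "serre i j m" for u T i j m
    using that(1)
  proof (induction u arbitrary: T)
    case Nil
    have "app (theta i j m) T = (\<lambda>_. 0)"
      using Z_D Nil that(2) .
    moreover have "app (sbr (par k) (podd i j m) (F k) (theta i j m)) T = (\<lambda>_. 0)"
      using F_theta[OF that(2)] by simp
    ultimately have "app (theta i j m) (app (F k) T) = (\<lambda>_. 0)"
      by (simp add: sbr_def app_zero del: app_F)
    then show ?case by simp
  next
    case (Cons a u)
    have eq: "(\<lambda>v. app (F k) T ((a # u) @ v)) = (\<lambda>v. koszul (par k) (par a) *
        (app (F k) (app (E a) T) (u @ v) - (if a = k then app (H k) T (u @ v) else 0)))"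
      by (auto simp: fun_eq_iff)
    have 1: "app (theta i j m) (\<lambda>v. app (F k) (app (E a) T) (u @ v)) = (\<lambda>_. 0)"
      using Cons preserves_E unfolding preserves_def by blast
    have 2: "app (theta i j m) (\<lambda>v. app (H k) T (u @ v)) = (\<lambda>_. 0)"
      using Cons(2) preserves_H that(2) unfolding preserves_def Z_def by blast
    show ?case
      unfolding eq
      by (cases "a = k"; use 1 2 in \<open>simp only: app_scale app_diff app_zero simp_thms if_True if_False diff_self
          mult_zero_right\<close>)
  qed
  then show ?thesis unfolding preserves_def Z_def by blast
qed

section \<open>Evaluation of the defining relations\<close>

primrec rep_gen :: "'i bkm_gen \<Rightarrow> 'i list lop" where
  "rep_gen (Egen i) = E i" | "rep_gen (Fgen i) = F i" | "rep_gen (Hgen i) = H i"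

abbreviation "evb \<equiv> ev rep_gen (bkm_odd \<Psi>) False"

lemma preserves_rep: "preserves Z (rep_gen g)"
  by (cases g) (auto simp: preserves_E preserves_F preserves_H)

lemma evb_gen [simp]: "evb (gen g) = rep_gen g"
  by (simp add: ev_mon)

lemma ad_power_ev:
  assumes "homog (bkm_odd \<Psi>) pe p" "homog (bkm_odd \<Psi>) py q"
  shows "homog (bkm_odd \<Psi>) (py \<noteq> (pe \<and> odd m)) ((br p ^^ m) q) \<and>
     evb ((br p ^^ m) q) = adn pe (evb p) py (evb q) m"
proof (induction m)
  case (Suc m)
  let ?p = "py \<noteq> (pe \<and> odd m)"
  have p: "(py \<noteq> (pe \<and> odd (Suc m))) \<longleftrightarrow> (pe \<noteq> ?p)" by auto
  have h: "homog (bkm_odd \<Psi>) ?p ((br p ^^ m) q)" using Suc by blast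
  show ?case
    unfolding p using homog_br[OF assms(1) h] ev_br[OF assms(1) h, of rep_gen] Suc by simp
qed (use assms in auto)

lemma kills_theta: "serre i j m \<Longrightarrow> kills Z (theta i j m)"
  unfolding kills_def using Z_D by blast

lemma homog_bkm_gen: "homog (bkm_odd \<Psi>) (bkm_odd \<Psi> g) (gen g)"
  by (rule homog_gen)

lemmas homog_EFH = homog_bkm_gen[of "Egen _", simplified] homog_bkm_gen[of "Fgen _", simplified]
  homog_bkm_gen[of "Hgen _", simplified]

lemma kills_theta_Suc: "serre i j m \<Longrightarrow> kills Z (theta i j (Suc m))"
  using kills_theta preserves_E by (simp add: kills_sbr)

lemma theta'_Suc_zero: "serre i j m \<Longrightarrow> theta' i j (Suc m) = 0"
  by (simp add: theta'_zero)

lemma kills_relations: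
  assumes "r \<in> bkm_relations A \<Psi>"
  shows "(\<exists>b. homog (bkm_odd \<Psi>) b r) \<and> kills Z (evb r)"
proof -
  note ebr = ev_br[OF homog_EFH(1) homog_EFH(1)] ev_br[OF homog_EFH(1) homog_EFH(2)]
    ev_br[OF homog_EFH(2) homog_EFH(2)] ev_br[OF homog_EFH(3) homog_EFH(3)]
    ev_br[OF homog_EFH(3) homog_EFH(1)] ev_br[OF homog_EFH(3) homog_EFH(2)]
  \<comment> \<open>If m = 1 - a/2 then 2m = (1 - a) + 1, so the relation with ad [e,e] is a
    multiple of a Serre element bracketed with e once more.\<close>
  have dbl: "serre i j (2 * m - 1) \<and> 2 * m = Suc (2 * m - 1)" if "i \<in> Psi_re A \<Psi>" "i \<noteq> j" "real m = 1 - A i j / 2" for i j m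
  proof -
    have "A i j \<le> 0" using bkm that(2) unfolding bkm_supermatrix_def by blast
    then have "0 < m" using that(3) by (intro Nat.gr0I) auto
    then have "real (2 * m - 1) = 1 - A i j" "2 * m = Suc (2 * m - 1)" using that(3) by (auto simp: of_nat_diff)
    then show ?thesis using that unfolding serre_def Psi_re_def by simp
  qed
  have serre: "\<And>i j m. i \<in> I_re A \<Longrightarrow> i \<noteq> j \<Longrightarrow> real m = 1 - A i j \<Longrightarrow> serre i j m"
    "\<And>i j. A i j = 0 \<Longrightarrow> serre i j 1" "\<And>i. i \<in> Psi_0 A \<Psi> \<Longrightarrow> serre i i 1"
    unfolding serre_def Psi_0_def by auto
  have sq: "homog (bkm_odd \<Psi>) False (br (gen g) (gen g))" for g
    using homog_br[OF homog_bkm_gen homog_bkm_gen, of g g] by simp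
  from assms consider
    (hh) i j where "r = br (gen (Hgen i)) (gen (Hgen j))"
  | (he) i j where "r = br (gen (Hgen i)) (gen (Egen j)) - scl (of_real (A i j)) (gen (Egen j))"
  | (hf) i j where "r = br (gen (Hgen i)) (gen (Fgen j)) + scl (of_real (A i j)) (gen (Fgen j))"
  | (ef) i j where "r = br (gen (Egen i)) (gen (Fgen j)) - (if i = j then gen (Hgen i) else 0)"
  | (e1) i j m where "r = (br (gen (Egen i)) ^^ m) (gen (Egen j))" "serre i j m"
  | (f1) i j m where "r = (br (gen (Fgen i)) ^^ m) (gen (Fgen j))" "serre i j m"
  | (e2) i j m where "r = (br (br (gen (Egen i)) (gen (Egen i))) ^^ m) (gen (Egen j))"
      "i \<in> Psi_re A \<Psi>" "i \<noteq> j" "real m = 1 - A i j / 2"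
  | (f2) i j m where "r = (br (br (gen (Fgen i)) (gen (Fgen i))) ^^ m) (gen (Fgen j))"
      "i \<in> Psi_re A \<Psi>" "i \<noteq> j" "real m = 1 - A i j / 2"
  | (e3) i j where "r = br (gen (Egen i)) (gen (Egen j))" "serre i j 1"
  | (f3) i j where "r = br (gen (Fgen i)) (gen (Fgen j))" "serre i j 1"
    unfolding bkm_relations_def Let_def Un_iff mem_Collect_eq
    apply (elim disjE exE conjE)
    subgoal by (erule that(1))
    subgoal by (erule that(2))
    subgoal by (erule that(3))
    subgoal by (erule that(4))
    subgoal by (erule that(5)) (rule serre)
    subgoal by (erule that(6)) (rule serre)
    subgoal by (erule that(7))
    subgoal by (erule that(8))
    subgoal by (erule that(9)) (rule serre)
    subgoal by (erule that(10)) (rule serre)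
    subgoal by (erule that(9)) (rule serre)
    subgoal by (erule that(10)) (rule serre)
    done
  then show ?thesis
  proof cases
    case hh
    have "homog (bkm_odd \<Psi>) False r" unfolding hh by (auto intro: homog_br[where a = False and b = False, simplified] homog_EFH)
    then show ?thesis using HH[of i j] unfolding hh by (auto simp: ebr sbr_def kills_simps)
  next
    case he
    have "homog (bkm_odd \<Psi>) (par j) r" unfolding he
      using homog_br[OF homog_EFH(3) homog_EFH(1)] by (auto intro!: homog_diff homog_scl homog_EFH)
    then show ?thesis using HE[of i j] unfolding he
      by (auto simp: ebr sbr_def kills_simps ev_diff ev_scl)
  next
    case hf
    have "homog (bkm_odd \<Psi>) (par j) r" unfolding hf
      using homog_br[OF homog_EFH(3) homog_EFH(2)] by (auto intro!: homog_add homog_scl homog_EFH)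
    then show ?thesis using HF[of i j] unfolding hf
      by (auto simp: ebr sbr_def kills_simps ev_add ev_scl)
  next
    case ef
    have "homog (bkm_odd \<Psi>) (par i \<noteq> par j) r" unfolding ef
      using homog_br[OF homog_EFH(1) homog_EFH(2), of i j]
      by (auto intro!: homog_diff simp: homog_0 homog_EFH)
    then show ?thesis using EF[of i j] unfolding ef
      by (auto simp: ebr kills_simps ev_diff)
  next
    case e1
    then show ?thesis using ad_power_ev[OF homog_EFH(1)[of i] homog_EFH(1)[of j], of m] kills_theta by auto
  next
    case f1
    then show ?thesis using ad_power_ev[OF homog_EFH(2)[of i] homog_EFH(2)[of j], of m] theta'_zero
      by (auto simp: kills_simps)
  next
    case e2
    then have i: "par i" unfolding Psi_re_def by simp
    have "evb r = sc (2 ^ m) (theta i j (Suc (2 * m - 1)))"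
      using ad_power_ev[OF sq[of "Egen i"] homog_EFH(1)[of j], of m] dbl[OF e2(2-4)] i
      by (simp add: e2(1) ebr adn_square)
    then show ?thesis
      using kills_theta_Suc[of i j "2 * m - 1"] dbl[OF e2(2-4)] ad_power_ev[OF sq[of "Egen i"] homog_EFH(1)[of j], of m]
      unfolding e2(1) by (metis kills_simps(4))
  next
    case f2
    then have i: "par i" unfolding Psi_re_def by simp
    have "evb r = sc (2 ^ m) (theta' i j (Suc (2 * m - 1)))"
      using ad_power_ev[OF sq[of "Fgen i"] homog_EFH(2)[of j], of m] dbl[OF f2(2-4)] i
      by (simp add: f2(1) ebr adn_square)
    also have "\<dots> = 0" by (simp only: theta'_Suc_zero[OF dbl[OF f2(2-4), THEN conjunct1]] lop.scale_zero_right)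
    finally show ?thesis
      using ad_power_ev[OF sq[of "Fgen i"] homog_EFH(2)[of j], of m] kills_simps(1)
      unfolding f2(1) by metis
  next
    case e3
    then show ?thesis using ad_power_ev[OF homog_EFH(1)[of i] homog_EFH(1)[of j], of 1] kills_theta[of i j 1] by auto
  next
    case f3
    then show ?thesis using ad_power_ev[OF homog_EFH(2)[of i] homog_EFH(2)[of j], of 1] theta'_zero[of i j 1]
      by (auto simp: kills_simps)
  qed
qed

theorem kills_bkm_ideal:
  "p \<in> two_sided_ideal UNIV (lie_axioms UNIV (bkm_odd \<Psi>) \<union> bkm_relations A \<Psi>) \<Longrightarrow> kills Z (evb p)"
  by (rule kills_ideal[OF Z_diff Z_scale preserves_rep kills_relations])

text \<open>Functionals on words whose support avoids repeated real letters only see the commutation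
  relations.\<close>

lemma mem_ZI:
  assumes supp: "\<And>w j. T w \<noteq> 0 \<Longrightarrow> j \<in> I_re A \<union> Psi_0 A \<Psi> \<Longrightarrow> count_list w j \<le> 1"
    and swap: "\<And>u v a b. a \<noteq> b \<Longrightarrow> A a b = 0 \<Longrightarrow> T (u @ a # b # v) = koszul (par a) (par b) * T (u @ b # a # v)"
  shows "T \<in> Z"
  unfolding Z_def
proof (intro CollectI allI impI)
  fix u i j m assume S: "serre i j m"
  let ?T = "\<lambda>v. T (u @ v)"
  show "app (theta i j m) ?T = (\<lambda>_. 0)"
  proof (cases "A i j = 0 \<and> m = 1")
    case True
    have "T (u @ i # j # w) - koszul (par i) (par j) * T (u @ j # i # w) = 0" for w
    proof (cases "i = j")
      case i: True
      show ?thesis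
      proof (cases "par i")
        case par: True
        then have "i \<in> Psi_0 A \<Psi>" using True i unfolding Psi_0_def by simp
        moreover have "\<not> count_list (u @ i # i # w) i \<le> 1" by simp
        ultimately have "T (u @ i # i # w) = 0" using supp by blast
        then show ?thesis using i by simp
      qed (use i in simp)
    qed (use swap True in simp)
    then show ?thesis using True by (simp add: sbr_def)
  next
    case False
    then have re: "i \<in> I_re A" "i \<noteq> j" "real m = 1 - A i j" using S unfolding serre_def by auto
    have "A i j \<in> \<int>" "A i j \<le> 0" using bkm re unfolding bkm_supermatrix_def I_re_def by blast+
    moreover have "A i j \<noteq> 0" using False re by auto
    ultimately have "A i j \<le> -1" using Ints_eq_abs_less1[of "A i j" 0] by force
    then have m: "2 \<le> m" using re(3) by linarith
    \<comment> \<open>\<open>D n\<close> treats \<open>n\<close> letters \<open>i\<close> as already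
      used up, out of the one that is allowed. Every ad \<open>E i\<close> uses one more, so after m
      >= 2 steps no word remains in the support.\<close>
    define D where "D n = {T. \<forall>w. T w \<noteq> (0::complex) \<longrightarrow> count_list w i + n \<le> 1}" for n
    have "app (theta i j n) S \<in> D (l + n)" if "S \<in> D l" for n l S
      using that
    proof (induction n arbitrary: S l)
      case 0
      then show ?case using re(2) unfolding D_def by force
    next
      case (Suc n)
      have 1: "app (E i) S \<in> D (Suc l)" if "S \<in> D l" for S l
        using that unfolding D_def by force
      have "app (theta i j n) (app (E i) S) \<in> D (l + Suc n)"
        using Suc.IH[OF 1[OF Suc.prems]] by simp
      moreover have "app (E i) (app (theta i j n) S) \<in> D (l + Suc n)"
        using 1[OF Suc.IH[OF Suc.prems]] by simp
      moreover have "(\<lambda>w. P w - c * Q w) \<in> D k" if "P \<in> D k" "Q \<in> D k" for P Q c k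
      proof -
        have "P w \<noteq> 0 \<or> Q w \<noteq> 0" if "P w - c * Q w \<noteq> 0" for w using that by auto
        then show ?thesis using that unfolding D_def by blast
      qed
      ultimately show ?case by (simp add: sbr_def)
    qed
    moreover have "?T \<in> D 0" using supp re(1) unfolding D_def by force
    ultimately have "app (theta i j m) ?T \<in> D m" by (metis add_0)
    then show ?thesis using m unfolding D_def by force
  qed
qed

end

section \<open>Traces\<close>

lemma trace_eq_iff: "trace G v = trace G w \<longleftrightarrow> v \<in> trace G w"
proof
  assume "v \<in> trace G w"
  then have vw: "equivclp (swap1 G) w v" unfolding trace_def by simp
  show "trace G v = trace G w"
  proof (rule Set.set_eqI)
    show "u \<in> trace G v \<longleftrightarrow> u \<in> trace G w" for u
      unfolding trace_def mem_Collect_eq using vw equivclp_sym equivclp_trans by metis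
  qed
next
  assume "trace G v = trace G w"
  moreover have "v \<in> trace G v" unfolding trace_def by simp
  ultimately show "v \<in> trace G w" by simp
qed

lemma trace_self [simp]: "w \<in> trace G w"
  unfolding trace_def by simp

lemma trace_in_traces [simp]: "trace G w \<in> traces G"
  unfolding traces_def by simp

lemma traces_eq_trace: "w \<in> traces G \<Longrightarrow> v \<in> w \<Longrightarrow> w = trace G v"
  unfolding traces_def using trace_eq_iff by blast

text \<open>Symmetry of \<open>G\<close> is not assumed here and a swap may be run in either
  direction; hence the disjunction.\<close>

lemma trace_induct [consumes 1, case_names refl swap]:
  assumes "v \<in> trace G w" "P w"
    and "\<And>x a b y. x @ a # b # y \<in> trace G w \<Longrightarrow> P (x @ a # b # y) \<Longrightarrow> \<not> G a b \<or> \<not> G b a \<Longrightarrow> P (x @ b # a # y)"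
  shows "P v"
proof -
  have "equivclp (swap1 G) w v" using assms(1) unfolding trace_def by simp
  then show ?thesis
  proof (induction rule: equivclp_induct)
    case base
    then show ?case by (rule assms(2))
  next
    case (step y z)
    then have "y \<in> trace G w" unfolding trace_def by simp
    then show ?case using step assms(3) unfolding swap1_def by fastforce
  qed
qed

lemma trace_swap: "\<not> G a b \<Longrightarrow> trace G (x @ a # b # y) = trace G (x @ b # a # y)"
proof -
  assume "\<not> G a b"
  then have "swap1 G (x @ a # b # y) (x @ b # a # y)"
    unfolding swap1_def by (intro exI[of _ x] exI[of _ y] exI[of _ a] exI[of _ b]) simp
  then have "x @ a # b # y \<in> trace G (x @ b # a # y)"
    unfolding trace_def by (simp add: converse_r_into_equivclp)
  then show ?thesis by (simp add: trace_eq_iff)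
qed

lemma trace_mset: "v \<in> trace G w \<Longrightarrow> mset v = mset w"
  by (induction rule: trace_induct) (auto simp: add_mset_commute)

lemma trace_append:
  assumes "trace G v = trace G v'" "trace G w = trace G w'"
  shows "trace G (v @ w) = trace G (v' @ w')"
proof -
  have 1: "trace G (u @ v) = trace G (u @ w)" if "v \<in> trace G w" for u v w
    using that
  proof (induction rule: trace_induct)
    case (swap x a b y)
    then show ?case using trace_swap[of G a b "u @ x" y] trace_swap[of G b a "u @ x" y] by auto
  qed simp
  have 2: "trace G (v @ u) = trace G (w @ u)" if "v \<in> trace G w" for u v w
    using that
  proof (induction rule: trace_induct)
    case (swap x a b y)
    then show ?case using trace_swap[of G a b x "y @ u"] trace_swap[of G b a x "y @ u"] by auto
  qed simp
  show ?thesis using 1[of w w' v] 2[of v v' w'] assms by (metis trace_eq_iff)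
qed

section \<open>Standard representatives and the order on traces\<close>

lemma lexord_trans_less: "(u, v) \<in> lexord {(a, b). a < b} \<Longrightarrow> (v, w) \<in> lexord {(a, b). a < b}
    \<Longrightarrow> (u, w) \<in> lexord {(a, b). a < (b :: 'i::linorder)}"
  by (rule lexord_trans) (auto intro: transI)

lemma lexord_irrefl_less: "(u, u) \<notin> lexord {(a, b). a < (b :: 'i::linorder)}"
  by (rule lexord_irreflexive) auto

lemma lexord_total_less: "u \<noteq> v \<Longrightarrow> (u, v) \<in> lexord {(a, b). a < b} \<or> (v, u) \<in> lexord {(a, b). a < (b :: 'i::linorder)}"
proof -
  assume "u \<noteq> v"
  have "\<forall>a b. (a, b) \<in> {(a, b). a < (b :: 'i)} \<or> a = b \<or> (b, a) \<in> {(a, b). a < b}"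
    using linorder_less_linear by blast
  from lexord_linear[OF this, of u v] \<open>u \<noteq> v\<close> show ?thesis by simp
qed

lemma finite_ex_lex_max:
  fixes W :: "'i::linorder list set"
  assumes "finite W" "W \<noteq> {}"
  shows "\<exists>m\<in>W. \<forall>u\<in>W. u \<noteq> m \<longrightarrow> (u, m) \<in> lexord {(a, b). a < b}"
  using assms
proof (induction rule: finite_ne_induct)
  case (insert x W)
  then obtain m where m: "m \<in> W" "\<forall>u\<in>W. u \<noteq> m \<longrightarrow> (u, m) \<in> lexord {(a, b). a < b}" by blast
  show ?case
  proof (cases "(x, m) \<in> lexord {(a, b). a < b}")
    case True
    then show ?thesis using m by blast
  next
    case False
    then have "(m, x) \<in> lexord {(a, b). a < b}" using lexord_total_less m insert.hyps(3) by metis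
    then have "\<forall>u\<in>W. (u, x) \<in> lexord {(a, b). a < b}" using m lexord_trans_less by metis
    then show ?thesis by blast
  qed
qed simp

text \<open>All words of a trace have the same multiset of letters, so a trace is finite and its
  lexicographic maximum exists; this gives meaning to the definite description in
  \<open>std\<close>.\<close>

lemma std_mem:
  assumes "w \<in> traces G"
  shows "std w \<in> w"
proof -
  obtain v where v: "w = trace G v" using assms unfolding traces_def by auto
  have "w \<subseteq> {u. mset u = mset v}" using trace_mset v by blast
  moreover have "finite {u. mset u = mset v}"
    by (rule finite_subset[OF _ finite_lists_length_le[of "set v" "length v"]])
      (auto dest: mset_eq_setD mset_eq_length)
  ultimately have "finite w" by (rule finite_subset)
  moreover have "w \<noteq> {}" using v trace_self by blast
  ultimately obtain m where m: "m \<in> w" "\<forall>u\<in>w. u \<noteq> m \<longrightarrow> (u, m) \<in> lexord {(a, b). a < b}"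
    using finite_ex_lex_max by blast
  have "std w = m"
    unfolding std_def
  proof (rule the_equality)
    fix n assume n: "n \<in> w \<and> (\<forall>u\<in>w. u \<noteq> n \<longrightarrow> (u, n) \<in> lexord {(a, b). a < b})"
    show "n = m"
    proof (rule ccontr)
      assume "n \<noteq> m"
      then have "(n, m) \<in> lexord {(a, b). a < b}" "(m, n) \<in> lexord {(a, b). a < b}"
        using m n by auto
      then show False using lexord_trans_less lexord_irrefl_less by metis
    qed
  qed (use m in blast)
  then show ?thesis using m by simp
qed

lemma alphabet_traces: "X \<subseteq> traces G \<Longrightarrow> alphabet trace_less X"
proof
  show "trans trace_less" unfolding trace_less_def
    by (rule transI) (use lexord_trans_less in auto)
  show "irrefl trace_less" unfolding trace_less_def irrefl_def using lexord_irrefl_less by auto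
  assume X: "X \<subseteq> traces G"
  have "std v \<noteq> std w" if "v \<in> X" "w \<in> X" "v \<noteq> w" for v w
    using that X std_mem traces_eq_trace by (metis subsetD)
  then show "total_on X trace_less"
    unfolding trace_less_def total_on_def using lexord_total_less by blast
qed

section \<open>Weight and parity read off from any representative\<close>

definition wtl :: "'i list \<Rightarrow> ('i \<Rightarrow>\<^sub>0 int)" where
  "wtl w = (\<Sum>j\<leftarrow>w. Poly_Mapping.single j 1)"

lemma lookup_wtl: "Poly_Mapping.lookup (wtl w) j = int (count_list w j)"
  unfolding wtl_def by (induction w) (auto simp: lookup_add lookup_single when_def)

lemma count_list_mset: "count_list w j = count (mset w) j"
  by (induction w) auto

lemma wtl_mset: "mset v = mset w \<Longrightarrow> wtl v = wtl w"
  by (rule poly_mapping_eqI) (simp add: lookup_wtl count_list_mset)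

lemma wtl_concat: "wtl (concat ws) = (\<Sum>w\<leftarrow>ws. wtl w)"
  by (induction ws) (auto simp: wtl_def)

lemma occ_trace: "w \<in> traces G \<Longrightarrow> v \<in> w \<Longrightarrow> occ j w = count_list v j"
  unfolding occ_def count_list_mset using std_mem traces_eq_trace trace_mset by metis

lemma wt_trace:
  assumes "w \<in> traces G" "v \<in> w"
  shows "wt w = wtl v"
proof (rule poly_mapping_eqI)
  fix j
  have m: "mset (std w) = mset v" using std_mem traces_eq_trace trace_mset assms by metis
  have "Poly_Mapping.lookup (wt w) j
      = (\<Sum>l\<in>set (std w). if l = j then int (count_list v j) else 0)"
    unfolding wt_def lookup_sum by (intro sum.cong) (auto simp: lookup_single when_def occ_trace[OF assms])
  also have "\<dots> = int (count_list v j)"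
    using mset_eq_setD[OF m] by (simp add: sum.delta count_list_0_iff)
  finally show "Poly_Mapping.lookup (wt w) j = Poly_Mapping.lookup (wtl v) j" by (simp add: lookup_wtl)
qed

lemma sum_count_filter: "finite S \<Longrightarrow> set w \<subseteq> S \<Longrightarrow> (\<Sum>j\<in>S \<inter> \<Psi>. count_list w j) = length (filter (\<lambda>j. j \<in> \<Psi>) w)"
proof (induction w)
  case (Cons a w)
  have "(\<Sum>j\<in>S \<inter> \<Psi>. count_list (a # w) j)
      = (\<Sum>j\<in>S \<inter> \<Psi>. count_list w j + (if j = a then 1 else 0))"
    by (intro sum.cong) auto
  also have "\<dots> = length (filter (\<lambda>j. j \<in> \<Psi>) w) + (if a \<in> \<Psi> then 1 else 0)"
    using Cons by (simp add: sum.distrib sum.delta)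
  finally show ?case by simp
qed simp

lemma trace_odd_trace:
  assumes "w \<in> traces G" "v \<in> w"
  shows "trace_odd \<Psi> w \<longleftrightarrow> word_odd (\<lambda>j. j \<in> \<Psi>) v"
proof -
  have m: "mset (std w) = mset v" using std_mem traces_eq_trace trace_mset assms by metis
  have "(\<Sum>j\<in>set (std w) \<inter> \<Psi>. occ j w) = length (filter (\<lambda>j. j \<in> \<Psi>) (std w))"
    unfolding occ_def by (rule sum_count_filter) auto
  also have "\<dots> = length (filter (\<lambda>j. j \<in> \<Psi>) v)"
    using m by (metis mset_filter size_mset)
  finally show ?thesis unfolding trace_odd_def word_odd_def by simp
qed

section \<open>The part of a trace above its last letter \<open>i\<close>\<close>

definition dep :: "('i \<Rightarrow> 'i \<Rightarrow> bool) \<Rightarrow> 'i set \<Rightarrow> 'i \<Rightarrow> bool" where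
  "dep G D b \<longleftrightarrow> b \<in> D \<or> (\<exists>d\<in>D. G d b)"

text \<open>In the heap of a trace, \<^term>\<open>sel G D s\<close> consists of the letters of \<open>s\<close> above some letter of \<open>D\<close>.\<close>

primrec sel :: "('i \<Rightarrow> 'i \<Rightarrow> bool) \<Rightarrow> 'i set \<Rightarrow> 'i list \<Rightarrow> 'i list" where
  "sel G D [] = []"
| "sel G D (b # s) = (if dep G D b then b # sel G (insert b D) s else sel G D s)"

primrec unsel :: "('i \<Rightarrow> 'i \<Rightarrow> bool) \<Rightarrow> 'i set \<Rightarrow> 'i list \<Rightarrow> 'i list" where
  "unsel G D [] = []"
| "unsel G D (b # s) = (if dep G D b then unsel G (insert b D) s else b # unsel G D s)"

lemma length_sel: "length (sel G D s) + length (unsel G D s) = length s"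
  by (induction s arbitrary: D) auto

lemma sel_full: "length s \<le> length (sel G D s) \<Longrightarrow> sel G D s = s \<and> unsel G D s = []"
proof (induction s arbitrary: D)
  case (Cons b s)
  then show ?case using length_sel[of G D s] by (auto split: if_splits)
qed simp

lemma set_unsel: "set (unsel G D s) \<subseteq> set s"
  by (induction s arbitrary: D) auto

lemma sel_append_one:
  "sel G D s = s \<Longrightarrow> sel G D (s @ [a]) = (if dep G (D \<union> set s) a then s @ [a] else s)"
proof (induction s arbitrary: D)
  case (Cons b s)
  have "dep G D b"
  proof (rule ccontr)
    assume "\<not> dep G D b"
    then have "length (sel G D s) = length (b # s)" using Cons.prems by simp
    then show False using length_sel[of G D s] by simp
  qed
  then show ?case using Cons by simp
qed simp

text \<open>Adding one of two distinct nonadjacent letters to \<open>D\<close> does not affect the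
  selection of the other, so each of the two parts undergoes at most the same swap.\<close>

lemma sel_swap:
  assumes "\<not> G a b" "\<not> G b a"
  shows "trace G (sel G D (x @ a # b # y)) = trace G (sel G D (x @ b # a # y)) \<and>
    trace G (unsel G D (x @ a # b # y)) = trace G (unsel G D (x @ b # a # y))"
proof (induction x arbitrary: D)
  case Nil
  show ?case
  proof (cases "a = b")
    case False
    then have "dep G (insert a D) b = dep G D b" "dep G (insert b D) a = dep G D a"
      using assms unfolding dep_def by auto
    then show ?thesis
      using trace_swap[of G a b, OF assms(1), of "[]"] by (auto simp: insert_commute)
  qed simp
next
  case (Cons c x)
  then show ?case
    using trace_append[of G "[c]" "[c]" "sel G (insert c D) (x @ a # b # y)" "sel G (insert c D) (x @ b # a # y)"]
      trace_append[of G "[c]" "[c]" "unsel G D (x @ a # b # y)" "unsel G D (x @ b # a # y)"] by auto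
qed

locale commutation_graph =
  fixes G :: "'i::linorder \<Rightarrow> 'i \<Rightarrow> bool" and i :: 'i
  assumes sym_G: "G a b \<Longrightarrow> G b a"
begin

abbreviation "tr \<equiv> trace G"
abbreviation "up \<equiv> sel G {i}"
abbreviation "down \<equiv> unsel G {i}"

lemma not_G_sym: "\<not> G a b \<Longrightarrow> \<not> G b a"
  using sym_G by blast

text \<open>The delicate swaps involve the last \<open>i\<close> itself: the other letter is
  nonadjacent to \<open>i\<close> and moves between \<open>p\<close> and \<open>s\<close>, but in
  \<open>s\<close> it belongs to \<open>down\<close>, so the left part does not notice.\<close>

lemma last_factor_swap:
  assumes w: "x @ a # b # y = p @ i # s" "i \<notin> set s" and ab: "\<not> G a b"
  shows "\<exists>p' s'. x @ b # a # y = p' @ i # s' \<and> i \<notin> set s' \<and>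
    tr (i # up s') = tr (i # up s) \<and> tr (p' @ down s') = tr (p @ down s)"
proof (cases "a = b")
  case True
  then show ?thesis using w by auto
next
  case False
  from w(1) consider (left) t where "p = x @ a # b # t" "y = t @ i # s"
    | (b) "p = x @ [a]" "b = i" "y = s" | (a) "p = x" "a = i" "s = b # y"
    | (right) t where "x = p @ i # t" "s = t @ a # b # y"
    by (auto simp: append_eq_append_conv2 append_eq_Cons_conv Cons_eq_append_conv)
  then show ?thesis
  proof cases
    case left
    have "tr ((x @ b # a # t) @ down s) = tr (p @ down s)"
      using trace_swap[of G a b, OF ab, of x "t @ down s"] left by simp
    then show ?thesis using left w(2) by (intro exI[of _ "x @ b # a # t"] exI[of _ s]) simp
  next
    case b
    have "\<not> dep G {i} a" using b False not_G_sym[OF ab] unfolding dep_def by auto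
    then show ?thesis using b w(2) False by (intro exI[of _ x] exI[of _ "a # s"]) simp
  next
    case a
    have "\<not> dep G {i} b" using a False ab unfolding dep_def by auto
    then show ?thesis using a w(2) False by (intro exI[of _ "p @ [b]"] exI[of _ y]) simp
  next
    case right
    note S = sel_swap[of G a b, OF ab not_G_sym[OF ab], of "{i}" t y]
    show ?thesis
      using right w(2) S trace_append[of G "[i]" "[i]" "up (t @ b # a # y)" "up s"]
        trace_append[of G p p "down (t @ b # a # y)" "down s"]
      by (intro exI[of _ p] exI[of _ "t @ b # a # y"]) auto
  qed
qed

lemma last_factor_unique:
  "p @ i # s = p' @ i # s' \<Longrightarrow> i \<notin> set s \<Longrightarrow> i \<notin> set s' \<Longrightarrow> p = p' \<and> s = s'"
  by (auto simp: append_eq_append_conv2 append_eq_Cons_conv Cons_eq_append_conv)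

text \<open>Both the factor above the last \<open>i\<close> and the complementary trace are
  invariants of the trace. This is what allows factors over \<open>X_alph G i\<close> to be stripped
  off from the right.\<close>

lemma last_factor:
  assumes "tr (p' @ i # s') = tr (p @ i # s)" "i \<notin> set s" "i \<notin> set s'"
  shows "tr (i # up s') = tr (i # up s)" "tr (p' @ down s') = tr (p @ down s)"
proof -
  have "\<exists>p' s'. v = p' @ i # s' \<and> i \<notin> set s' \<and>
    tr (i # up s') = tr (i # up s) \<and> tr (p' @ down s') = tr (p @ down s)" if "v \<in> tr (p @ i # s)" for v
    using that
  proof (induction rule: trace_induct)
    case refl
    then show ?case using assms(2) by blast
  next
    case (swap x a b y)
    then obtain q t where qt: "x @ a # b # y = q @ i # t" "i \<notin> set t"
      "tr (i # up t) = tr (i # up s)" "tr (q @ down t) = tr (p @ down s)" by blast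
    have "\<not> G a b" using swap sym_G by blast
    from last_factor_swap[OF qt(1,2) this] show ?case using qt(3,4) by simp
  qed
  from this[of "p' @ i # s'"] assms(1) obtain p'' s'' where
    "p' @ i # s' = p'' @ i # s''" "i \<notin> set s''"
    "tr (i # up s'') = tr (i # up s)" "tr (p'' @ down s'') = tr (p @ down s)"
    by (metis trace_self)
  then show "tr (i # up s') = tr (i # up s)" "tr (p' @ down s') = tr (p @ down s)"
    using last_factor_unique assms(3) by metis+
qed

text \<open>By counting letters: the part above the last \<open>i\<close> is an invariant and
  already has full length, so nothing can stand to the left of that \<open>i\<close>.\<close>

lemma pyramid_representative:
  assumes "v \<in> tr (i # s)" "i \<notin> set s" "up s = s"
  obtains s' where "v = i # s'" "i \<notin> set s'" "up s' = s'"
proof -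
  have m: "mset v = mset (i # s)" using trace_mset assms(1) .
  then have "i \<in> set v" using mset_eq_setD by fastforce
  then obtain p s' where v: "v = p @ i # s'" "i \<notin> set s'" using split_list_last by metis
  have "tr (p @ i # s') = tr ([] @ i # s)" using assms(1) v by (simp add: trace_eq_iff)
  from last_factor(1)[OF this assms(2) v(2)] assms(3) have "tr (i # up s') = tr (i # s)" by simp
  then have "mset (i # up s') = mset (i # s)" using trace_mset trace_self by metis
  then have "length (up s') = length s" using mset_eq_length by fastforce
  moreover have "length v = length (i # s)" using m mset_eq_length by blast
  ultimately have "p = []" "up s' = s'" using v length_sel[of G "{i}" s'] sel_full[of s' G "{i}"] by auto
  then show ?thesis using that v by simp
qed

lemma trace_move: "\<forall>d\<in>set x. \<not> G d b \<Longrightarrow> tr (x @ [b]) = tr (b # x)"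
proof (induction x)
  case (Cons c x)
  then have "tr ([c] @ (x @ [b])) = tr ([c] @ (b # x))" by (intro trace_append) auto
  also have "\<dots> = tr (b # c # x)" using trace_swap[of G c b "[]" x] Cons by simp
  finally show ?case by simp
qed simp

text \<open>Letters of \<open>s\<close> that are not above \<open>x\<close> commute with everything
  they have to pass on their way to the front.\<close>

lemma trace_unsel_first: "tr (x @ s) = tr (unsel G (set x) s @ x @ sel G (set x) s)"
proof (induction s arbitrary: x)
  case (Cons b s)
  show ?case
  proof (cases "dep G (set x) b")
    case True
    then show ?thesis using Cons[of "x @ [b]"] by simp
  next
    case False
    then have "tr (x @ [b]) = tr (b # x)" unfolding dep_def by (intro trace_move) auto
    then have "tr ((x @ [b]) @ s) = tr ((b # x) @ s)" by (intro trace_append) auto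
    also have "\<dots> = tr ([b] @ (unsel G (set x) s @ x @ sel G (set x) s))"
      using trace_append[of G "[b]" "[b]", OF refl Cons[of x]] by simp
    finally show ?thesis using False by simp
  qed
qed simp

text \<open>The exponent of an initial power is bounded by the length of the words, so the greatest
  one exists and is attained.\<close>

lemma init_mult_le:
  assumes "w \<in> traces G" "w = tr (replicate m j @ u)"
  shows "m \<le> init_mult G w j" "\<And>n. n = init_mult G w j \<Longrightarrow> \<exists>u. w = tr (replicate n j @ u)"
proof -
  have b: "n \<le> length (std w)" if "\<exists>u. w = tr (replicate n j @ u)" for n
  proof -
    from that obtain u where "w = tr (replicate n j @ u)" by blast
    then have "mset (std w) = mset (replicate n j @ u)"
      using std_mem[OF assms(1)] trace_mset by blast
    from mset_eq_length[OF this] show ?thesis by simp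
  qed
  show "m \<le> init_mult G w j"
    unfolding init_mult_def by (rule Greatest_le_nat[where b = "length (std w)"]) (use assms(2) b in auto)
  show "\<exists>u. w = tr (replicate n j @ u)" if "n = init_mult G w j" for n
    unfolding that init_mult_def
    by (rule GreatestI_nat[where b = "length (std w)" and k = m]) (use assms(2) b in auto)
qed

text \<open>A letter of \<open>s\<close> not above \<open>i\<close> could be moved to the front and
  would be a second initial letter.\<close>

lemma X_alph_D:
  assumes "w \<in> X_alph G i" "v \<in> w"
  obtains s where "v = i # s" "i \<notin> set s" "up s = s"
proof -
  have w: "w \<in> traces G" "IA_m G w = {#i#}" "occ i w = 1" using assms(1) unfolding X_alph_def by auto
  have first: "j = i" if "j # u \<in> w" for j u
  proof -
    have "w = tr (replicate 1 j @ u)" using traces_eq_trace[OF w(1) that] by simp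
    then have "1 \<le> init_mult G w j" using init_mult_le(1) w(1) by blast
    moreover have "j \<in> set (std w)"
      using trace_mset mset_eq_setD std_mem[OF w(1)] that traces_eq_trace[OF w(1)]
      by (metis list.set_intros(1))
    moreover have "count (IA_m G w) j = (\<Sum>l\<in>set (std w). if l = j then init_mult G w l else 0)"
      unfolding IA_m_def count_sum by (intro sum.cong) auto
    ultimately have "0 < count (IA_m G w) j" by (simp add: sum.delta)
    then show ?thesis using w(2) by (auto split: if_splits)
  qed
  have c: "count_list v i = 1" using occ_trace[OF w(1) assms(2)] w(3) by simp
  then obtain a s where "v = a # s" by (cases v) auto
  then have v: "v = i # s" "i \<notin> set s" using first assms(2) c by (auto simp: count_list_0_iff)
  have "up s = s"
  proof (rule ccontr)
    assume "up s \<noteq> s"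
    then have "down s \<noteq> []" using sel_full[of s G "{i}"] length_sel[of G "{i}" s] by auto
    then obtain b t where b: "down s = b # t" by (cases "down s") auto
    have "tr (i # s) = tr (down s @ i # up s)" using trace_unsel_first[of "[i]" s] by simp
    then have "b # t @ i # up s \<in> w" using traces_eq_trace[OF w(1) assms(2)] v b
      by (metis append_Cons trace_self)
    then have "b = i" by (rule first)
    then show False using set_unsel[of G "{i}" s] b v(2) by auto
  qed
  then show ?thesis using that v by blast
qed

text \<open>By \<open>pyramid_representative\<close> every word of the trace starts with its only
  \<open>i\<close>, which determines all initial multiplicities.\<close>

lemma X_alph_I:
  assumes "i \<notin> set s" "up s = s"
  shows "tr (i # s) \<in> X_alph G i"
proof -
  let ?w = "tr (i # s)"
  have w: "?w \<in> traces G" by simp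
  have m: "init_mult G ?w j = (if j = i then 1 else 0)" for j
  proof -
    have "?w = tr (replicate 0 j @ i # s)" by simp
    then obtain u where u: "?w = tr (replicate (init_mult G ?w j) j @ u)"
      using init_mult_le(2)[OF w] by blast
    have "1 \<le> init_mult G ?w i" using init_mult_le(1)[OF w, of 1 i s] by simp
    moreover have "replicate (init_mult G ?w j) j @ u \<in> ?w" using u trace_self by metis
    then obtain s' where s': "replicate (init_mult G ?w j) j @ u = i # s'" "i \<notin> set s'"
      using pyramid_representative assms by metis
    have "init_mult G ?w j = 0 \<or> j = i \<and> init_mult G ?w j \<le> 1"
    proof (cases "init_mult G ?w j")
      case (Suc n)
      then show ?thesis using s' by (cases n) auto
    qed simp
    ultimately show ?thesis by auto
  qed
  have "i \<in> set (std ?w)"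
    using mset_eq_setD[OF trace_mset[OF std_mem[OF w]]] by simp
  moreover have "IA_m G ?w = (\<Sum>j\<in>set (std ?w). if j = i then {#i#} else {#})"
    unfolding IA_m_def by (intro sum.cong) (auto simp: m)
  ultimately have "IA_m G ?w = {#i#}" by (simp add: sum.delta)
  moreover have "occ i ?w = 1" using occ_trace[OF w trace_self] assms(1) by (simp add: count_list_0_iff)
  ultimately show ?thesis unfolding X_alph_def by simp
qed

lemma X_alph_traces: "X_alph G i \<subseteq> traces G"
  unfolding X_alph_def by auto

section \<open>Unique factorization\<close>

text \<open>The words that can occur in the expansion of e(x) according to
  \<open>ev_lnw_leading\<close>.\<close>

definition lead_or_other :: "('i list set \<Rightarrow> 'i list) \<Rightarrow> 'i list set \<Rightarrow> 'i list set" where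
  "lead_or_other rep x = insert (rep x) {y. mset y = mset (rep x) \<and> hd y \<noteq> i}"

text \<open>Factors are compared from the right because \<open>last_factor\<close> strips them
  there. The last factor of \<open>xs'\<close> is the part of the last word of \<open>ys\<close>
  above its last \<open>i\<close>; it is at most as long as \<open>rep x\<close>, and equally long
  only if that word starts with \<open>i\<close> and hence is the leading one.\<close>

lemma factorization_key:
  assumes rep: "\<And>x. x \<in> X_alph G i \<Longrightarrow> rep x \<in> x"
    and xs: "xs \<in> lists (X_alph G i)" and xs': "xs' \<in> lists (X_alph G i)"
    and ys: "list_all2 (\<lambda>x y. y \<in> lead_or_other rep x) xs ys"
    and tr: "tr (concat ys) = tr (concat (map rep xs'))"
  shows "(rev (map (length \<circ> rep) xs'), rev (map (length \<circ> rep) xs)) \<in> lexord {(a, b). a < b} \<or>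
    (xs' = xs \<and> ys = map rep xs)"
  using xs xs' ys tr
proof (induction xs arbitrary: xs' ys rule: rev_induct)
  case Nil
  then have "mset (concat (map rep xs')) = {#}" using trace_mset trace_self by (metis concat.simps(1)
      list.size(3) list_all2_Nil mset.simps(1))
  then have "xs' = []" using X_alph_D[OF _ rep] Nil(2)
    by (cases xs') (auto, metis list.distinct(1))
  then show ?case using Nil by simp
next
  case (snoc x xs)
  from snoc.prems(3) obtain ys0 y where ys: "ys = ys0 @ [y]"
    "list_all2 (\<lambda>x y. y \<in> lead_or_other rep x) xs ys0" "y \<in> lead_or_other rep x"
    by (auto simp: list_all2_append1 list_all2_Cons1)
  have x: "x \<in> X_alph G i" "xs \<in> lists (X_alph G i)" using snoc.prems by auto
  obtain r where r: "rep x = i # r" "i \<notin> set r" by (rule X_alph_D[OF x(1) rep[OF x(1)]])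
  have my: "mset y = mset (rep x)" using ys(3) unfolding lead_or_other_def by auto
  then have "i \<in> set y" using r mset_eq_setD by fastforce
  then obtain p s where y: "y = p @ i # s" "i \<notin> set s" using split_list_last by metis
  have leny: "length y = length (rep x)" using my mset_eq_length by blast
  have "xs' \<noteq> []"
  proof
    assume "xs' = []"
    then have "mset (concat ys) = {#}" using snoc.prems(4) trace_mset trace_self
      by (metis concat.simps(1) list.map_disc_iff mset.simps(1))
    then show False using ys(1) y by simp
  qed
  then obtain xs0 x' where x'0: "xs' = xs0 @ [x']" by (cases xs' rule: rev_cases) auto
  then have x': "x' \<in> X_alph G i" "xs0 \<in> lists (X_alph G i)" using snoc.prems(2) by auto
  obtain s' where s': "rep x' = i # s'" "i \<notin> set s'" "up s' = s'"
    by (rule X_alph_D[OF x'(1) rep[OF x'(1)]])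
  have "tr ((concat ys0 @ p) @ i # s) = tr (concat (map rep xs0) @ i # s')"
    using snoc.prems(4) by (simp add: ys(1) y(1) x'0 s'(1))
  note lf = last_factor[OF this s'(2) y(2)]
  have "down s' = []" using s'(3) sel_full[of s' G "{i}"] by simp
  have "mset (i # up s) = mset (i # s')" using lf(1) s'(3) trace_mset trace_self by metis
  then have lens': "length (up s) = length s'" using mset_eq_length by fastforce
  show ?case
  proof (cases "length (rep x') < length (rep x)")
    case True
    then show ?thesis by (simp add: x'0)
  next
    case False
    have l: "Suc (length s') = length (rep x')" "Suc (length p + length s) = length (rep x)"
      using s'(1) leny y(1) by simp_all
    have "length p = 0" "length s \<le> length (up s)" "length (rep x') = length (rep x)"
      using False l lens' length_sel[of G "{i}" s] by linarith+
    then have eq: "p = []" "up s = s" "length (rep x') = length (rep x)"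
      using sel_full[of s G "{i}"] by auto
    then have yx: "y = rep x" using ys(3) y(1) unfolding lead_or_other_def by auto
    have "tr (rep x) = tr (rep x')" using lf(1) eq yx y s' by simp
    then have xx': "x = x'" using traces_eq_trace rep x(1) x'(1) X_alph_traces by (metis subsetD)
    have "tr (concat ys0) = tr (concat (map rep xs0))"
      using lf(2) eq sel_full[of s G "{i}"] \<open>down s' = []\<close> by simp
    from snoc.IH[OF x(2) x'(2) ys(2) this] show ?thesis
      using xx' yx by (auto simp: x'0 ys(1))
  qed
qed

end

section \<open>Independence of the super Lyndon brackets\<close>

lemma lop_span_mult:
  assumes "x \<in> lop.span S" "y \<in> lop.span T" "\<And>a b. a \<in> S \<Longrightarrow> b \<in> T \<Longrightarrow> a * b \<in> U"
  shows "x * y \<in> lop.span U"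
proof -
  have 1: "a * y \<in> lop.span U" if a: "a \<in> S" for a
    using assms(2)
  proof (induction rule: lop.span_induct)
    case base
    show ?case unfolding lop.subspace_def
      by (auto simp: ring_distribs intro: lop.span_add lop.span_scale lop.span_zero)
  next
    case (step b)
    then show ?case using assms(3) a by (blast intro: lop.span_base)
  qed
  show ?thesis using assms(1)
  proof (induction rule: lop.span_induct)
    case base
    show ?case unfolding lop.subspace_def
      by (auto simp: ring_distribs intro: lop.span_add lop.span_scale lop.span_zero)
  next
    case (step b)
    then show ?case using 1 by blast
  qed
qed

lemma lop_span_image:
  assumes "y \<in> lop.span (f ` W)"
  shows "\<exists>S d. finite S \<and> S \<subseteq> W \<and> y = (\<Sum>w\<in>S. sc (d w) (f w))"
proof -
  from assms obtain T c where T: "finite T" "T \<subseteq> f ` W" "y = (\<Sum>x\<in>T. sc (c x) x)"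
    unfolding lop.span_explicit by blast
  from T(2) obtain S where S: "S \<subseteq> W" "inj_on f S" "T = f ` S"
    unfolding subset_image_inj by blast
  then have "finite S" using T(1) finite_imageD by auto
  moreover have "y = (\<Sum>w\<in>S. sc (c (f w)) (f w))" using T S by (simp add: sum.reindex)
  ultimately show ?thesis using S(1) by (intro exI[of _ S] exI[of _ "\<lambda>w. c (f w)"]) simp
qed

lemma app_sum: "app (\<Sum>w\<in>S. f w) T v = (\<Sum>w\<in>S. app (f w) T v)"
  by (induction S rule: infinite_finite_induct) auto

lemma app_span_zero:
  assumes "x \<in> lop.span S" "\<And>s. s \<in> S \<Longrightarrow> app s T v = 0"
  shows "app x T v = 0"
  using assms(1)
proof (induction rule: lop.span_induct)
  case base
  show ?case unfolding lop.subspace_def by auto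
qed (use assms(2) in auto)

text \<open>The sign of the permutation sorting the odd letters turns the super commutation of distinct
  letters into commutation.\<close>

primrec sort_sign :: "'i::linorder set \<Rightarrow> 'i list \<Rightarrow> complex" where
  "sort_sign \<Psi> [] = 1"
| "sort_sign \<Psi> (a # w) = (if a \<in> \<Psi> then (-1) ^ length (filter (\<lambda>b. b \<in> \<Psi> \<and> b < a) w) else 1) * sort_sign \<Psi> w"

lemma sort_sign_nonzero: "sort_sign \<Psi> w \<noteq> 0"
  by (induction w) auto

lemma sort_sign_swap:
  "a \<noteq> b \<Longrightarrow> sort_sign \<Psi> (u @ a # b # v) = koszul (a \<in> \<Psi>) (b \<in> \<Psi>) * sort_sign \<Psi> (u @ b # a # v)"
proof (induction u)
  case Nil
  then show ?case by (cases a b rule: linorder_cases) (auto simp: koszul_def)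
qed auto

fun lnw :: "'i list \<Rightarrow> 'i bkm_gen na" where
  "lnw [] = 0"
| "lnw (a # w) = foldl br (gen (Egen a)) (map (\<lambda>b. gen (Egen b)) w)"

lemma lnw_snoc: "w \<noteq> [] \<Longrightarrow> lnw (w @ [a]) = br (lnw w) (gen (Egen a))"
  by (cases w) auto

lemma lookup_eta: "Poly_Mapping.lookup (eta k) j = int (Poly_Mapping.lookup k j)"
proof -
  have "Poly_Mapping.lookup (eta k) j
      = (\<Sum>l\<in>Poly_Mapping.keys k. if l = j then int (Poly_Mapping.lookup k j) else 0)"
    unfolding eta_def lookup_sum by (intro sum.cong) (auto simp: lookup_single when_def)
  then show ?thesis by (simp add: sum.delta in_keys_iff)
qed

context bkm_data
begin

definition opw :: "'i list \<Rightarrow> 'i list lop" where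
  "opw w = prod_list (map E w)"

lemma app_opw: "app (opw w) T = (\<lambda>v. T (w @ v))"
  unfolding opw_def by (induction w arbitrary: T) auto

lemma opw_append: "opw (u @ v) = opw u * opw v"
  unfolding opw_def by simp

lemma homog_lnw: "homog (bkm_odd \<Psi>) (word_odd (\<lambda>j. j \<in> \<Psi>) w) (lnw w)"
proof (induction w rule: rev_induct)
  case Nil
  show ?case by (simp add: homog_0)
next
  case (snoc a w)
  show ?case
  proof (cases "w = []")
    case True
    then show ?thesis using homog_EFH(1) by simp
  next
    case False
    then show ?thesis
      using homog_br[OF snoc homog_EFH(1)[of a]] by (simp add: lnw_snoc word_odd_append)
  qed
qed

lemma ev_lnw_snoc:
  "w \<noteq> [] \<Longrightarrow> evb (lnw (w @ [a])) = sbr (word_odd (\<lambda>j. j \<in> \<Psi>) w) (par a) (evb (lnw w)) (E a)"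
  by (simp add: lnw_snoc ev_br[OF homog_lnw homog_EFH(1)])

text \<open>Each commutator puts the new letter at the right end or, with a sign, at the left end.
  As \<open>i\<close> occurs only once, the word in which all letters went to the right is the only
  one starting with \<open>i\<close>.\<close>

lemma ev_lnw_leading:
  assumes "i \<notin> set s"
  shows "evb (lnw (i # s)) - opw (i # s) \<in> lop.span {opw y |y. mset y = mset (i # s) \<and> hd y \<noteq> i}"
  using assms
proof (induction s rule: rev_induct)
  case Nil
  show ?case by (simp add: opw_def lop.span_zero)
next
  case (snoc a s)
  let ?S = "\<lambda>s. {opw y |y. mset y = mset (i # s) \<and> hd y \<noteq> i}"
  let ?k = "koszul (word_odd (\<lambda>j. j \<in> \<Psi>) (i # s)) (par a)"
  define \<sigma> where "\<sigma> = evb (lnw (i # s)) - opw (i # s)"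
  have \<sigma>: "\<sigma> \<in> lop.span (?S s)" using snoc unfolding \<sigma>_def by simp
  have Ea: "E a \<in> lop.span {E a}" by (rule lop.span_base) simp
  have "evb (lnw (i # s @ [a])) = sbr (word_odd (\<lambda>j. j \<in> \<Psi>) (i # s)) (par a) (opw (i # s) + \<sigma>) (E a)"
    using ev_lnw_snoc[of "i # s" a] by (simp add: \<sigma>_def)
  then have "evb (lnw (i # s @ [a])) - opw (i # s @ [a])
      = \<sigma> * E a - sc ?k (opw (a # i # s)) - sc ?k (E a * \<sigma>)"
    using opw_append[of "i # s" "[a]"]
    by (simp add: sbr_def opw_def algebra_simps lop.scale_right_distrib)
  moreover have "\<sigma> * E a \<in> lop.span (?S (s @ [a]))"
  proof (rule lop_span_mult[OF \<sigma> Ea])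
    fix x y assume "x \<in> ?S s" "y \<in> {E a}"
    then obtain z where z: "x = opw z" "mset z = mset (i # s)" "hd z \<noteq> i" "y = E a" by blast
    then have "z \<noteq> []" by auto
    then have "x * y = opw (z @ [a])" "mset (z @ [a]) = mset (i # s @ [a])" "hd (z @ [a]) \<noteq> i"
      using z by (simp_all add: opw_def)
    then show "x * y \<in> ?S (s @ [a])" by blast
  qed
  moreover have "E a * \<sigma> \<in> lop.span (?S (s @ [a]))"
  proof (rule lop_span_mult[OF Ea \<sigma>])
    fix x y assume "x \<in> {E a}" "y \<in> ?S s"
    then obtain z where z: "y = opw z" "mset z = mset (i # s)" "x = E a" by blast
    then have "x * y = opw (a # z)" "mset (a # z) = mset (i # s @ [a])" "hd (a # z) \<noteq> i"
      using snoc.prems by (auto simp: opw_def add_mset_commute)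
    then show "x * y \<in> ?S (s @ [a])" by blast
  qed
  moreover have "opw (a # i # s) \<in> lop.span (?S (s @ [a]))"
  proof (rule lop.span_base)
    have "mset (a # i # s) = mset (i # s @ [a])" "hd (a # i # s) \<noteq> i" using snoc.prems by auto
    then show "opw (a # i # s) \<in> ?S (s @ [a])" by blast
  qed
  ultimately show ?case by (simp add: lop.span_diff lop.span_scale)
qed

end

text \<open>The choice \<open>rep\<close> is arbitrary: swapping nonadjacent odd letters may change
  the sign of a left normed word, so e(w) has to be attached to a chosen representative.\<close>

locale bkm_words = bkm_data A \<Psi> for A :: "'i::linorder \<Rightarrow> 'i \<Rightarrow> real" and \<Psi> :: "'i set" +
  fixes i :: 'i and rep :: "'i list set \<Rightarrow> 'i list"
  assumes rep: "x \<in> traces (quasi_dynkin A) \<Longrightarrow> rep x \<in> x"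
begin

abbreviation "G \<equiv> quasi_dynkin A"
abbreviation "XA \<equiv> X_alph G i"
abbreviation "ex x \<equiv> lnw (rep x)"

sublocale commutation_graph G i
  by unfold_locales (auto simp: quasi_dynkin_def A_zero_iff)

sublocale lyndon_span trace_less XA "bkm_odd \<Psi>" "bkm_relations A \<Psi>" "trace_odd \<Psi>" "\<lambda>x. lnw (rep x)"
proof -
  interpret alphabet trace_less XA by (rule alphabet_traces[OF X_alph_traces])
  show "lyndon_span trace_less XA (bkm_odd \<Psi>) (trace_odd \<Psi>) (\<lambda>x. lnw (rep x))"
  proof
    show "homog (bkm_odd \<Psi>) (trace_odd \<Psi> x) (lnw (rep x))" if "x \<in> XA" for x
      using homog_lnw[of "rep x"] trace_odd_trace[of x G "rep x"] rep that X_alph_traces by auto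
  qed
qed

lemma rep_XA: "x \<in> XA \<Longrightarrow> rep x \<in> x"
  using rep X_alph_traces by blast

lemma rep_form:
  assumes "x \<in> XA"
  obtains s where "rep x = i # s" "i \<notin> set s" "sel G {i} s = s"
  using X_alph_D[OF assms rep_XA[OF assms]] .

lemma wt_rep: "x \<in> XA \<Longrightarrow> wt x = wtl (rep x)"
  using wt_trace rep_XA X_alph_traces by blast

definition exw :: "'i list set list \<Rightarrow> 'i list lop" where
  "exw xs = prod_list (map (\<lambda>x. evb (ex x)) xs)"

lemma exw_append: "exw (u @ v) = exw u * exw v"
  unfolding exw_def by simp

lemma exw_leading:
  assumes "xs \<in> lists XA"
  shows "exw xs - opw (concat (map rep xs)) \<in> lop.span {opw (concat ys) |ys.
    list_all2 (\<lambda>x y. y \<in> lead_or_other rep x) xs ys \<and> ys \<noteq> map rep xs}"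
  using assms
proof (induction rule: lists.induct)
  case Nil
  show ?case by (simp add: exw_def opw_def lop.span_zero)
next
  case (Cons x xs)
  let ?S = "\<lambda>xs. {opw (concat ys) |ys. list_all2 (\<lambda>x y. y \<in> lead_or_other rep x) xs ys \<and> ys \<noteq> map rep xs}"
  let ?Y = "\<lambda>x. {opw y |y. y \<in> lead_or_other rep x \<and> y \<noteq> rep x}"
  have x: "x \<in> XA" by (rule Cons.hyps)
  obtain s where s: "rep x = i # s" "i \<notin> set s" by (rule rep_form[OF x])
  define \<alpha> where "\<alpha> = evb (ex x) - opw (rep x)"
  define \<beta> where "\<beta> = exw xs - opw (concat (map rep xs))"
  have \<alpha>: "\<alpha> \<in> lop.span (?Y x)"
  proof -
    have "\<alpha> \<in> lop.span {opw y |y. mset y = mset (i # s) \<and> hd y \<noteq> i}"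
      unfolding \<alpha>_def s(1) by (rule ev_lnw_leading[OF s(2)])
    moreover have "{opw y |y. mset y = mset (i # s) \<and> hd y \<noteq> i} \<subseteq> ?Y x"
      using s(1) unfolding lead_or_other_def by fastforce
    ultimately show ?thesis using lop.span_mono by blast
  qed
  have \<beta>: "\<beta> \<in> lop.span (?S xs)" unfolding \<beta>_def using Cons by simp
  have "exw (x # xs) = (opw (rep x) + \<alpha>) * (opw (concat (map rep xs)) + \<beta>)"
    by (simp add: \<alpha>_def \<beta>_def exw_def)
  then have "exw (x # xs) - opw (concat (map rep (x # xs)))
      = opw (rep x) * \<beta> + (\<alpha> * opw (concat (map rep xs)) + \<alpha> * \<beta>)"
    by (simp add: opw_append ring_distribs)
  moreover have "opw (rep x) * \<beta> \<in> lop.span (?S (x # xs))"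
  proof (rule lop_span_mult[OF lop.span_base[of _ "{opw (rep x)}"] \<beta>])
    fix a b assume "a \<in> {opw (rep x)}" "b \<in> ?S xs"
    then obtain ys where ys: "a = opw (rep x)" "b = opw (concat ys)"
      "list_all2 (\<lambda>x y. y \<in> lead_or_other rep x) xs ys" "ys \<noteq> map rep xs" by blast
    have "a * b = opw (concat (rep x # ys)) \<and>
      list_all2 (\<lambda>x y. y \<in> lead_or_other rep x) (x # xs) (rep x # ys) \<and> rep x # ys \<noteq> map rep (x # xs)"
      using ys by (simp add: opw_append lead_or_other_def)
    then show "a * b \<in> ?S (x # xs)" by blast
  qed simp
  moreover have "\<alpha> * opw (concat (map rep xs)) \<in> lop.span (?S (x # xs))"
  proof (rule lop_span_mult[OF \<alpha> lop.span_base[of _ "{opw (concat (map rep xs))}"]])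
    fix a b assume "a \<in> ?Y x" "b \<in> {opw (concat (map rep xs))}"
    then obtain y where y: "a = opw y" "y \<in> lead_or_other rep x" "y \<noteq> rep x"
      "b = opw (concat (map rep xs))" by blast
    have "list_all2 (\<lambda>x y. y \<in> lead_or_other rep x) xs (map rep xs)"
      by (simp add: list_all2_conv_all_nth lead_or_other_def)
    then have "a * b = opw (concat (y # map rep xs)) \<and>
      list_all2 (\<lambda>x y. y \<in> lead_or_other rep x) (x # xs) (y # map rep xs) \<and> y # map rep xs \<noteq> map rep (x # xs)"
      using y by (simp add: opw_append)
    then show "a * b \<in> ?S (x # xs)" by blast
  qed simp
  moreover have "\<alpha> * \<beta> \<in> lop.span (?S (x # xs))"
  proof (rule lop_span_mult[OF \<alpha> \<beta>])
    fix a b assume "a \<in> ?Y x" "b \<in> ?S xs"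
    then obtain y ys where y: "a = opw y" "y \<in> lead_or_other rep x" "y \<noteq> rep x" "b = opw (concat ys)"
      "list_all2 (\<lambda>x y. y \<in> lead_or_other rep x) xs ys" by blast
    then have "a * b = opw (concat (y # ys)) \<and>
      list_all2 (\<lambda>x y. y \<in> lead_or_other rep x) (x # xs) (y # ys) \<and> y # ys \<noteq> map rep (x # xs)"
      by (simp add: opw_append)
    then show "a * b \<in> ?S (x # xs)" by blast
  qed
  ultimately show ?case by (simp only:) (intro lop.span_add)
qed

definition trace_fun :: "'i list set \<Rightarrow> 'i list \<Rightarrow> complex" where
  "trace_fun \<tau> w = (if w \<in> \<tau> then sort_sign \<Psi> w else 0)"

definition wtX :: "'i list set list \<Rightarrow> ('i \<Rightarrow>\<^sub>0 int)" where
  "wtX xs = sum_list (map wt xs)"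

lemma wtX_rep: "xs \<in> lists XA \<Longrightarrow> wtX xs = wtl (concat (map rep xs))"
  unfolding wtX_def wtl_concat by (induction xs) (auto simp: wt_rep)

lemma wtX_mset: "mset u = mset v \<Longrightarrow> wtX u = wtX v"
  unfolding wtX_def by (metis mset_map sum_mset_sum_list)

lemma trace_fun_Z:
  assumes \<tau>: "\<tau> \<in> traces G" "v \<in> \<tau>" "wtl v = eta k"
    and k: "\<forall>j \<in> I_re A \<union> Psi_0 A \<Psi>. Poly_Mapping.lookup k j \<le> 1"
  shows "trace_fun \<tau> \<in> Z"
proof (rule mem_ZI)
  have eq: "\<tau> = trace G v" using traces_eq_trace \<tau> by blast
  show "count_list w j \<le> 1" if "trace_fun \<tau> w \<noteq> 0" "j \<in> I_re A \<union> Psi_0 A \<Psi>" for w j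
  proof -
    have "w \<in> trace G v" using that(1) eq unfolding trace_fun_def by (auto split: if_splits)
    then have "wtl w = eta k" using trace_mset wtl_mset \<tau>(3) by metis
    then have "int (count_list w j) = int (Poly_Mapping.lookup k j)" by (metis lookup_wtl lookup_eta)
    then show ?thesis using k that(2) by auto
  qed
  show "trace_fun \<tau> (u @ a # b # v) = koszul (par a) (par b) * trace_fun \<tau> (u @ b # a # v)"
    if "a \<noteq> b" "A a b = 0" for u v a b
  proof -
    have "\<not> G a b" using that unfolding quasi_dynkin_def by simp
    then have "u @ a # b # v \<in> \<tau> \<longleftrightarrow> u @ b # a # v \<in> \<tau>"
      unfolding eq using trace_swap[of G a b u v] by (simp flip: trace_eq_iff)
    then show ?thesis using sort_sign_swap[OF that(1)] unfolding trace_fun_def by simp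
  qed
qed

text \<open>The word whose list of factor lengths, read from the right, is largest is detected by its own
  trace.\<close>

lemma exw_independent:
  assumes S: "finite S" "S \<subseteq> lists XA" and d: "w1 \<in> S" "d w1 \<noteq> 0"
  shows "\<exists>w\<in>S. app (\<Sum>w\<in>S. sc (d w) (exw w)) (trace_fun (trace G (concat (map rep w)))) [] \<noteq> 0"
proof -
  let ?key = "\<lambda>xs. rev (map (length \<circ> rep) xs)"
  let ?L = "lexord {(a, b). a < (b :: nat)}"
  \<comment> \<open>Zero coefficients are discarded, so that the maximal key belongs to a word that
    is really present.\<close>
  define S' where "S' = {w\<in>S. d w \<noteq> 0}"
  have "finite (?key ` S')" "?key ` S' \<noteq> {}" using S d unfolding S'_def by auto
  then obtain m where m: "m \<in> ?key ` S'" "\<forall>u\<in>?key ` S'. u \<noteq> m \<longrightarrow> (u, m) \<in> ?L"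
    using finite_ex_lex_max by blast
  then obtain w where w: "w \<in> S'" "m = ?key w" by blast
  let ?\<tau> = "trace G (concat (map rep w))"
  let ?T = "trace_fun ?\<tau>"
  have wS: "w \<in> S" "w \<in> lists XA" "d w \<noteq> 0" using w S unfolding S'_def by auto
  \<comment> \<open>A word of \<open>S'\<close> that meets the trace of \<open>w\<close> has a key
    at least that of \<open>w\<close>, by \<open>factorization_key\<close>; maximality leaves only
    \<open>w\<close> with its leading word.\<close>
  have lead: "v = w \<and> ys = map rep w"
    if v: "v \<in> S'" and ys: "list_all2 (\<lambda>x y. y \<in> lead_or_other rep x) v ys" "concat ys \<in> ?\<tau>" for v ys
  proof -
    have vX: "v \<in> lists XA" using v S unfolding S'_def by auto
    have "trace G (concat ys) = trace G (concat (map rep w))" using ys(2) by (simp add: trace_eq_iff)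
    from factorization_key[OF rep_XA vX wS(2) ys(1) this]
    consider "(?key w, ?key v) \<in> ?L" | "w = v \<and> ys = map rep v" by blast
    then show ?thesis
    proof cases
      case 1
      have "?key v = m \<or> (?key v, m) \<in> ?L" using m(2) v by blast
      then have "(m, m) \<in> ?L" using 1 w(2) lexord_trans_less by auto
      then show ?thesis using lexord_irrefl_less by blast
    qed simp
  qed
  have val: "app (exw v) ?T [] = (if v = w then sort_sign \<Psi> (concat (map rep w)) else 0)" if v: "v \<in> S'" for v
  proof -
    have vX: "v \<in> lists XA" using v S unfolding S'_def by auto
    have "app (exw v - opw (concat (map rep v))) ?T [] = 0"
    proof (rule app_span_zero[OF exw_leading[OF vX]])
      fix s assume "s \<in> {opw (concat ys) |ys. list_all2 (\<lambda>x y. y \<in> lead_or_other rep x) v ys \<and> ys \<noteq> map rep v}"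
      then obtain ys where ys: "s = opw (concat ys)" "list_all2 (\<lambda>x y. y \<in> lead_or_other rep x) v ys"
        "ys \<noteq> map rep v" by blast
      then have "concat ys \<notin> ?\<tau>" using lead[OF v ys(2)] by blast
      then show "app s ?T [] = 0" unfolding ys(1) by (simp add: app_opw trace_fun_def)
    qed
    then have "app (exw v) ?T [] = ?T (concat (map rep v))" by (simp add: app_opw)
    moreover have "concat (map rep v) \<in> ?\<tau> \<longleftrightarrow> v = w"
    proof
      assume "concat (map rep v) \<in> ?\<tau>"
      moreover have "list_all2 (\<lambda>x y. y \<in> lead_or_other rep x) v (map rep v)"
        by (simp add: list_all2_conv_all_nth lead_or_other_def)
      ultimately show "v = w" using lead[OF v] by blast
    qed simp
    ultimately show ?thesis unfolding trace_fun_def by auto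
  qed
  have "app (\<Sum>w\<in>S. sc (d w) (exw w)) ?T [] = (\<Sum>v\<in>S. d v * app (exw v) ?T [])"
    by (simp add: app_sum)
  also have "\<dots> = (\<Sum>v\<in>S. if v = w then d w * sort_sign \<Psi> (concat (map rep w)) else 0)"
  proof (rule sum.cong[OF refl])
    fix v assume "v \<in> S"
    then show "d v * app (exw v) ?T [] = (if v = w then d w * sort_sign \<Psi> (concat (map rep w)) else 0)"
      using val[of v] wS by (cases "v \<in> S'") (auto simp: S'_def)
  qed
  also have "\<dots> = d w * sort_sign \<Psi> (concat (map rep w))" using wS S by (simp add: sum.delta)
  finally show ?thesis using wS sort_sign_nonzero by (intro bexI[of _ w]) auto
qed

section \<open>Leading words of super Lyndon brackets\<close>

definition above :: "'i list set list \<Rightarrow> 'i list lop set" where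
  "above w = {exw w' |w'. w' \<in> lists XA \<and> (w, w') \<in> lexord trace_less \<and> mset w' = mset w}"

text \<open>Equal multisets give equal lengths, so a strict comparison of the first factors is not
  disturbed by what follows.\<close>

lemma exw_mult_above:
  assumes "a \<in> insert (exw u) (above u)" "b \<in> insert (exw v) (above v)" "u \<in> lists XA" "v \<in> lists XA"
  shows "a * b \<in> insert (exw (u @ v)) (above (u @ v))"
    and "a \<in> above u \<or> b \<in> above v \<Longrightarrow> a * b \<in> above (u @ v)"
proof -
  obtain u' where u': "a = exw u'" "u' \<in> lists XA" "mset u' = mset u" "u' = u \<or> (u, u') \<in> lexord trace_less"
    "a \<in> above u \<Longrightarrow> (u, u') \<in> lexord trace_less"
    using assms(1,3) unfolding above_def by blast
  obtain v' where v': "b = exw v'" "v' \<in> lists XA" "mset v' = mset v" "v' = v \<or> (v, v') \<in> lexord trace_less"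
    "b \<in> above v \<Longrightarrow> (v, v') \<in> lexord trace_less"
    using assms(2,4) unfolding above_def by blast
  have ab: "a * b = exw (u' @ v')" "u' @ v' \<in> lists XA" "mset (u' @ v') = mset (u @ v)"
    using u' v' by (auto simp: exw_append)
  have len: "length u' = length u" using u'(3) mset_eq_length by blast
  have 1: "(u @ v, u' @ v') \<in> lexord trace_less" if "(u, u') \<in> lexord trace_less"
    using lexord_append_mono[OF that] len by simp
  have 2: "(u @ v, u' @ v') \<in> lexord trace_less" if "u' = u" "(v, v') \<in> lexord trace_less"
    using lexord_append_leftI that by blast
  show "a * b \<in> insert (exw (u @ v)) (above (u @ v))"
    using 1 2 ab u'(4) v'(4) unfolding above_def by blast
  show "a * b \<in> above (u @ v)" if "a \<in> above u \<or> b \<in> above v"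
  proof -
    have "(u @ v, u' @ v') \<in> lexord trace_less" using that u'(4,5) v'(4,5) 1 2 by blast
    then show ?thesis using ab unfolding above_def by blast
  qed
qed

lemma mult_above:
  assumes "x - exw u \<in> lop.span (above u)" "y - exw v \<in> lop.span (above v)" "u \<in> lists XA" "v \<in> lists XA"
  shows "x * y - exw (u @ v) \<in> lop.span (above (u @ v))"
proof -
  define \<alpha> where "\<alpha> = x - exw u"
  define \<beta> where "\<beta> = y - exw v"
  have ab: "\<alpha> \<in> lop.span (above u)" "\<beta> \<in> lop.span (above v)" using assms unfolding \<alpha>_def \<beta>_def by auto
  have e: "exw w \<in> lop.span {exw w}" for w by (simp add: lop.span_base)
  have "x * y - exw (u @ v) = exw u * \<beta> + (\<alpha> * exw v + \<alpha> * \<beta>)"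
    by (simp add: \<alpha>_def \<beta>_def exw_append algebra_simps)
  moreover have "exw u * \<beta> \<in> lop.span (above (u @ v))"
    by (rule lop_span_mult[OF e ab(2)]) (use exw_mult_above(2) assms in blast)
  moreover have "\<alpha> * exw v \<in> lop.span (above (u @ v))"
    by (rule lop_span_mult[OF ab(1) e]) (use exw_mult_above(2) assms in blast)
  moreover have "\<alpha> * \<beta> \<in> lop.span (above (u @ v))"
    by (rule lop_span_mult[OF ab]) (use exw_mult_above(2) assms in blast)
  ultimately show ?thesis by (simp only:) (intro lop.span_add)
qed

text \<open>The second term of [P u, P v] has leading word v u, a rotation of the Lyndon word u v
  and therefore larger.\<close>

lemma lyndon_leading:
  assumes "w \<in> Lyn"
  shows "evb (P w) - exw w \<in> lop.span (above w)"
  using assms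
proof (induction w rule: length_induct)
  case (1 w)
  have w: "w \<in> lists XA" "lyndon trace_less w" "w \<noteq> []" using 1(2) unfolding Lyn_def lyndon_def by auto
  show ?case
  proof (cases "length w = 1")
    case True
    then obtain x where "w = [x]" by (auto simp: length_Suc_conv)
    then show ?thesis by (simp add: exw_def lop.span_zero)
  next
    case False
    have len: "2 \<le> length w" using False w(3) by (cases w) (auto simp: Suc_le_eq)
    define u where "u = take (std_split trace_less w) w"
    define v where "v = drop (std_split trace_less w) w"
    note props = std_split_props[OF w(1,2) len]
    have uv: "w = u @ v" "P w = br (P u) (P v)"
      using lyndon_poly_split[OF len props(2,3)] by (simp_all add: u_def v_def)
    have L: "u \<in> Lyn" "v \<in> Lyn" using props w(1)
      by (auto simp: Lyn_def u_def v_def dest: in_set_takeD in_set_dropD)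
    have X: "u \<in> lists XA" "v \<in> lists XA" and ne: "u \<noteq> []" "v \<noteq> []"
      using L unfolding Lyn_def lyndon_def by auto
    have IH: "evb (P u) - exw u \<in> lop.span (above u)" "evb (P v) - exw v \<in> lop.span (above v)"
      using 1(1) L ne uv(1) by auto
    have uv_vu: "(u @ v, v @ u) \<in> lexord trace_less"
      using w(2) ne unfolding lyndon_iff_append uv(1) by blast
    have sub: "above (v @ u) \<subseteq> above (u @ v)"
      using lex_trans[OF uv_vu] unfolding above_def by auto
    have vu: "exw (v @ u) \<in> above (u @ v)"
      using uv_vu X unfolding above_def by (intro CollectI exI[of _ "v @ u"]) auto
    have 1: "evb (P u) * evb (P v) - exw (u @ v) \<in> lop.span (above (u @ v))"
      by (rule mult_above[OF IH X])
    have "evb (P v) * evb (P u) - exw (v @ u) \<in> lop.span (above (v @ u))"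
      by (rule mult_above[OF IH(2,1) X(2,1)])
    then have "evb (P v) * evb (P u) - exw (v @ u) \<in> lop.span (above (u @ v))"
      using lop.span_mono[OF sub] by blast
    from lop.span_add[OF this lop.span_base[OF vu]]
    have 2: "evb (P v) * evb (P u) \<in> lop.span (above (u @ v))" by simp
    have eq: "evb (P w) - exw w = (evb (P u) * evb (P v) - exw (u @ v))
        - sc (koszul (word_odd (trace_odd \<Psi>) u) (word_odd (trace_odd \<Psi>) v)) (evb (P v) * evb (P u))"
      unfolding uv(2) ev_br[OF homog_P[OF L(1)] homog_P[OF L(2)]] by (simp add: sbr_def uv(1))
    have "evb (P w) - exw w \<in> lop.span (above (u @ v))"
      unfolding eq by (rule lop.span_diff[OF 1 lop.span_scale[OF 2]])
    then show ?thesis using uv(1) by simp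
  qed
qed

text \<open>For w = u u with \<open>u\<close> odd the super bracket of \<open>P u\<close> with
  itself is twice its square, so the leading coefficient is 2 instead of 1.\<close>

lemma super_lyndon_leading:
  assumes "w \<in> lists XA" "super_lyndon trace_less (trace_odd \<Psi>) w"
  shows "\<exists>c. c \<noteq> 0 \<and> evb (P w) - sc c (exw w) \<in> lop.span (above w)"
proof (cases "lyndon trace_less w")
  case True
  then show ?thesis using lyndon_leading[of w] assms unfolding Lyn_def by (intro exI[of _ 1]) simp
next
  case False
  then obtain u where u: "lyndon trace_less u" "word_odd (trace_odd \<Psi>) u" "w = u @ u"
    using assms unfolding super_lyndon_def by blast
  then have L: "u \<in> Lyn" "u \<in> lists XA" using assms unfolding Lyn_def by auto
  have "homog (bkm_odd \<Psi>) True (P u)" using homog_P[OF L(1)] u(2) by simp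
  from ev_br[OF this this, of rep_gen] have ev: "evb (P w) = sc 2 (evb (P u) * evb (P u))"
    unfolding u(3) lyndon_poly_square[OF L(1)]
    using lop.scale_left_distrib[of 1 1 "evb (P u) * evb (P u)"] by (simp add: sbr_def)
  have "evb (P u) * evb (P u) - exw (u @ u) \<in> lop.span (above (u @ u))"
    by (rule mult_above[OF lyndon_leading lyndon_leading]) (use L in auto)
  from lop.span_scale[OF this, of 2] have "sc 2 (evb (P u) * evb (P u)) - sc 2 (exw w) \<in> lop.span (above w)"
    by (simp add: u(3) lop.scale_right_diff_distrib)
  then show ?thesis unfolding ev by (intro exI[of _ 2]) simp
qed

lemma above_exw: "above w \<subseteq> exw ` {w' \<in> lists XA. (w, w') \<in> lexord trace_less \<and> wtX w' = wtX w}"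
proof
  fix z assume "z \<in> above w"
  then obtain w' where w': "z = exw w'" "w' \<in> lists XA" "(w, w') \<in> lexord trace_less" "mset w' = mset w"
    unfolding above_def by blast
  from wtX_mset[OF w'(4)] w' show "z \<in> exw ` {w' \<in> lists XA. (w, w') \<in> lexord trace_less \<and> wtX w' = wtX w}"
    by blast
qed

lemma finite_ex_lex_min:
  assumes "finite S" "S \<noteq> {}" "S \<subseteq> lists XA"
  shows "\<exists>m\<in>S. \<forall>w\<in>S. w = m \<or> (m, w) \<in> lexord trace_less"
  using assms
proof (induction rule: finite_ne_induct)
  case (insert x S)
  then obtain m where m: "m \<in> S" "\<forall>w\<in>S. w = m \<or> (m, w) \<in> lexord trace_less" by auto
  then have "m \<noteq> x" "m \<in> lists XA" using insert by auto
  then consider "(m, x) \<in> lexord trace_less" | "(x, m) \<in> lexord trace_less"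
    using lex_total[of m x] insert.prems by auto
  then show ?case
  proof cases
    case 1
    then show ?thesis using m by blast
  next
    case 2
    then have "\<forall>w\<in>S. (x, w) \<in> lexord trace_less" using m(2) lex_trans[OF 2] by auto
    then show ?thesis by blast
  qed
qed simp

text \<open>The least word \<open>m\<close> of a relation contributes \<open>exw m\<close> with
  coefficient \<open>c m * a\<close>, and all else lies above \<open>m\<close>. So a nontrivial
  combination of the products \<open>exw\<close> arises, and \<open>exw_independent\<close> detects
  it, though possibly at another word than \<open>m\<close>.\<close>

theorem lyndon_poly_independent:
  assumes k: "\<forall>j \<in> I_re A \<union> Psi_0 A \<Psi>. Poly_Mapping.lookup k j \<le> 1"
    and S: "finite S" "S \<subseteq> C_set G \<Psi> i k" and sum: "(\<Sum>w\<in>S. scl (c w) (P w)) \<in> ideal"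
  shows "\<forall>w\<in>S. c w = 0"
proof (rule ccontr)
  assume "\<not> (\<forall>w\<in>S. c w = 0)"
  define S' where "S' = {w\<in>S. c w \<noteq> 0}"
  have C: "w \<in> lists XA" "super_lyndon trace_less (trace_odd \<Psi>) w" "wtX w = eta k" if "w \<in> S" for w
    using that S(2) unfolding C_set_def wtX_def by auto
  have "finite S'" "S' \<noteq> {}" "S' \<subseteq> lists XA"
    using S C \<open>\<not> (\<forall>w\<in>S. c w = 0)\<close> unfolding S'_def by auto
  then obtain m where m: "m \<in> S'" "\<forall>w\<in>S'. w = m \<or> (m, w) \<in> lexord trace_less"
    using finite_ex_lex_min by blast
  then have mS: "m \<in> S" "c m \<noteq> 0" unfolding S'_def by auto
  define W where "W = {w \<in> lists XA. (m, w) \<in> lexord trace_less \<and> wtX w = eta k}"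
  define x where "x = evb (\<Sum>w\<in>S. scl (c w) (P w))"
  obtain a where a: "a \<noteq> 0" "evb (P m) - sc a (exw m) \<in> lop.span (above m)"
    using super_lyndon_leading C mS by blast
  have aW: "above m \<subseteq> exw ` W"
    using above_exw[of m] C(3)[OF mS(1)] unfolding W_def by simp
  have PW: "evb (P w) \<in> lop.span (exw ` W)" if w: "w \<in> S'" "w \<noteq> m" for w
  proof -
    have wS: "w \<in> S" "(m, w) \<in> lexord trace_less" using w m(2) unfolding S'_def by auto
    obtain b where b: "evb (P w) - sc b (exw w) \<in> lop.span (above w)"
      using super_lyndon_leading C wS by blast
    have "above w \<subseteq> exw ` W"
      by (rule order.trans[OF above_exw]) (use C(3)[OF wS(1)] lex_trans[OF wS(2)] in \<open>auto simp: W_def\<close>)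
    then have "evb (P w) - sc b (exw w) \<in> lop.span (exw ` W)" using b lop.span_mono by blast
    moreover have "exw w \<in> lop.span (exw ` W)"
      using wS C[OF wS(1)] unfolding W_def by (intro lop.span_base imageI) auto
    ultimately show ?thesis
      using lop.span_add[OF _ lop.span_scale] by (metis diff_add_cancel)
  qed
  have "x = (\<Sum>w\<in>S. sc (c w) (evb (P w)))"
    unfolding x_def by (simp add: ev_sum ev_scl)
  also have "\<dots> = (\<Sum>w\<in>S'. sc (c w) (evb (P w)))"
    using S(1) unfolding S'_def by (intro sum.mono_neutral_right) auto
  also have "\<dots> = sc (c m) (evb (P m)) + (\<Sum>w\<in>S' - {m}. sc (c w) (evb (P w)))"
    using m(1) S(1) unfolding S'_def by (intro sum.remove) auto
  finally have "x - sc (c m * a) (exw m)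
      = sc (c m) (evb (P m) - sc a (exw m)) + (\<Sum>w\<in>S' - {m}. sc (c w) (evb (P w)))"
    by (simp add: lop.scale_right_diff_distrib)
  also have "\<dots> \<in> lop.span (exw ` W)"
    using a(2) lop.span_mono[OF aW] PW
    by (intro lop.span_add lop.span_sum lop.span_scale) auto
  finally have "x - sc (c m * a) (exw m) \<in> lop.span (exw ` W)" .
  from lop_span_image[OF this] obtain T d where
    T: "finite T" "T \<subseteq> W" "x - sc (c m * a) (exw m) = (\<Sum>w\<in>T. sc (d w) (exw w))"
    by (elim exE conjE)
  have mT: "m \<notin> T" using T(2) lex_irrefl unfolding W_def by blast
  define d' where "d' = d(m := c m * a)"
  have "(\<Sum>w\<in>insert m T. sc (d' w) (exw w)) = sc (c m * a) (exw m) + (\<Sum>w\<in>T. sc (d' w) (exw w))"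
    using mT T(1) by (simp add: d'_def)
  also have "(\<Sum>w\<in>T. sc (d' w) (exw w)) = (\<Sum>w\<in>T. sc (d w) (exw w))"
    using mT by (intro sum.cong) (auto simp: d'_def)
  also have "\<dots> = x - sc (c m * a) (exw m)" using T(3) by simp
  finally have x: "x = (\<Sum>w\<in>insert m T. sc (d' w) (exw w))" by simp
  obtain w where w: "w \<in> insert m T"
    "app (\<Sum>w\<in>insert m T. sc (d' w) (exw w)) (trace_fun (trace G (concat (map rep w)))) [] \<noteq> 0"
    using exw_independent[of "insert m T" m d'] T(1,2) C(1)[OF mS(1)] mS(2) a(1)
    unfolding W_def d'_def by auto
  have wX: "w \<in> lists XA" "wtX w = eta k" using w(1) T(2) C mS unfolding W_def by auto
  \<comment> \<open>All words involved have weight \<open>eta k\<close>, so the detecting functional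
    belongs to \<open>Z\<close> and the relation must annihilate it.\<close>
  have "trace_fun (trace G (concat (map rep w))) \<in> Z"
    using wX wtX_rep[OF wX(1)] by (intro trace_fun_Z[OF _ trace_self _ k]) auto
  then have "app x (trace_fun (trace G (concat (map rep w)))) = (\<lambda>_. 0)"
    using kills_bkm_ideal sum unfolding ideal_def kills_def x_def by blast
  then show False using w(2) x by simp
qed

end

section \<open>The root space is spanned by brackets of the \<open>e\<^sub>i\<close>\<close>

context lie_relations
begin

lemma mem_span_ideal: "p - scl c q \<in> ideal \<Longrightarrow> p \<in> na.span (ideal \<union> {q})"
proof -
  assume "p - scl c q \<in> ideal"
  then have "(p - scl c q) + scl c q \<in> na.span (ideal \<union> {q})"
    by (intro na.span_add na.span_scale na.span_base) auto
  then show ?thesis by simp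
qed

lemma ideal_span: "ideal \<subseteq> na.span (ideal \<union> B)"
  using na.span_superset by blast

lemma foldl_br_span:
  "p \<in> na.span (ideal \<union> {q}) \<Longrightarrow> foldl br p ys \<in> na.span (ideal \<union> {foldl br q ys})"
proof (induction ys arbitrary: p q)
  case (Cons y ys)
  have "br p y \<in> na.span (ideal \<union> {br q y})"
    by (rule br_span_left_mem[OF Cons.prems na.subspace_span ideal_span]) (auto intro: na.span_base)
  then show ?case using Cons.IH by simp
qed simp

end

context bkm_data
begin

sublocale lie_relations "bkm_odd \<Psi>" "bkm_relations A \<Psi>" .

lemma relation_ideal: "r \<in> bkm_relations A \<Psi> \<Longrightarrow> r \<in> ideal"
  unfolding ideal_def by (rule two_sided_ideal.base) simp

text \<open>The comprehension is empty unless \<open>a = b\<close>. This and the following rules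
  forget the scalars in the relations, since only spans are needed.\<close>

lemma ef_span: "br (gen (Egen a)) (gen (Fgen b)) \<in> na.span (ideal \<union> {x. x = gen (Hgen a) \<and> a = b})"
proof -
  let ?h = "if a = b then gen (Hgen a) else 0"
  have "br (gen (Egen a)) (gen (Fgen b)) - ?h \<in> ideal"
    by (rule relation_ideal) (unfold bkm_relations_def Let_def, rule UnI1, rule UnI1, rule UnI1, rule UnI1, rule UnI1, rule UnI1, rule UnI1, rule UnI1, rule UnI2, blast)
  then have "(br (gen (Egen a)) (gen (Fgen b)) - ?h) + ?h \<in> na.span (ideal \<union> {x. x = gen (Hgen a) \<and> a = b})"
    by (intro na.span_add) (auto intro: na.span_base na.span_zero)
  then show ?thesis by simp
qed

lemma fe_span: "br (gen (Fgen a)) (gen (Egen b)) \<in> na.span (ideal \<union> {x. x = gen (Hgen a) \<and> a = b})"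
  by (rule br_skew_mem[OF na.subspace_span ideal_span homog_gen homog_gen])
    (rule na.span_mono[THEN subsetD, OF _ ef_span], auto)

lemma he_span: "br (gen (Hgen j)) (gen (Egen a)) \<in> na.span (ideal \<union> {gen (Egen a)})"
  by (rule mem_span_ideal[where c = "of_real (A j a)"], rule relation_ideal)
    (unfold bkm_relations_def Let_def, rule UnI1, rule UnI1, rule UnI1, rule UnI1, rule UnI1, rule UnI1, rule UnI1, rule UnI1, rule UnI1, rule UnI1, rule UnI2, blast)

lemma hf_span: "br (gen (Hgen j)) (gen (Fgen a)) \<in> na.span (ideal \<union> {gen (Fgen a)})"
proof (rule mem_span_ideal[where c = "- of_real (A j a)"])
  have "br (gen (Hgen j)) (gen (Fgen a)) + scl (of_real (A j a)) (gen (Fgen a)) \<in> ideal"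
    by (rule relation_ideal) (unfold bkm_relations_def Let_def, rule UnI1, rule UnI1, rule UnI1, rule UnI1, rule UnI1, rule UnI1, rule UnI1, rule UnI1, rule UnI1, rule UnI2, blast)
  then show "br (gen (Hgen j)) (gen (Fgen a)) - scl (- of_real (A j a)) (gen (Fgen a)) \<in> ideal" by simp
qed

lemma eh_span: "br (gen (Egen a)) (gen (Hgen j)) \<in> na.span (ideal \<union> {gen (Egen a)})"
  by (rule br_skew_mem[OF na.subspace_span ideal_span homog_gen homog_gen he_span])

lemma fh_span: "br (gen (Fgen a)) (gen (Hgen j)) \<in> na.span (ideal \<union> {gen (Fgen a)})"
  by (rule br_skew_mem[OF na.subspace_span ideal_span homog_gen homog_gen hf_span])

lemma hh_ideal: "br (gen (Hgen i)) (gen (Hgen j)) \<in> ideal"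
  by (rule relation_ideal) (unfold bkm_relations_def Let_def, (rule UnI1)+, blast)

lemma ee_ideal: "A a b = 0 \<Longrightarrow> br (gen (Egen a)) (gen (Egen b)) \<in> ideal"
  by (rule relation_ideal) (unfold bkm_relations_def Let_def, rule UnI1, rule UnI2, blast)

text \<open>Instantiated once with the e's and once with the f's, so that both halves of the
  triangular decomposition share their proofs.\<close>

definition half :: "('i \<Rightarrow> 'i bkm_gen) \<Rightarrow> ('i \<Rightarrow> ('i \<Rightarrow>\<^sub>0 int)) \<Rightarrow> ('i \<Rightarrow>\<^sub>0 int) \<Rightarrow> 'i bkm_gen na set" where
  "half u \<delta> \<gamma> = {foldl br (gen (u a)) (map (\<lambda>b. gen (u b)) w) |a w. \<delta> a + sum_list (map \<delta> w) = \<gamma>}"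

definition cartan :: "('i \<Rightarrow>\<^sub>0 int) \<Rightarrow> 'i bkm_gen na set" where
  "cartan \<gamma> = {gen (Hgen j) |j. \<gamma> = 0}"

lemma half_h:
  assumes "\<And>a. br (gen (u a)) (gen (Hgen j)) \<in> na.span (ideal \<union> {gen (u a)})"
  shows "br (foldl br (gen (u a)) (map (\<lambda>b. gen (u b)) w)) (gen (Hgen j))
    \<in> na.span (ideal \<union> {foldl br (gen (u a)) (map (\<lambda>b. gen (u b)) w)})"
proof (induction w rule: rev_induct)
  case Nil
  then show ?case using assms by simp
next
  case (snoc b w)
  let ?l = "foldl br (gen (u a)) (map (\<lambda>b. gen (u b)) w)"
  let ?S = "na.span (ideal \<union> {br ?l (gen (u b))})"
  have 1: "br ?l (br (gen (u b)) (gen (Hgen j))) \<in> ?S"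
    by (rule br_span_right_mem[OF assms na.subspace_span ideal_span]) (auto intro: na.span_base)
  have 2: "br (br ?l (gen (Hgen j))) (gen (u b)) \<in> ?S"
    by (rule br_span_left_mem[OF snoc na.subspace_span ideal_span]) (auto intro: na.span_base)
  show ?case
    using br_right_mem[OF na.subspace_span ideal_span homog_gen homog_gen 1 2] by simp
qed

lemma half_raise:
  assumes "\<And>a j. br (gen (Hgen j)) (gen (u a)) \<in> na.span (ideal \<union> {gen (u a)})"
    and "p \<in> na.span (ideal \<union> (half u \<delta> \<gamma> \<union> cartan \<gamma>))"
  shows "br p (gen (u c)) \<in> na.span (ideal \<union> half u \<delta> (\<gamma> + \<delta> c))"
proof (rule br_span_left_mem[OF assms(2) na.subspace_span ideal_span])
  fix b assume "b \<in> half u \<delta> \<gamma> \<union> cartan \<gamma>"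
  then show "br b (gen (u c)) \<in> na.span (ideal \<union> half u \<delta> (\<gamma> + \<delta> c))"
  proof
    assume "b \<in> half u \<delta> \<gamma>"
    then obtain a w where w: "b = foldl br (gen (u a)) (map (\<lambda>b. gen (u b)) w)"
      "\<delta> a + sum_list (map \<delta> w) = \<gamma>" unfolding half_def by blast
    have "br b (gen (u c)) = foldl br (gen (u a)) (map (\<lambda>b. gen (u b)) (w @ [c]))"
      "\<delta> a + sum_list (map \<delta> (w @ [c])) = \<gamma> + \<delta> c" using w by (auto simp: ac_simps)
    then have "br b (gen (u c)) \<in> half u \<delta> (\<gamma> + \<delta> c)" unfolding half_def by blast
    then show ?thesis by (simp add: na.span_base)
  next
    assume "b \<in> cartan \<gamma>"
    then obtain j where j: "b = gen (Hgen j)" "\<gamma> = 0" unfolding cartan_def by auto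
    have "gen (u c) = foldl br (gen (u c)) (map (\<lambda>b. gen (u b)) []) \<and>
      \<delta> c + sum_list (map \<delta> []) = \<gamma> + \<delta> c" using j by simp
    then have "{gen (u c)} \<subseteq> half u \<delta> (\<gamma> + \<delta> c)" unfolding half_def by blast
    then show ?thesis
      using assms(1)[of j c] na.span_mono[of "ideal \<union> {gen (u c)}" "ideal \<union> half u \<delta> (\<gamma> + \<delta> c)"] j(1) by blast
  qed
qed

text \<open>The opposite generator either meets the last letter, leaving a Cartan element that acts
  on the shorter word by a scalar, or moves past it, and the induction hypothesis applies.\<close>

lemma half_lower:
  assumes uv: "\<And>a b. br (gen (u a)) (gen (v b)) \<in> na.span (ideal \<union> {x. x = gen (Hgen a) \<and> a = b})"
    and uh: "\<And>a j. br (gen (u a)) (gen (Hgen j)) \<in> na.span (ideal \<union> {gen (u a)})"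
    and hu: "\<And>a j. br (gen (Hgen j)) (gen (u a)) \<in> na.span (ideal \<union> {gen (u a)})"
  shows "br (foldl br (gen (u a)) (map (\<lambda>b. gen (u b)) w)) (gen (v b))
    \<in> na.span (ideal \<union> (half u \<delta> (\<delta> a + sum_list (map \<delta> w) - \<delta> b) \<union> cartan (\<delta> a + sum_list (map \<delta> w) - \<delta> b)))"
proof (induction w rule: rev_induct)
  case Nil
  have "{x. x = gen (Hgen a) \<and> a = b} \<subseteq> cartan (\<delta> a - \<delta> b)" unfolding cartan_def by auto
  then have "na.span (ideal \<union> {x. x = gen (Hgen a) \<and> a = b})
    \<subseteq> na.span (ideal \<union> (half u \<delta> (\<delta> a - \<delta> b) \<union> cartan (\<delta> a - \<delta> b)))"
    by (intro na.span_mono) auto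
  then show ?case using uv[of a b] by auto
next
  case (snoc c w)
  let ?l = "foldl br (gen (u a)) (map (\<lambda>b. gen (u b)) w)"
  let ?g = "\<delta> a + sum_list (map \<delta> (w @ [c])) - \<delta> b"
  let ?S = "na.span (ideal \<union> (half u \<delta> ?g \<union> cartan ?g))"
  have 1: "br ?l (br (gen (u c)) (gen (v b))) \<in> ?S"
  proof (rule br_span_right_mem[OF uv na.subspace_span ideal_span])
    fix x assume "x \<in> {x. x = gen (Hgen c) \<and> c = b}"
    then have x: "x = gen (Hgen c)" "?g = \<delta> a + sum_list (map \<delta> w)" by auto
    have "?l \<in> half u \<delta> (\<delta> a + sum_list (map \<delta> w))" unfolding half_def by blast
    then have "{?l} \<subseteq> half u \<delta> ?g \<union> cartan ?g" unfolding x(2) by simp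
    then show "br ?l x \<in> ?S"
      using half_h[where u = u and a = a and w = w and j = c, OF uh] na.span_mono[of "ideal \<union> {?l}" "ideal \<union> (half u \<delta> ?g \<union> cartan ?g)"]
      unfolding x(1) by blast
  qed
  have g: "\<delta> a + sum_list (map \<delta> w) - \<delta> b + \<delta> c = ?g" by (simp add: algebra_simps)
  have "br (br ?l (gen (v b))) (gen (u c)) \<in> na.span (ideal \<union> half u \<delta> ?g)"
    using half_raise[OF hu snoc, of c] unfolding g .
  then have 2: "br (br ?l (gen (v b))) (gen (u c)) \<in> ?S"
    using na.span_mono[of "ideal \<union> half u \<delta> ?g" "ideal \<union> (half u \<delta> ?g \<union> cartan ?g)"] by blast
  show ?case using br_right_mem[OF na.subspace_span ideal_span homog_gen homog_gen 1 2] by simp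
qed

abbreviation "al j \<equiv> Poly_Mapping.single j (1 :: int)"

definition triangular :: "('i \<Rightarrow>\<^sub>0 int) \<Rightarrow> 'i bkm_gen na set" where
  "triangular \<gamma> = na.span (ideal \<union> (half Egen al \<gamma> \<union> half Fgen (\<lambda>j. - al j) \<gamma> \<union> cartan \<gamma>))"

lemma triangular_mono:
  "B \<subseteq> half Egen al \<gamma> \<union> half Fgen (\<lambda>j. - al j) \<gamma> \<union> cartan \<gamma> \<Longrightarrow> p \<in> na.span (ideal \<union> B) \<Longrightarrow> p \<in> triangular \<gamma>"
  unfolding triangular_def using na.span_mono[of "ideal \<union> B"] by blast

text \<open>Stability under right bracketing by every generator is what
  \<open>mon_left_normed_span\<close> needs to place all monomials in the sum of the three
  parts.\<close>

lemma triangular_closed: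
  assumes "p \<in> triangular \<gamma>"
  shows "br p (gen x) \<in> triangular (\<gamma> + bkm_deg x)"
  using assms unfolding triangular_def[of \<gamma>]
proof (rule br_span_left_mem)
  show "na.subspace (triangular (\<gamma> + bkm_deg x))" "ideal \<subseteq> triangular (\<gamma> + bkm_deg x)"
    unfolding triangular_def using ideal_span by auto
  fix b assume b: "b \<in> half Egen al \<gamma> \<union> half Fgen (\<lambda>j. - al j) \<gamma> \<union> cartan \<gamma>"
  show "br b (gen x) \<in> triangular (\<gamma> + bkm_deg x)"
  proof (cases x)
    case (Egen c)
    show ?thesis
    proof (cases "b \<in> half Fgen (\<lambda>j. - al j) \<gamma>")
      case True
      then obtain a w where w: "b = foldl br (gen (Fgen a)) (map (\<lambda>b. gen (Fgen b)) w)"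
        "- al a + sum_list (map (\<lambda>j. - al j) w) = \<gamma>" unfolding half_def by blast
      show ?thesis
        using half_lower[OF fe_span fh_span hf_span, of a w c "\<lambda>j. - al j"] unfolding w(2) w(1)[symmetric]
        by (intro triangular_mono[of "half Fgen (\<lambda>j. - al j) (\<gamma> + bkm_deg x) \<union> cartan (\<gamma> + bkm_deg x)"]) (auto simp: Egen)
    next
      case False
      then have "b \<in> na.span (ideal \<union> (half Egen al \<gamma> \<union> cartan \<gamma>))" using b by (auto intro: na.span_base)
      from half_raise[OF he_span this, of c] show ?thesis
        by (intro triangular_mono[of "half Egen al (\<gamma> + bkm_deg x)"]) (auto simp: Egen)
    qed
  next
    case (Fgen c)
    show ?thesis
    proof (cases "b \<in> half Egen al \<gamma>")
      case True
      then obtain a w where w: "b = foldl br (gen (Egen a)) (map (\<lambda>b. gen (Egen b)) w)"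
        "al a + sum_list (map al w) = \<gamma>" unfolding half_def by blast
      show ?thesis
        using half_lower[OF ef_span eh_span he_span, of a w c al] unfolding w(2) w(1)[symmetric]
        by (intro triangular_mono[of "half Egen al (\<gamma> + bkm_deg x) \<union> cartan (\<gamma> + bkm_deg x)"]) (auto simp: Fgen)
    next
      case False
      then have "b \<in> na.span (ideal \<union> (half Fgen (\<lambda>j. - al j) \<gamma> \<union> cartan \<gamma>))" using b by (auto intro: na.span_base)
      from half_raise[OF hf_span this, of c] show ?thesis
        by (intro triangular_mono[of "half Fgen (\<lambda>j. - al j) (\<gamma> + bkm_deg x)"]) (auto simp: Fgen)
    qed
  next
    case (Hgen j)
    from b consider "b \<in> half Egen al \<gamma>" | "b \<in> half Fgen (\<lambda>j. - al j) \<gamma>" | "b \<in> cartan \<gamma>" by blast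
    then show ?thesis
    proof cases
      case 1
      then obtain a w where w: "b = foldl br (gen (Egen a)) (map (\<lambda>b. gen (Egen b)) w)"
        unfolding half_def by blast
      have "br b (gen (Hgen j)) \<in> na.span (ideal \<union> {b})" unfolding w by (rule half_h[OF eh_span])
      then show ?thesis using 1 by (intro triangular_mono[of "{b}"]) (auto simp: Hgen)
    next
      case 2
      then obtain a w where w: "b = foldl br (gen (Fgen a)) (map (\<lambda>b. gen (Fgen b)) w)"
        unfolding half_def by blast
      have "br b (gen (Hgen j)) \<in> na.span (ideal \<union> {b})" unfolding w by (rule half_h[OF fh_span])
      then show ?thesis using 2 by (intro triangular_mono[of "{b}"]) (auto simp: Hgen)
    next
      case 3
      then obtain l where "b = gen (Hgen l)" unfolding cartan_def by blast
      then have "br b (gen (Hgen j)) \<in> ideal" using hh_ideal by simp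
      then show ?thesis using Hgen ideal_span unfolding triangular_def by blast
    qed
  qed
qed

lemma mon_triangular: "mon t \<in> triangular (magma_deg bkm_deg t)"
proof -
  have start: "gen x \<in> triangular (bkm_deg x)" for x
  proof (cases x)
    case (Egen a)
    have "gen x = foldl br (gen (Egen a)) (map (\<lambda>b. gen (Egen b)) []) \<and> al a + sum_list (map al []) = bkm_deg x"
      by (simp add: Egen)
    then have "gen x \<in> half Egen al (bkm_deg x)" unfolding half_def by blast
    then show ?thesis by (intro triangular_mono[of "{gen x}"]) (auto intro: na.span_base)
  next
    case (Fgen a)
    have "gen x = foldl br (gen (Fgen a)) (map (\<lambda>b. gen (Fgen b)) []) \<and>
      - al a + sum_list (map (\<lambda>j. - al j) []) = bkm_deg x"
      by (simp add: Fgen)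
    then have "gen x \<in> half Fgen (\<lambda>j. - al j) (bkm_deg x)" unfolding half_def by blast
    then show ?thesis by (intro triangular_mono[of "{gen x}"]) (auto intro: na.span_base)
  next
    case (Hgen j)
    then have "gen x \<in> cartan (bkm_deg x)" unfolding cartan_def by auto
    then show ?thesis by (intro triangular_mono[of "{gen x}"]) (auto intro: na.span_base)
  qed
  have ln: "foldl br (gen x) (map gen xs) \<in> triangular (bkm_deg x + sum_list (map bkm_deg xs))" for x xs
  proof (induction xs rule: rev_induct)
    case Nil
    then show ?case using start by simp
  next
    case (snoc y ys)
    from triangular_closed[OF this, of y] show ?case by (simp add: add.assoc)
  qed
  let ?B = "{foldl br (gen x) (map gen xs) |x xs. bkm_deg x + sum_list (map bkm_deg xs) = magma_deg bkm_deg t}"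
  have "ideal \<union> ?B \<subseteq> triangular (magma_deg bkm_deg t)"
  proof (rule Un_least)
    show "ideal \<subseteq> triangular (magma_deg bkm_deg t)" unfolding triangular_def by (rule ideal_span)
    show "?B \<subseteq> triangular (magma_deg bkm_deg t)"
    proof
      fix z assume "z \<in> ?B"
      then obtain x xs where "z = foldl br (gen x) (map gen xs)"
        "bkm_deg x + sum_list (map bkm_deg xs) = magma_deg bkm_deg t" by blast
      then show "z \<in> triangular (magma_deg bkm_deg t)" using ln[of x xs] by simp
    qed
  qed
  then have "na.span (ideal \<union> ?B) \<subseteq> triangular (magma_deg bkm_deg t)"
    by (rule na.span_minimal) (simp add: triangular_def)
  then show ?thesis using mon_left_normed_span[where d = bkm_deg] by blast
qed

text \<open>A positive coordinate of \<gamma> excludes the Cartan part, which has degree 0, and the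
  f-words, whose degrees have no positive coordinate.\<close>

lemma mon_e_span:
  assumes "magma_deg bkm_deg t = \<gamma>" "0 < Poly_Mapping.lookup \<gamma> i"
  shows "mon t \<in> na.span (ideal \<union> {lnw w |w. wtl w = \<gamma>})"
proof -
  have "cartan \<gamma> = {}" using assms(2) unfolding cartan_def by auto
  moreover have "half Fgen (\<lambda>j. - al j) \<gamma> = {}"
  proof -
    have "- al a + sum_list (map (\<lambda>j. - al j) w) \<noteq> \<gamma>" for a w
    proof -
      have "sum_list (map (\<lambda>j. - al j) w) = - wtl w" unfolding wtl_def by (induction w) auto
      then have "Poly_Mapping.lookup (- al a + sum_list (map (\<lambda>j. - al j) w)) i \<le> 0"
        by (simp add: lookup_add lookup_minus lookup_uminus lookup_wtl lookup_single when_def)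
      then show ?thesis using assms(2) by auto
    qed
    then show ?thesis unfolding half_def by blast
  qed
  moreover have "half Egen al \<gamma> \<subseteq> {lnw w |w. wtl w = \<gamma>}"
  proof
    fix p assume "p \<in> half Egen al \<gamma>"
    then obtain a w where w: "p = foldl br (gen (Egen a)) (map (\<lambda>b. gen (Egen b)) w)"
      "al a + sum_list (map al w) = \<gamma>" unfolding half_def by blast
    then have "p = lnw (a # w)" "wtl (a # w) = \<gamma>" by (simp_all add: wtl_def)
    then show "p \<in> {lnw w |w. wtl w = \<gamma>}" by blast
  qed
  ultimately have "triangular \<gamma> \<subseteq> na.span (ideal \<union> {lnw w |w. wtl w = \<gamma>})"
    unfolding triangular_def by (intro na.span_mono) auto
  then show ?thesis using mon_triangular[of t] assms(1) by auto
qed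

end

section \<open>Elimination of all letters but \<open>i\<close>\<close>

context bkm_words
begin

text \<open>The subalgebra generated by the e(x), sorted by weight. Its stability under all letters
  is Lazard elimination of the letters other than \<open>i\<close>.\<close>

definition XN :: "('i \<Rightarrow>\<^sub>0 int) \<Rightarrow> 'i bkm_gen na set" where
  "XN \<gamma> = na.span (ideal \<union> {foldl br (ex x) (map (\<lambda>x. ex x) xs) |x xs. x # xs \<in> lists XA \<and> wtX (x # xs) = \<gamma>})"

lemma XN_subspace: "na.subspace (XN \<gamma>)"
  unfolding XN_def by (rule na.subspace_span)

lemma ideal_XN: "ideal \<subseteq> XN \<gamma>"
  unfolding XN_def by (rule ideal_span)

lemma XN_word: "x # xs \<in> lists XA \<Longrightarrow> wtX (x # xs) = \<gamma> \<Longrightarrow> foldl br (ex x) (map (\<lambda>x. ex x) xs) \<in> XN \<gamma>"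
  unfolding XN_def by (rule na.span_base) blast

lemma homog_ex: "x \<in> XA \<Longrightarrow> homog (bkm_odd \<Psi>) (trace_odd \<Psi> x) (ex x)"
  by (rule homog_E)

text \<open>Every word of the trace starts with its only \<open>i\<close>, so a swap of distinct
  letters never touches the first position. There [[x,b],a] and [[x,a],b] agree up to sign, because
  [x,[b,a]] lies in the ideal.\<close>

lemma lnw_pyramid:
  assumes "z = i # s" "i \<notin> set s" "sel G {i} s = s" "v \<in> trace G z"
  shows "lnw v \<in> na.span (ideal \<union> {lnw z})"
  using assms(4)
proof (induction rule: trace_induct)
  case refl
  show ?case by (simp add: na.span_base)
next
  case (swap x a b y)
  let ?v = "x @ a # b # y" and ?w = "x @ b # a # y"
  have ab: "\<not> G a b" using swap.hyps(2) sym_G[of a b] by auto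
  have "?w \<in> trace G z" using swap(1) trace_swap[of G a b, OF ab, of x y]
    by (simp flip: trace_eq_iff)
  then obtain s1 where s1: "?w = i # s1" "i \<notin> set s1"
    using pyramid_representative assms(1-3) by metis
  obtain s2 where s2: "?v = i # s2" "i \<notin> set s2"
    using pyramid_representative assms(1-3) swap(1) by metis
  have "x \<noteq> []" using s1 s2 by auto
  have "lnw (x @ [b, a]) \<in> na.span (ideal \<union> {lnw (x @ [a, b])})"
  proof (cases "a = b")
    case True
    then show ?thesis by (simp add: na.span_base)
  next
    case False
    then have "A b a = 0" using ab A_zero_iff unfolding quasi_dynkin_def by blast
    then have "br (lnw x) (br (gen (Egen b)) (gen (Egen a))) \<in> ideal"
      using ee_ideal ideal_br_left by simp
    then have 1: "br (lnw x) (br (gen (Egen b)) (gen (Egen a))) \<in> na.span (ideal \<union> {lnw (x @ [a, b])})"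
      using ideal_span by blast
    have "lnw (x @ [a, b]) = br (br (lnw x) (gen (Egen a))) (gen (Egen b))"
      using lnw_snoc[of "x @ [a]" b] lnw_snoc[of x a] \<open>x \<noteq> []\<close> by simp
    then have 2: "br (br (lnw x) (gen (Egen a))) (gen (Egen b)) \<in> na.span (ideal \<union> {lnw (x @ [a, b])})"
      by (simp add: na.span_base)
    have "lnw (x @ [b, a]) = br (br (lnw x) (gen (Egen b))) (gen (Egen a))"
      using lnw_snoc[of "x @ [b]" a] lnw_snoc[of x b] \<open>x \<noteq> []\<close> by simp
    then show ?thesis
      using br_right_mem[OF na.subspace_span ideal_span homog_gen homog_gen 1 2] by simp
  qed
  then have "foldl br (lnw (x @ [b, a])) (map (\<lambda>b. gen (Egen b)) y)
      \<in> na.span (ideal \<union> {foldl br (lnw (x @ [a, b])) (map (\<lambda>b. gen (Egen b)) y)})"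
    by (rule foldl_br_span)
  moreover have "foldl br (lnw (x @ [c, d])) (map (\<lambda>b. gen (Egen b)) y) = lnw (x @ c # d # y)" for c d
    using \<open>x \<noteq> []\<close> by (cases x) auto
  ultimately have "lnw ?w \<in> na.span (ideal \<union> {lnw ?v})" by simp
  moreover have "na.span (ideal \<union> {lnw ?v}) \<subseteq> na.span (ideal \<union> {lnw z})"
    by (rule na.span_minimal[OF _ na.subspace_span], rule Un_least[OF ideal_span]) (use swap.IH in simp)
  ultimately show ?case by blast
qed

lemma lnw_commuting:
  "\<forall>b\<in>set w. A b a = 0 \<Longrightarrow> br (lnw w) (gen (Egen a)) \<in> ideal"
proof (induction w rule: rev_induct)
  case Nil
  then show ?case using na.subspace_0[OF ideal_subspace] by simp
next
  case (snoc b w)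
  show ?case
  proof (cases "w = []")
    case True
    then show ?thesis using snoc ee_ideal by simp
  next
    case False
    have 1: "br (lnw w) (br (gen (Egen b)) (gen (Egen a))) \<in> ideal"
      using ee_ideal snoc.prems ideal_br_left by simp
    have 2: "br (br (lnw w) (gen (Egen a))) (gen (Egen b)) \<in> ideal"
      using snoc ideal_br_right by simp
    show ?thesis
      using br_right_mem[OF ideal_subspace order.refl homog_gen homog_gen 1 2] False by (simp add: lnw_snoc)
  qed
qed

text \<open>Either \<open>a\<close> commutes with all letters of \<open>y\<close> and the bracket
  vanishes, or appending \<open>a\<close> gives a trace in the alphabet again; passing to its chosen
  representative costs only a scalar modulo the ideal.\<close>

lemma ex_append_letter:
  assumes y: "y \<in> XA" and a: "a \<noteq> i"
  shows "br (ex y) (gen (Egen a)) \<in> na.span (ideal \<union> {ex z |z. z \<in> XA \<and> wt z = wt y + al a})"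
proof -
  obtain s where s: "rep y = i # s" "i \<notin> set s" "sel G {i} s = s" by (rule rep_form[OF y])
  show ?thesis
  proof (cases "dep G ({i} \<union> set s) a")
    case False
    then have "\<forall>b\<in>set (rep y). A b a = 0" using s(1) unfolding dep_def quasi_dynkin_def by auto
    then show ?thesis using lnw_commuting ideal_span by blast
  next
    case True
    define z where "z = trace G (i # s @ [a])"
    have sa: "i \<notin> set (s @ [a])" "sel G {i} (s @ [a]) = s @ [a]"
      using s a sel_append_one[OF s(3), of a] True by auto
    then have z: "z \<in> XA" unfolding z_def using X_alph_I[of "s @ [a]"] by simp
    obtain s' where s': "rep z = i # s'" "i \<notin> set s'" "sel G {i} s' = s'" by (rule rep_form[OF z])
    have "i # s @ [a] \<in> trace G (rep z)"
      using rep_XA[OF z] unfolding z_def by (simp flip: trace_eq_iff)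
    then have "lnw (i # s @ [a]) \<in> na.span (ideal \<union> {ex z})" by (rule lnw_pyramid[OF s'])
    moreover have "lnw (i # s @ [a]) = br (ex y) (gen (Egen a))"
      using lnw_snoc[of "i # s" a] s(1) by simp
    moreover have "wt z = wt y + al a"
      using wt_trace[of z G "i # s @ [a]"] wt_rep[OF y] s(1) unfolding z_def by (simp add: wtl_def ac_simps)
    then have "na.span (ideal \<union> {ex z}) \<subseteq> na.span (ideal \<union> {ex z |z. z \<in> XA \<and> wt z = wt y + al a})"
      using z by (intro na.span_mono) auto
    ultimately show ?thesis by auto
  qed
qed

lemma i_alph: "trace G [i] \<in> XA" "ex (trace G [i]) = gen (Egen i)" "wt (trace G [i]) = al i"
proof -
  show X: "trace G [i] \<in> XA" using X_alph_I[of "[]"] by simp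
  have "mset (rep (trace G [i])) = mset [i]" using trace_mset rep_XA[OF X] by blast
  then have "rep (trace G [i]) = [i]" by (metis mset_single_iff_right mset.simps)
  then show "ex (trace G [i]) = gen (Egen i)" by simp
  show "wt (trace G [i]) = al i" using wt_trace[of "trace G [i]" G "[i]"] by (simp add: wtl_def)
qed

lemma XN_closed_ex:
  assumes "p \<in> XN \<gamma>" "y \<in> XA"
  shows "br p (ex y) \<in> XN (\<gamma> + wt y)"
  using assms(1) unfolding XN_def[of \<gamma>]
proof (rule br_span_left_mem[OF _ XN_subspace ideal_XN])
  fix b assume "b \<in> {foldl br (ex x) (map (\<lambda>x. ex x) xs) |x xs. x # xs \<in> lists XA \<and> wtX (x # xs) = \<gamma>}"
  then obtain x xs where b: "b = foldl br (ex x) (map (\<lambda>x. ex x) xs)" "x # xs \<in> lists XA" "wtX (x # xs) = \<gamma>"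
    by blast
  have "foldl br (ex x) (map (\<lambda>x. ex x) (xs @ [y])) \<in> XN (\<gamma> + wt y)"
    by (rule XN_word) (use b assms(2) in \<open>auto simp: wtX_def ac_simps\<close>)
  then show "br b (ex y) \<in> XN (\<gamma> + wt y)" using b(1) by simp
qed

text \<open>Bracketing with a letter is a derivation, which for \<open>a \<noteq> i\<close> reduces
  the claim to single factors and \<open>ex_append_letter\<close>; the letter \<open>i\<close>
  itself belongs to the alphabet.\<close>

lemma XN_closed_letter:
  assumes "p \<in> XN \<gamma>"
  shows "br p (gen (Egen a)) \<in> XN (\<gamma> + al a)"
proof (cases "a = i")
  case True
  then show ?thesis using XN_closed_ex[OF assms i_alph(1)] i_alph by simp
next
  case False
  have "br (foldl br (ex x) (map (\<lambda>x. ex x) xs)) (gen (Egen a)) \<in> XN (wtX (x # xs) + al a)"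
    if "x # xs \<in> lists XA" for x xs
    using that
  proof (induction xs rule: rev_induct)
    case Nil
    then have x: "x \<in> XA" by simp
    have "na.span (ideal \<union> {ex z |z. z \<in> XA \<and> wt z = wt x + al a}) \<subseteq> XN (wtX [x] + al a)"
    proof (rule na.span_minimal[OF _ XN_subspace], rule Un_least[OF ideal_XN], rule subsetI)
      fix p assume "p \<in> {ex z |z. z \<in> XA \<and> wt z = wt x + al a}"
      then obtain z where "p = ex z" "z \<in> XA" "wt z = wt x + al a" by blast
      then show "p \<in> XN (wtX [x] + al a)" using XN_word[of z "[]"] by (simp add: wtX_def)
    qed
    then show ?case using ex_append_letter[OF x False] by auto
  next
    case (snoc y ys)
    let ?l = "foldl br (ex x) (map (\<lambda>x. ex x) ys)"
    let ?g = "wtX (x # ys @ [y]) + al a"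
    have y: "y \<in> XA" "x # ys \<in> lists XA" using snoc.prems by auto
    have l: "?l \<in> XN (wtX (x # ys))" using XN_word y(2) by blast
    have 1: "br ?l (br (ex y) (gen (Egen a))) \<in> XN ?g"
    proof (rule br_span_right_mem[OF ex_append_letter[OF y(1) False] XN_subspace ideal_XN])
      fix b assume "b \<in> {ex z |z. z \<in> XA \<and> wt z = wt y + al a}"
      then obtain z where z: "b = ex z" "z \<in> XA" "wt z = wt y + al a" by blast
      have "wtX (x # ys) + wt z = ?g" using z(3) by (simp add: wtX_def ac_simps)
      then show "br ?l b \<in> XN ?g" using XN_closed_ex[OF l z(2)] z(1) by simp
    qed
    have g: "wtX (x # ys) + al a + wt y = ?g" by (simp add: wtX_def ac_simps)
    have 2: "br (br ?l (gen (Egen a))) (ex y) \<in> XN ?g"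
      using XN_closed_ex[OF snoc.IH[OF y(2)] y(1)] unfolding g .
    show ?case
      using br_right_mem[OF XN_subspace ideal_XN homog_ex[OF y(1)] homog_gen 1 2] by simp
  qed
  note * = this
  show ?thesis
  proof (rule br_span_left_mem[OF assms[unfolded XN_def] XN_subspace ideal_XN])
    fix b assume "b \<in> {foldl br (ex x) (map (\<lambda>x. ex x) xs) |x xs. x # xs \<in> lists XA \<and> wtX (x # xs) = \<gamma>}"
    then obtain x xs where "b = foldl br (ex x) (map (\<lambda>x. ex x) xs)" "x # xs \<in> lists XA" "wtX (x # xs) = \<gamma>"
      by blast
    then show "br b (gen (Egen a)) \<in> XN (\<gamma> + al a)" using *[of x xs] by simp
  qed
qed

text \<open>Induction on the last letter. If \<open>i\<close> occurs only there, the bracket is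
  turned around to start from \<open>Egen i\<close>, and \<open>br_foldl_mem\<close> brings in the
  other letters.\<close>

lemma lnw_XN: "i \<in> set w \<Longrightarrow> lnw w \<in> XN (wtl w)"
proof (induction w rule: rev_induct)
  case (snoc a w)
  have wt_eq: "wtl (w @ [a]) = wtl w + al a" by (simp add: wtl_def)
  have i: "gen (Egen i) \<in> XN (al i)"
    using XN_word[of "trace G [i]" "[]"] i_alph by (simp add: wtX_def)
  show ?case
  proof (cases "i \<in> set w")
    case True
    then have "w \<noteq> []" by auto
    then show ?thesis using XN_closed_letter[OF snoc.IH[OF True], of a] wt_eq by (simp add: lnw_snoc)
  next
    case False
    then have a: "a = i" using snoc.prems by auto
    have hE: "\<exists>b. homog (bkm_odd \<Psi>) b (gen (Egen j))" for j using homog_EFH(1) by blast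
    show ?thesis
    proof (cases w)
      case Nil
      then show ?thesis using i a by (simp add: wtl_def)
    next
      case (Cons b u)
      have "br (gen (Egen i)) (foldl br (gen (Egen b)) (map (\<lambda>b. gen (Egen b)) u))
          \<in> XN (al i + al b + sum_list (map al u))"
        by (rule br_foldl_mem[where Y = UNIV and S = XN and d = al and u = "\<lambda>b. gen (Egen b)"])
          (use XN_subspace ideal_XN XN_closed_letter i hE in auto)
      also have "al i + al b + sum_list (map al u) = wtl (w @ [a])"
        by (simp add: wtl_def Cons a ac_simps)
      finally have "br (gen (Egen i)) (lnw w) \<in> XN (wtl (w @ [a]))" by (simp add: Cons)
      then have "br (lnw w) (gen (Egen i)) \<in> XN (wtl (w @ [a]))"
        by (rule br_skew_mem[OF XN_subspace ideal_XN homog_lnw homog_gen])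
      then show ?thesis using Cons a lnw_snoc[of w a] by (simp del: lnw.simps)
    qed
  qed
qed simp

theorem root_space_span:
  assumes p: "\<forall>t\<in>Poly_Mapping.keys p. magma_deg bkm_deg t = eta k" and k: "0 < Poly_Mapping.lookup k i"
  shows "p \<in> na.span (ideal \<union> P ` C_set G \<Psi> i k)"
proof -
  let ?S = "na.span (ideal \<union> P ` C_set G \<Psi> i k)"
  have XN: "XN (eta k) \<subseteq> ?S"
    unfolding XN_def
  proof (rule na.span_minimal[OF _ na.subspace_span], rule Un_least[OF ideal_span], rule subsetI)
    fix q assume "q \<in> {foldl br (ex x) (map (\<lambda>x. ex x) xs) |x xs. x # xs \<in> lists XA \<and> wtX (x # xs) = eta k}"
    then obtain x xs where q: "q = foldl br (ex x) (map (\<lambda>x. ex x) xs)" "x # xs \<in> lists XA" "wtX (x # xs) = eta k"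
      by blast
    have "{P w |w. w \<in> lists XA \<and> super_lyndon trace_less (trace_odd \<Psi>) w \<and> mset w = mset (x # xs)}
        \<subseteq> P ` C_set G \<Psi> i k"
    proof
      fix z assume "z \<in> {P w |w. w \<in> lists XA \<and> super_lyndon trace_less (trace_odd \<Psi>) w \<and> mset w = mset (x # xs)}"
      then obtain w where w: "z = P w" "w \<in> lists XA" "super_lyndon trace_less (trace_odd \<Psi>) w"
        "mset w = mset (x # xs)" by blast
      have "wtX w = eta k" using wtX_mset[OF w(4)] q(3) by simp
      then show "z \<in> P ` C_set G \<Psi> i k" using w(1-3) unfolding C_set_def wtX_def by blast
    qed
    then show "q \<in> ?S"
      using left_normed_in_super_lyndon_span[OF q(2)] na.span_mono[of _ "ideal \<union> P ` C_set G \<Psi> i k"]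
      unfolding q(1) by (meson Un_mono order.refl subsetD)
  qed
  have "mon t \<in> ?S" if t: "t \<in> Poly_Mapping.keys p" for t
  proof -
    have pos: "0 < Poly_Mapping.lookup (eta k) i" using k by (simp add: lookup_eta)
    have "na.span (ideal \<union> {lnw w |w. wtl w = eta k}) \<subseteq> XN (eta k)"
    proof (rule na.span_minimal[OF _ XN_subspace], rule Un_least[OF ideal_XN], rule subsetI)
      fix q assume "q \<in> {lnw w |w. wtl w = eta k}"
      then obtain w where w: "q = lnw w" "wtl w = eta k" by blast
      then have "count_list w i \<noteq> 0" using pos lookup_wtl[of w i] by auto
      then have "i \<in> set w" using count_list_0_iff by metis
      then show "q \<in> XN (eta k)" using lnw_XN[of w] w by simp
    qed
    then show ?thesis using mon_e_span[of t "eta k" i] p t pos XN by blast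
  qed
  then have "mon ` Poly_Mapping.keys p \<subseteq> ?S" by blast
  then have "na.span (mon ` Poly_Mapping.keys p) \<subseteq> ?S"
    by (rule na.span_minimal) (rule na.subspace_span)
  then show ?thesis using na_span_mon by blast
qed

end

section \<open>The basis theorem\<close>

definition deg_homog :: "('x \<Rightarrow> 'q::plus) \<Rightarrow> 'q \<Rightarrow> 'x na \<Rightarrow> bool" where
  "deg_homog d \<gamma> p \<longleftrightarrow> (\<forall>t\<in>Poly_Mapping.keys p. magma_deg d t = \<gamma>)"

lemma deg_homog_br: "deg_homog d \<gamma> p \<Longrightarrow> deg_homog d \<delta> q \<Longrightarrow> deg_homog d (\<gamma> + \<delta>) (br p q)"
  using keys_br[of p q] unfolding deg_homog_def by fastforce

lemma deg_homog_subspace: "na.subspace {p. deg_homog d \<gamma> p}"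
  unfolding na.subspace_def deg_homog_def
  using Poly_Mapping.keys_add keys_scl by (fastforce dest: subsetD)

lemma deg_homog_lnw: "deg_homog bkm_deg (wtl w) (lnw w)"
proof (induction w rule: rev_induct)
  case Nil
  then show ?case by (simp add: deg_homog_def)
next
  case (snoc a w)
  have a: "deg_homog bkm_deg (Poly_Mapping.single a 1) (gen (Egen a))" by (simp add: deg_homog_def)
  show ?case
  proof (cases "w = []")
    case True
    then show ?thesis using a by (simp add: wtl_def)
  next
    case False
    then show ?thesis using deg_homog_br[OF snoc a] by (simp add: lnw_snoc wtl_def)
  qed
qed

context bkm_words
begin

lemma deg_homog_P: "w \<in> lists XA \<Longrightarrow> deg_homog bkm_deg (wtX w) (P w)"
proof (induction w rule: length_induct)
  case (1 w)
  show ?case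
  proof (cases "length w = 1")
    case True
    then obtain x where x: "w = [x]" by (auto simp: length_Suc_conv)
    then have "wtX w = wtl (rep x)" using 1(2) by (simp add: wtX_def wt_rep)
    then show ?thesis using deg_homog_lnw[of "rep x"] x by simp
  next
    case False
    let ?n = "std_split trace_less w"
    show ?thesis
    proof (cases "0 < ?n \<and> ?n < length w")
      case True
      have "deg_homog bkm_deg (wtX (take ?n w)) (P (take ?n w))" "deg_homog bkm_deg (wtX (drop ?n w)) (P (drop ?n w))"
        using 1(1)[rule_format, of "take ?n w"] 1(1)[rule_format, of "drop ?n w"]
          True[THEN conjunct1] True[THEN conjunct2] 1(2) set_take_subset[of ?n w] set_drop_subset[of ?n w]
        by (simp_all add: in_lists_conv_set subset_iff)
      note * = deg_homog_br[OF this]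
      have "wtX w = wtX (take ?n w @ drop ?n w)" by simp
      also have "\<dots> = wtX (take ?n w) + wtX (drop ?n w)" unfolding wtX_def by (simp only: map_append sum_list_append)
      finally show ?thesis using * False True by (subst lyndon_poly.simps) simp
    next
      case no: False
      then show ?thesis using False by (subst lyndon_poly.simps) (auto simp: deg_homog_def)
    qed
  qed
qed

lemma bkm_L: "bkm A \<Psi> = L"
  unfolding bkm_def ..

lemma left_normed_cls: "left_normed A \<Psi> w = cls (lnw w)"
proof (cases w)
  case Nil
  then show ?thesis by (simp add: bkm_L zero_L)
next
  case (Cons a u)
  have "foldl (\<lambda>x b. x \<otimes>\<^bsub>L\<^esub> bkm_e A \<Psi> b) (cls p) u = cls (foldl br p (map (\<lambda>b. gen (Egen b)) u))" for p
    by (induction u arbitrary: p) (simp_all add: bkm_e_def mult_cls)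
  then show ?thesis by (simp add: Cons bkm_L bkm_e_def)
qed

lemma root_space_cls: "root_space A \<Psi> \<gamma> = cls ` {p. deg_homog bkm_deg \<gamma> p}"
  unfolding root_space_def lie_component_def deg_homog_def by simp

text \<open>The recursion along the standard factorization carries a representative in the free
  algebra, so that products of cosets can be computed on both sides.\<close>

lemma hom_lyndon_bracket:
  assumes \<Phi>: "\<Phi> \<in> superalgebra_hom (fls XA (trace_odd \<Psi>)) (bkm A \<Psi>)"
    and gens: "\<And>x. x \<in> XA \<Longrightarrow> \<Phi> (fls_gen XA (trace_odd \<Psi>) x) = cls (ex x)"
    and w: "w \<in> lists XA"
  shows "\<Phi> (lyndon_bracket XA trace_less (trace_odd \<Psi>) w) = cls (P w)"
proof -
  interpret fl: presented_lie XA "trace_odd \<Psi>" "{}" by unfold_locales simp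
  let ?b = "lyndon_bracket XA trace_less (trace_odd \<Psi>)"
  have fls: "fls XA (trace_odd \<Psi>) = fl.L" unfolding fls_def ..
  note hom = \<Phi>[unfolded superalgebra_hom_def fls bkm_L mem_Collect_eq]
  have "\<forall>x\<in>carrier fl.L. \<forall>y\<in>carrier fl.L. \<Phi> (x \<otimes>\<^bsub>fl.L\<^esub> y) = \<Phi> x \<otimes>\<^bsub>L\<^esub> \<Phi> y"
    using hom by (elim conjE)
  then have mult: "\<Phi> (x \<otimes>\<^bsub>fl.L\<^esub> y) = \<Phi> x \<otimes>\<^bsub>L\<^esub> \<Phi> y" if "x \<in> carrier fl.L" "y \<in> carrier fl.L" for x y
    using that by simp
  have "\<forall>c. \<forall>x\<in>carrier fl.L. \<Phi> (c \<odot>\<^bsub>fl.L\<^esub> x) = c \<odot>\<^bsub>L\<^esub> \<Phi> x"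
    using hom by (elim conjE)
  then have smult: "\<Phi> (c \<odot>\<^bsub>fl.L\<^esub> x) = c \<odot>\<^bsub>L\<^esub> \<Phi> x" if "x \<in> carrier fl.L" for x c
    using that by simp
  have carrier: "\<Phi> x \<in> carrier L" if "x \<in> carrier fl.L" for x
    using hom that by (elim conjE) (rule funcset_mem)
  have "\<exists>p\<in>fna XA. ?b w = fl.cls p \<and> \<Phi> (fl.cls p) = cls (P w)"
    using w
  proof (induction w rule: length_induct)
    case (1 w)
    show ?case
    proof (cases "length w = 1")
      case True
      then obtain x where x: "w = [x]" by (auto simp: length_Suc_conv)
      then have "x \<in> XA" using 1(2) by simp
      then show ?thesis using gens[of x] x
        by (intro bexI[of _ "gen x"]) (simp_all add: lyndon_bracket.simps fls_gen_def fna_gen)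
    next
      case False
      let ?n = "std_split trace_less w"
      show ?thesis
      proof (cases "0 < ?n \<and> ?n < length w")
        case True
        let ?u = "take ?n w" and ?v = "drop ?n w"
        have X: "?u \<in> lists XA" "?v \<in> lists XA"
          using 1(2) set_take_subset[of ?n w] set_drop_subset[of ?n w]
          by (simp_all add: in_lists_conv_set subset_iff)
        have len: "length ?u < length w" "length ?v < length w" using True by auto
        obtain p where p: "p \<in> fna XA" "?b ?u = fl.cls p" "\<Phi> (fl.cls p) = cls (P ?u)"
          using 1(1)[rule_format, OF len(1) X(1)] by blast
        obtain q where q: "q \<in> fna XA" "?b ?v = fl.cls q" "\<Phi> (fl.cls q) = cls (P ?v)"
          using 1(1)[rule_format, OF len(2) X(2)] by blast
        have "?b w = fl.cls (br p q)"
          using False True p q by (subst lyndon_bracket.simps) (simp add: fls fl.mult_cls)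
        moreover have "\<Phi> (fl.cls (br p q)) = cls (P w)"
        proof -
          have "\<Phi> (fl.cls (br p q)) = \<Phi> (fl.cls p) \<otimes>\<^bsub>L\<^esub> \<Phi> (fl.cls q)"
            using mult p q by (simp add: fl.carrier_L flip: fl.mult_cls)
          also have "\<dots> = cls (br (P ?u) (P ?v))" using p q by (simp add: mult_cls)
          also have "br (P ?u) (P ?v) = P w"
            using False True by (subst (3) lyndon_poly.simps) simp
          finally show ?thesis .
        qed
        ultimately show ?thesis using p q fna_br by blast
      next
        case no: False
        \<comment> \<open>Preservation of zero is not a clause of \<open>superalgebra_hom\<close>;
          it follows from compatibility with the scalar 0.\<close>
        have 0: "fl.cls 0 = 0 \<odot>\<^bsub>fl.L\<^esub> fl.cls 0" by (simp add: fl.smult_cls)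
        have c0: "fl.cls 0 \<in> carrier fl.L" by (simp add: fl.carrier_L)
        obtain q where q: "\<Phi> (fl.cls 0) = cls q" using carrier[OF c0] by (auto simp: carrier_L)
        have "\<Phi> (fl.cls 0) = 0 \<odot>\<^bsub>L\<^esub> cls q" using smult[OF c0, of 0] q 0 by simp
        also have "\<dots> = cls 0" by (simp add: smult_cls)
        finally have "\<Phi> (fl.cls 0) = cls 0" .
        moreover have "P w = 0" using False no by (subst lyndon_poly.simps) auto
        moreover have "?b w = fl.cls 0" using False no by (subst lyndon_bracket.simps) (auto simp: fls fl.zero_L)
        ultimately show ?thesis by (intro bexI[of _ 0]) auto
      qed
    qed
  qed
  then show ?thesis by auto
qed

text \<open>Every letter of the alphabet contains \<open>i\<close> exactly once, so the number of
  letters of a word of weight \<open>eta k\<close> is the multiplicity of \<open>i\<close>, here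
  one.\<close>

lemma C_set_one:
  assumes "Poly_Mapping.lookup k i = 1"
  shows "C_set G \<Psi> i k = (\<lambda>x. [x]) ` {x \<in> XA. wt x = eta k}"
proof
  show "C_set G \<Psi> i k \<subseteq> (\<lambda>x. [x]) ` {x \<in> XA. wt x = eta k}"
  proof
    fix w assume w: "w \<in> C_set G \<Psi> i k"
    then have X: "w \<in> lists XA" "wtX w = eta k" unfolding C_set_def wtX_def by auto
    have "Poly_Mapping.lookup (wtX w) i = int (length w)"
      using X(1)
    proof (induction w)
      case (Cons x w)
      obtain s where s: "rep x = i # s" "i \<notin> set s" by (rule rep_form[OF Cons.hyps(1)])
      then have "Poly_Mapping.lookup (wt x) i = 1"
        using wt_rep[OF Cons.hyps(1)] by (simp add: lookup_wtl count_list_0_iff)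
      then show ?case using Cons by (simp add: wtX_def lookup_add)
    qed (simp add: wtX_def)
    then have "length w = 1" using X(2) assms by (simp add: lookup_eta)
    then obtain x where "w = [x]" by (auto simp: length_Suc_conv)
    then show "w \<in> (\<lambda>x. [x]) ` {x \<in> XA. wt x = eta k}" using X by (simp add: wtX_def)
  qed
  show "(\<lambda>x. [x]) ` {x \<in> XA. wt x = eta k} \<subseteq> C_set G \<Psi> i k"
    using lyndon_singleton unfolding C_set_def super_lyndon_def by auto
qed

theorem lyndon_basis:
  assumes k: "\<forall>j \<in> I_re A \<union> Psi_0 A \<Psi>. Poly_Mapping.lookup k j \<le> 1"
    and ki: "1 \<le> Poly_Mapping.lookup k i"
  shows "inj_on (\<lambda>w. cls (P w)) (C_set G \<Psi> i k) \<and>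
    is_basis (bkm A \<Psi>) (root_space A \<Psi> (eta k)) ((\<lambda>w. cls (P w)) ` C_set G \<Psi> i k)"
  unfolding bkm_L root_space_cls
proof (rule is_basis_clsI)
  show "P w \<in> {p. deg_homog bkm_deg (eta k) p}" if "w \<in> C_set G \<Psi> i k" for w
    using deg_homog_P[of w] that unfolding C_set_def wtX_def by auto
  show "\<forall>w\<in>S. c w = 0" if "finite S" "S \<subseteq> C_set G \<Psi> i k" "(\<Sum>w\<in>S. scl (c w) (P w)) \<in> ideal" for S c
    by (rule lyndon_poly_independent[OF k that])
  show "p \<in> na.span (ideal \<union> P ` C_set G \<Psi> i k)" if "p \<in> {p. deg_homog bkm_deg (eta k) p}" for p
    by (rule root_space_span) (use that ki in \<open>auto simp: deg_homog_def\<close>)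
qed (simp_all add: deg_homog_subspace)

end

theorem theorem6:
  fixes A :: "'i::{countable, linorder} \<Rightarrow> 'i \<Rightarrow> real"
    and \<Psi> :: "'i set"
    and G :: "'i \<Rightarrow> 'i \<Rightarrow> bool"
    and k :: "'i \<Rightarrow>\<^sub>0 nat"
    and i :: 'i
    and rep :: "'i list set \<Rightarrow> 'i list"
    and e :: "'i list set \<Rightarrow> 'i bkm_gen na set"
    and \<Phi> :: "'i list set na set \<Rightarrow> 'i bkm_gen na set"
    and \<iota> :: "'i list set list \<Rightarrow> 'i bkm_gen na set"
  assumes "bkm_supermatrix A \<Psi>"
    and "G = quasi_dynkin A"
    and "\<forall>j \<in> I_re A \<union> Psi_0 A \<Psi>. Poly_Mapping.lookup k j \<le> 1"
    and "\<forall>j. i \<le> j"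
    and "Poly_Mapping.lookup k i \<ge> 1"
    and "\<forall>w \<in> traces G. rep w \<in> w"
    and "\<forall>w \<in> traces G. e w = left_normed A \<Psi> (rep w)"
    and "\<Phi> \<in> superalgebra_hom (fls (X_alph G i) (trace_odd \<Psi>)) (bkm A \<Psi>)"
    and "\<forall>w \<in> X_alph G i. \<Phi> (fls_gen (X_alph G i) (trace_odd \<Psi>) w) = e w"
    and "\<forall>w. \<iota> w = \<Phi> (lyndon_bracket (X_alph G i) trace_less (trace_odd \<Psi>) w)"
  shows "inj_on \<iota> (C_set G \<Psi> i k)
       \<and> is_basis (bkm A \<Psi>) (root_space A \<Psi> (eta k)) (\<iota> ` C_set G \<Psi> i k)
       \<and> (Poly_Mapping.lookup k i = 1 \<longrightarrow>
            inj_on e {w \<in> X_alph G i. wt w = eta k}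
          \<and> is_basis (bkm A \<Psi>) (root_space A \<Psi> (eta k)) (e ` {w \<in> X_alph G i. wt w = eta k}))"
proof -
  interpret W: bkm_words A \<Psi> i rep
    by unfold_locales (use assms(1,2,6) in auto)
  let ?C = "C_set G \<Psi> i k" and ?E = "{w \<in> X_alph G i. wt w = eta k}"
  have e: "e x = W.cls (lnw (rep x))" if "x \<in> X_alph G i" for x
    using assms(7) that W.X_alph_traces W.left_normed_cls assms(2) by auto
  have \<iota>: "\<iota> w = W.cls (W.P w)" if "w \<in> lists (X_alph G i)" for w
    using W.hom_lyndon_bracket[of \<Phi> w] assms(8-10) e that assms(2) by auto
  have \<iota>C: "\<iota> w = W.cls (W.P w)" if "w \<in> ?C" for w
    using \<iota> that unfolding C_set_def by simp
  have basis: "inj_on \<iota> ?C" "is_basis (bkm A \<Psi>) (root_space A \<Psi> (eta k)) (\<iota> ` ?C)"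
    using W.lyndon_basis[OF assms(3,5)] \<iota>C unfolding assms(2)[symmetric]
    by (simp_all cong: inj_on_cong image_cong)
  moreover have "inj_on e ?E \<and> is_basis (bkm A \<Psi>) (root_space A \<Psi> (eta k)) (e ` ?E)"
    if "Poly_Mapping.lookup k i = 1"
  proof -
    \<comment> \<open>Words of one letter identify the left normed family with the super Lyndon
      one.\<close>
    have C: "?C = (\<lambda>x. [x]) ` ?E" using W.C_set_one[OF that] unfolding assms(2)[symmetric] .
    have ei: "e x = \<iota> [x]" if "x \<in> ?E" for x using e[of x] \<iota>[of "[x]"] that by simp
    have "inj_on (\<lambda>x. \<iota> [x]) ?E"
      using basis(1) unfolding C by (auto simp: inj_on_def)
    then have "inj_on e ?E" using ei inj_on_cong[of ?E e "\<lambda>x. \<iota> [x]"] by blast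
    moreover have "e ` ?E = \<iota> ` ?C" unfolding C image_image using ei by (rule image_cong[OF refl])
    ultimately show ?thesis using basis(2) by simp
  qed
  ultimately show ?thesis by blast
qed

end
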